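(* Let $H$ be a Hopf algebra over a field $k$ and let $A$ be a left $H$-Galois object. Then there exists a connected cogroupoid $\mathcal C$ with two objects $X,Y$ such that $H=\mathcal C(X,X)$ (as Hopf algebras) and $A=\mathcal C(X,Y)$ (as left $H$-comodule algebras, the coaction on $\mathcal C(X,Y)$ being $\Delta_{X,Y}^X$).
   Context: Algebras are associative unital $k$-algebras, $m$ denotes multiplication. A left $H$-Galois object is a left $H$-comodule algebra $A\neq(0)$ with coaction $\alpha:A\to H\otimes A$ such that $(1_H\otimes m)(\alpha\otimes 1_A):A\otimes A\to H\otimes A$ is bijective. A cocategory $\mathcal C$ consists of a set $\mathrm{ob}(\mathcal C)$; for all $X,Y\in \mathrm{ob}(\mathcal C)$ a $k$-algebra $\mathcal C(X,Y)$; and for all $X,Y,Z$ algebra morphisms $\Delta_{X,Y}^Z:\mathcal C(X,Y)\to\mathcal C(X,Z)\otimes\mathcal C(Z,Y)$ and $\varepsilon_X:\mathcal C(X,X)\to k$ such that $(\Delta_{X,Z}^T\otimes 1)\Delta_{X,Y}^Z=(1\otimes\Delta_{T,Y}^Z)\Delta_{X,Y}^T$ and $(1\otimes\varepsilon_Y)\Delta_{X,Y}^Y=\mathrm{id}=(\varepsilon_X\otimes 1)\Delta_{X,Y}^X$. A cogroupoid is a cocategory together with linear maps $S_{X,Y}:\mathcal C(X,Y)\to\mathcal C(Y,X)$ such that for all $X,Y$ and $a\in\mathcal C(X,X)$: $m(1\otimes S_{Y,X})\Delta_{X,X}^Y(a)=\varepsilon_X(a)1$ in $\mathcal C(X,Y)$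 and $m(S_{X,Y}\otimes 1)\Delta_{X,X}^Y(a)=\varepsilon_X(a)1$ in $\mathcal C(Y,X)$. It is connected if $\mathcal C(X,Y)\neq(0)$ for all $X,Y$. Each $\mathcal C(X,X)$ is a Hopf algebra with structure maps $\Delta_{X,X}^X,\varepsilon_X,S_{X,X}$. *)

theory Defs
  imports Complex_Main "HOL-Library.Function_Algebras"
begin

section \<open>Algebras over a field\<close>

text \<open>
  The ground field is a type \<open>'k :: field\<close>.  The Hom-algebras of a cogroupoid have to live in one
  type, so the underlying space of an algebra is a linear subspace \<open>acar A\<close> of a vector space given
  by a whole type and the scalar multiplication \<open>ascale A\<close>; every vector space arises in this way.
  Multiplication and all structure maps below are only constrained on the carriers.
\<close>

record ('k, 'a) kalg =
  acar :: "'a set"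
  ascale :: "'k \<Rightarrow> 'a \<Rightarrow> 'a"
  amult :: "'a \<Rightarrow> 'a \<Rightarrow> 'a"
  aone :: "'a"

definition is_space :: "('k::field, 'a::ab_group_add, 'm) kalg_scheme \<Rightarrow> bool" where
  "is_space A \<longleftrightarrow> vector_space (ascale A) \<and> module.subspace (ascale A) (acar A)"

definition linear_map ::
  "('k::field, 'a::ab_group_add, 'm) kalg_scheme \<Rightarrow> ('k, 'b::ab_group_add, 'n) kalg_scheme
    \<Rightarrow> ('a \<Rightarrow> 'b) \<Rightarrow> bool" where
  "linear_map A B f \<longleftrightarrow>
     (\<forall>x\<in>acar A. f x \<in> acar B) \<and>
     (\<forall>x\<in>acar A. \<forall>y\<in>acar A. f (x + y) = f x + f y) \<and>
     (\<forall>c. \<forall>x\<in>acar A. f (ascale A c x) = ascale B c (f x))"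

definition bilinear_map ::
  "('k::field, 'a::ab_group_add, 'm) kalg_scheme \<Rightarrow> ('k, 'b::ab_group_add, 'n) kalg_scheme
    \<Rightarrow> ('k, 'c::ab_group_add, 'o) kalg_scheme \<Rightarrow> ('a \<Rightarrow> 'b \<Rightarrow> 'c) \<Rightarrow> bool" where
  "bilinear_map A B C b \<longleftrightarrow>
     (\<forall>x\<in>acar A. linear_map B C (b x)) \<and> (\<forall>y\<in>acar B. linear_map A C (\<lambda>x. b x y))"

definition is_algebra :: "('k::field, 'a::ab_group_add, 'm) kalg_scheme \<Rightarrow> bool" where
  "is_algebra A \<longleftrightarrow>
     is_space A \<and> bilinear_map A A A (amult A) \<and> aone A \<in> acar A \<and>
     (\<forall>x\<in>acar A. \<forall>y\<in>acar A. \<forall>z\<in>acar A. amult A (amult A x y) z = amult A x (amult A y z)) \<and>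
     (\<forall>x\<in>acar A. amult A (aone A) x = x \<and> amult A x (aone A) = x)"

definition alg_hom ::
  "('k::field, 'a::ab_group_add, 'm) kalg_scheme \<Rightarrow> ('k, 'b::ab_group_add, 'n) kalg_scheme
    \<Rightarrow> ('a \<Rightarrow> 'b) \<Rightarrow> bool" where
  "alg_hom A B f \<longleftrightarrow>
     linear_map A B f \<and> f (aone A) = aone B \<and>
     (\<forall>x\<in>acar A. \<forall>y\<in>acar A. f (amult A x y) = amult B (f x) (f y))"

definition ground :: "('k::field, 'k) kalg" where
  "ground = \<lparr>acar = UNIV, ascale = (*), amult = (*), aone = 1\<rparr>"


section \<open>Tensor products\<close>

text \<open>
  The tensor product of two spaces over a field is realised as the span of the evaluation
  functionals \<open>\<beta> \<mapsto> \<beta> x y\<close> on bilinear forms.  The forms are taken on the ambient spaces, so that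
  the tensor product of subspaces is a subspace of the tensor product; this agrees with the tensor
  product of the carriers because bilinear forms on subspaces extend.  The universal property is
  proved below (\<open>tlift_tpure\<close>, \<open>tlift_linear\<close>, \<open>linear_map_tensor_unique\<close>).
\<close>

type_synonym ('a, 'b, 'k) tens = "('a \<Rightarrow> 'b \<Rightarrow> 'k) \<Rightarrow> 'k"

definition bilinear_form ::
  "('k::field, 'a::ab_group_add, 'm) kalg_scheme \<Rightarrow> ('k, 'b::ab_group_add, 'n) kalg_scheme
    \<Rightarrow> ('a \<Rightarrow> 'b \<Rightarrow> 'k) \<Rightarrow> bool" where
  "bilinear_form A B \<beta> \<longleftrightarrow>
     (\<forall>x. Vector_Spaces.linear (ascale B) (*) (\<beta> x)) \<and>
     (\<forall>y. Vector_Spaces.linear (ascale A) (*) (\<lambda>x. \<beta> x y))"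

definition tpure ::
  "('k::field, 'a::ab_group_add, 'm) kalg_scheme \<Rightarrow> ('k, 'b::ab_group_add, 'n) kalg_scheme
    \<Rightarrow> 'a \<Rightarrow> 'b \<Rightarrow> ('a, 'b, 'k) tens" where
  "tpure A B x y = (\<lambda>\<beta>. if bilinear_form A B \<beta> then \<beta> x y else 0)"

definition tscale :: "'k::field \<Rightarrow> ('a, 'b, 'k) tens \<Rightarrow> ('a, 'b, 'k) tens" where
  "tscale c t = (\<lambda>\<beta>. c * t \<beta>)"

text \<open>
  For bilinear \<open>b\<close>, \<open>tlift A B b\<close> is the induced linear map
  \<open>\<Sum>i. x i \<otimes> y i \<mapsto> \<Sum>i. b (x i) (y i)\<close>.
\<close>

definition tlift ::
  "('k::field, 'a::ab_group_add, 'm) kalg_scheme \<Rightarrow> ('k, 'b::ab_group_add, 'n) kalg_scheme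
    \<Rightarrow> ('a \<Rightarrow> 'b \<Rightarrow> 'c::ab_group_add) \<Rightarrow> ('a, 'b, 'k) tens \<Rightarrow> 'c" where
  "tlift A B b t =
     (THE u. \<exists>(n::nat) x y. (\<forall>i<n. x i \<in> acar A \<and> y i \<in> acar B) \<and>
        t = (\<Sum>i<n. tpure A B (x i) (y i)) \<and> u = (\<Sum>i<n. b (x i) (y i)))"

definition tensor ::
  "('k::field, 'a::ab_group_add, 'm) kalg_scheme \<Rightarrow> ('k, 'b::ab_group_add, 'n) kalg_scheme
    \<Rightarrow> ('k, ('a, 'b, 'k) tens) kalg"  (infixr "\<otimes>" 70) where
  "A \<otimes> B =
     \<lparr>acar = module.span tscale {tpure A B x y | x y. x \<in> acar A \<and> y \<in> acar B},
      ascale = tscale,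
      amult = (\<lambda>s t. tlift A B (\<lambda>a b. tlift A B (\<lambda>c d. tpure A B (amult A a c) (amult B b d)) t) s),
      aone = tpure A B (aone A) (aone B)\<rparr>"

text \<open>\<open>tmap A B A' B' f g\<close> is \<open>f \<otimes> g : A \<otimes> B \<rightarrow> A' \<otimes> B'\<close>.\<close>

definition tmap where
  "tmap A B A' B' f g = tlift A B (\<lambda>a b. tpure A' B' (f a) (g b))"

text \<open>
  The canonical isomorphisms \<open>(A \<otimes> B) \<otimes> C \<rightarrow> A \<otimes> (B \<otimes> C)\<close>, \<open>A \<otimes> k \<rightarrow> A\<close> and \<open>k \<otimes> A \<rightarrow> A\<close>, which
  the usual notation suppresses, and the multiplication \<open>A \<otimes> A \<rightarrow> A\<close>.
\<close>

definition tassoc where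
  "tassoc A B C =
     tlift (A \<otimes> B) C (\<lambda>t c. tlift A B (\<lambda>a b. tpure A (B \<otimes> C) a (tpure B C b c)) t)"

definition trunit where
  "trunit A = tlift A ground (\<lambda>a c. ascale A c a)"

definition tlunit where
  "tlunit A = tlift ground A (\<lambda>c a. ascale A c a)"

definition tmult where
  "tmult A = tlift A A (amult A)"


subsection \<open>The universal property\<close>

lemma vector_space_ground: "vector_space ((*) :: 'k::field \<Rightarrow> 'k \<Rightarrow> 'k)"
  by unfold_locales (auto simp: algebra_simps)

lemma vector_space_tscale:
  "vector_space (tscale :: 'k::field \<Rightarrow> ('a, 'b, 'k) tens \<Rightarrow> ('a, 'b, 'k) tens)"
  by unfold_locales (auto simp: tscale_def fun_eq_iff algebra_simps)

lemma module_tscale: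
  "module (tscale :: 'k::field \<Rightarrow> ('a, 'b, 'k) tens \<Rightarrow> ('a, 'b, 'k) tens)"
  by unfold_locales (auto simp: tscale_def fun_eq_iff algebra_simps)

lemma sum_fun_apply: "(\<Sum>i\<in>I. f i) x = (\<Sum>i\<in>I. f i x)"
  by (induction I rule: infinite_finite_induct) auto

lemma is_space_closed:
  assumes "is_space A"
  shows "0 \<in> acar A" "x \<in> acar A \<Longrightarrow> y \<in> acar A \<Longrightarrow> x + y \<in> acar A"
    "x \<in> acar A \<Longrightarrow> ascale A c x \<in> acar A"
proof -
  interpret vector_space "ascale A" using assms by (simp add: is_space_def)
  have S: "subspace (acar A)" using assms by (simp add: is_space_def)
  show "0 \<in> acar A" "x \<in> acar A \<Longrightarrow> y \<in> acar A \<Longrightarrow> x + y \<in> acar A"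
    "x \<in> acar A \<Longrightarrow> ascale A c x \<in> acar A"
    using S by (auto simp: subspace_def)
qed

lemma subspace_projection:
  assumes "is_space (A :: ('k::field, 'a::ab_group_add, 'm) kalg_scheme)"
  obtains p where "Vector_Spaces.linear (ascale A) (ascale A) p"
    "\<And>x. p x \<in> acar A" "\<And>x. x \<in> acar A \<Longrightarrow> p x = x"
proof -
  interpret vector_space_pair "ascale A" "ascale A"
    using assms by (simp add: is_space_def vector_space_pair_def)
  have "Vector_Spaces.linear (ascale A) (ascale A) (\<lambda>x. x)"
    by (rule vs1.linear_ident)
  from linear_exists_left_inverse_on[OF this, of "acar A"] assms
  show ?thesis using that by (auto simp: is_space_def)
qed

lemma bilinear_map_sum_eq_0:
  fixes A :: "('k::field, 'a::ab_group_add, 'm) kalg_scheme"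
    and B :: "('k, 'b::ab_group_add, 'n) kalg_scheme"
    and C :: "('k, 'c::ab_group_add, 'o) kalg_scheme"
  assumes A: "is_space A" and B: "is_space B" and C: "is_space C" and b: "bilinear_map A B C b"
    and xy: "\<And>i. i \<in> I \<Longrightarrow> x i \<in> acar A \<and> y i \<in> acar B"
    and 0: "(\<Sum>i\<in>I. tscale (c i) (tpure A B (x i) (y i))) = 0"
  shows "(\<Sum>i\<in>I. ascale C (c i) (b (x i) (y i))) = 0"
proof (rule ccontr)
  let ?u = "\<Sum>i\<in>I. ascale C (c i) (b (x i) (y i))"
  assume u: "?u \<noteq> 0"
  interpret CK: vector_space_pair "ascale C" "(*) :: 'k \<Rightarrow> 'k \<Rightarrow> 'k"
    using C vector_space_ground by (simp add: is_space_def vector_space_pair_def)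
  obtain f where f: "Vector_Spaces.linear (ascale C) (*) f" and fu: "f ?u = 1"
    using CK.linear_independent_extend[OF CK.vs1.independent_insertI[of ?u "{}"], of "\<lambda>_. 1"] u
    by (auto simp: CK.vs1.independent_empty)
  obtain p where p: "Vector_Spaces.linear (ascale A) (ascale A) p"
      "\<And>x. p x \<in> acar A" "\<And>x. x \<in> acar A \<Longrightarrow> p x = x"
    using subspace_projection[OF A] by blast
  obtain q where q: "Vector_Spaces.linear (ascale B) (ascale B) q"
      "\<And>x. q x \<in> acar B" "\<And>x. x \<in> acar B \<Longrightarrow> q x = x"
    using subspace_projection[OF B] by blast
  interpret f: Vector_Spaces.linear "ascale C" "(*)" f by (rule f)
  interpret p: Vector_Spaces.linear "ascale A" "ascale A" p by (rule p)
  interpret q: Vector_Spaces.linear "ascale B" "ascale B" q by (rule q)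
  define \<beta> where "\<beta> = (\<lambda>v w. f (b (p v) (q w)))"
  have \<beta>: "bilinear_form A B \<beta>"
    unfolding bilinear_form_def
  proof (intro conjI allI)
    show "Vector_Spaces.linear (ascale B) (*) (\<beta> v)" for v
      using b p(2) q(2)
      by unfold_locales
        (auto simp: \<beta>_def bilinear_map_def linear_map_def q.add q.scale f.add f.scale algebra_simps)
    show "Vector_Spaces.linear (ascale A) (*) (\<lambda>v. \<beta> v w)" for w
      using b p(2) q(2)
      by unfold_locales
        (auto simp: \<beta>_def bilinear_map_def linear_map_def p.add p.scale f.add f.scale algebra_simps)
  qed
  have "f ?u = (\<Sum>i\<in>I. c i * f (b (x i) (y i)))"
    by (simp add: f.sum f.scale)
  also have "\<dots> = (\<Sum>i\<in>I. c i * \<beta> (x i) (y i))"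
    using xy p(3) q(3) by (intro sum.cong) (auto simp: \<beta>_def)
  also have "\<dots> = (\<Sum>i\<in>I. tscale (c i) (tpure A B (x i) (y i))) \<beta>"
    using \<beta> by (simp add: sum_fun_apply tscale_def tpure_def)
  also have "\<dots> = 0" using 0 by simp
  finally show False using fu by simp
qed

lemma tpure_bilinear:
  fixes A :: "('k::field, 'a::ab_group_add, 'm) kalg_scheme"
    and B :: "('k, 'b::ab_group_add, 'n) kalg_scheme"
  shows "tpure A B (x + x') y = tpure A B x y + tpure A B x' y"
    "tpure A B x (y + y') = tpure A B x y + tpure A B x y'"
    "tpure A B (ascale A c x) y = tscale c (tpure A B x y)"
    "tpure A B x (ascale B c y) = tscale c (tpure A B x y)"
proof -
  have "\<beta> (x + x') y = \<beta> x y + \<beta> x' y \<and> \<beta> x (y + y') = \<beta> x y + \<beta> x y' \<and>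
      \<beta> (ascale A c x) y = c * \<beta> x y \<and> \<beta> x (ascale B c y) = c * \<beta> x y"
    if *: "bilinear_form A B \<beta>" for \<beta>
  proof -
    interpret l: Vector_Spaces.linear "ascale B" "(*)" "\<beta> x"
      using * by (simp add: bilinear_form_def)
    interpret r: Vector_Spaces.linear "ascale A" "(*)" "\<lambda>x. \<beta> x y"
      using * by (simp add: bilinear_form_def)
    show ?thesis by (simp add: l.add r.add l.scale r.scale)
  qed
  note * = this[THEN conjunct1] this[THEN conjunct2, THEN conjunct1]
    this[THEN conjunct2, THEN conjunct2, THEN conjunct1]
    this[THEN conjunct2, THEN conjunct2, THEN conjunct2]
  show "tpure A B (x + x') y = tpure A B x y + tpure A B x' y"
    "tpure A B x (y + y') = tpure A B x y + tpure A B x y'"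
    "tpure A B (ascale A c x) y = tscale c (tpure A B x y)"
    "tpure A B x (ascale B c y) = tscale c (tpure A B x y)"
    by (simp_all add: tpure_def tscale_def fun_eq_iff *)
qed

lemma acar_tensor_iff:
  fixes A :: "('k::field, 'a::ab_group_add, 'm) kalg_scheme"
    and B :: "('k, 'b::ab_group_add, 'n) kalg_scheme"
  assumes A: "is_space A"
  shows "t \<in> acar (A \<otimes> B) \<longleftrightarrow> (\<exists>(n::nat) x y. (\<forall>i<n. x i \<in> acar A \<and> y i \<in> acar B) \<and>
      t = (\<Sum>i<n. tpure A B (x i) (y i)))" (is "_ \<longleftrightarrow> ?R t")
proof
  interpret T: module "tscale :: 'k \<Rightarrow> ('a, 'b, 'k) tens \<Rightarrow> _" by (rule module_tscale)
  assume "t \<in> acar (A \<otimes> B)"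
  then have "t \<in> T.span {tpure A B x y | x y. x \<in> acar A \<and> y \<in> acar B}"
    by (simp add: tensor_def)
  then show "?R t"
  proof (induction rule: T.span_induct_alt)
    case base
    show ?case by (rule exI[of _ 0]) auto
  next
    case (step c s t)
    then obtain x0 y0 n x y where s: "s = tpure A B x0 y0" "x0 \<in> acar A" "y0 \<in> acar B"
      and t: "\<forall>i<n::nat. x i \<in> acar A \<and> y i \<in> acar B" "t = (\<Sum>i<n. tpure A B (x i) (y i))"
      by blast
    let ?x = "x(n := ascale A c x0)" and ?y = "y(n := y0)"
    have "\<forall>i<Suc n. ?x i \<in> acar A \<and> ?y i \<in> acar B"
      using s t is_space_closed(3)[OF A] by auto
    moreover have "tscale c s + t = (\<Sum>i<Suc n. tpure A B (?x i) (?y i))"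
      by (simp add: s t tpure_bilinear add.commute)
    ultimately show ?case by blast
  qed
next
  interpret T: module "tscale :: 'k \<Rightarrow> ('a, 'b, 'k) tens \<Rightarrow> _" by (rule module_tscale)
  assume "?R t"
  then obtain n x y where t: "\<forall>i<n::nat. x i \<in> acar A \<and> y i \<in> acar B"
      "t = (\<Sum>i<n. tpure A B (x i) (y i))" by blast
  have "t \<in> T.span {tpure A B x y | x y. x \<in> acar A \<and> y \<in> acar B}"
    unfolding t(2) by (intro T.span_sum T.span_base) (use t(1) in blast)
  then show "t \<in> acar (A \<otimes> B)" by (simp add: tensor_def)
qed

lemma tlift_sum:
  fixes A :: "('k::field, 'a::ab_group_add, 'm) kalg_scheme"
    and B :: "('k, 'b::ab_group_add, 'n) kalg_scheme"
    and C :: "('k, 'c::ab_group_add, 'o) kalg_scheme"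
  assumes A: "is_space A" and B: "is_space B" and C: "is_space C" and b: "bilinear_map A B C b"
    and xy: "\<And>i. i < (n::nat) \<Longrightarrow> x i \<in> acar A \<and> y i \<in> acar B"
  shows "tlift A B b (\<Sum>i<n. tpure A B (x i) (y i)) = (\<Sum>i<n. b (x i) (y i))"
  unfolding tlift_def
proof (rule the_equality)
  show "\<exists>m x' y'. (\<forall>i<m::nat. x' i \<in> acar A \<and> y' i \<in> acar B) \<and>
      (\<Sum>i<n. tpure A B (x i) (y i)) = (\<Sum>i<m. tpure A B (x' i) (y' i)) \<and>
      (\<Sum>i<n. b (x i) (y i)) = (\<Sum>i<m. b (x' i) (y' i))"
    by (intro exI[of _ n] exI[of _ x] exI[of _ y]) (simp add: xy)
next
  fix u
  assume "\<exists>m x' y'. (\<forall>i<m::nat. x' i \<in> acar A \<and> y' i \<in> acar B) \<and>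
      (\<Sum>i<n. tpure A B (x i) (y i)) = (\<Sum>i<m. tpure A B (x' i) (y' i)) \<and>
      u = (\<Sum>i<m. b (x' i) (y' i))"
  then obtain m x' y' where m: "\<And>i. i < (m::nat) \<Longrightarrow> x' i \<in> acar A \<and> y' i \<in> acar B"
      "(\<Sum>i<n. tpure A B (x i) (y i)) = (\<Sum>i<m. tpure A B (x' i) (y' i))"
      "u = (\<Sum>i<m. b (x' i) (y' i))" by blast
  interpret C: vector_space "ascale C" using C by (simp add: is_space_def)
  interpret T: vector_space "tscale :: 'k \<Rightarrow> ('a, 'b, 'k) tens \<Rightarrow> _" by (rule vector_space_tscale)
  let ?I = "Inl ` {..<n} \<union> Inr ` {..<m} :: (nat + nat) set"
  let ?X = "case_sum x x'" and ?Y = "case_sum y y'" and ?c = "case_sum (\<lambda>_. 1) (\<lambda>_. - 1) :: _ \<Rightarrow> 'k"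
  have split: "(\<Sum>i\<in>?I. g i) = (\<Sum>i<n. g (Inl i)) + (\<Sum>i<m. g (Inr i))"
    for g :: "nat + nat \<Rightarrow> 'z::ab_group_add"
    by (subst sum.union_disjoint) (auto simp: sum.reindex)
  have "(\<Sum>i\<in>?I. ascale C (?c i) (b (?X i) (?Y i))) = 0"
  proof (rule bilinear_map_sum_eq_0[OF A B C b])
    show "?X i \<in> acar A \<and> ?Y i \<in> acar B" if "i \<in> ?I" for i
      using that xy m(1) by auto
    show "(\<Sum>i\<in>?I. tscale (?c i) (tpure A B (?X i) (?Y i))) = 0"
      using m(2) by (simp add: split sum_negf T.scale_minus_left)
  qed
  then show "u = (\<Sum>i<n. b (x i) (y i))"
    using m(3) by (simp add: split sum_negf C.scale_minus_left)
qed

lemma tlift_tpure: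
  fixes A :: "('k::field, 'a::ab_group_add, 'm) kalg_scheme"
    and B :: "('k, 'b::ab_group_add, 'n) kalg_scheme"
    and C :: "('k, 'c::ab_group_add, 'o) kalg_scheme"
  assumes "is_space A" "is_space B" "is_space C" "bilinear_map A B C b" "x \<in> acar A" "y \<in> acar B"
  shows "tlift A B b (tpure A B x y) = b x y"
  using tlift_sum[OF assms(1-4), of "Suc 0" "\<lambda>_. x" "\<lambda>_. y"] assms(5,6)
  by (simp del: sum_constant)

lemma tlift_linear:
  fixes A :: "('k::field, 'a::ab_group_add, 'm) kalg_scheme"
    and B :: "('k, 'b::ab_group_add, 'n) kalg_scheme"
    and C :: "('k, 'c::ab_group_add, 'o) kalg_scheme"
  assumes A: "is_space A" and B: "is_space B" and C: "is_space C" and b: "bilinear_map A B C b"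
  shows "linear_map (A \<otimes> B) C (tlift A B b)"
  unfolding linear_map_def
proof (intro conjI ballI allI)
  interpret C: vector_space "ascale C" using C by (simp add: is_space_def)
  interpret T: vector_space "tscale :: 'k \<Rightarrow> ('a, 'b, 'k) tens \<Rightarrow> _" by (rule vector_space_tscale)
  fix s
  assume "s \<in> acar (A \<otimes> B)"
  then obtain n x y where s: "\<And>i. i < (n::nat) \<Longrightarrow> x i \<in> acar A \<and> y i \<in> acar B"
      "s = (\<Sum>i<n. tpure A B (x i) (y i))"
    by (auto simp: acar_tensor_iff[OF A])
  have lift_s: "tlift A B b s = (\<Sum>i<n. b (x i) (y i))"
    unfolding s(2) by (rule tlift_sum[OF A B C b]) (rule s(1))
  have "C.subspace (acar C)" using C by (simp add: is_space_def)
  then show "tlift A B b s \<in> acar C"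
    unfolding lift_s using s(1) b
    by (intro C.subspace_sum) (auto simp: bilinear_map_def linear_map_def)
  show "tlift A B b (ascale (A \<otimes> B) c s) = ascale C c (tlift A B b s)" for c
  proof -
    have "ascale (A \<otimes> B) c s = (\<Sum>i<n. tpure A B (ascale A c (x i)) (y i))"
      by (simp add: tensor_def s(2) T.scale_sum_right tpure_bilinear)
    then have "tlift A B b (ascale (A \<otimes> B) c s)
        = tlift A B b (\<Sum>i<n. tpure A B (ascale A c (x i)) (y i))" by simp
    also have "\<dots> = (\<Sum>i<n. b (ascale A c (x i)) (y i))"
      using s(1) is_space_closed(3)[OF A] by (intro tlift_sum[OF A B C b]) auto
    also have "\<dots> = (\<Sum>i<n. ascale C c (b (x i) (y i)))"
      using s(1) b by (intro sum.cong) (auto simp: bilinear_map_def linear_map_def)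
    finally show ?thesis by (simp add: lift_s C.scale_sum_right)
  qed
  fix t
  assume "t \<in> acar (A \<otimes> B)"
  then obtain m x' y' where t: "\<And>i. i < (m::nat) \<Longrightarrow> x' i \<in> acar A \<and> y' i \<in> acar B"
      "t = (\<Sum>i<m. tpure A B (x' i) (y' i))"
    by (auto simp: acar_tensor_iff[OF A])
  have lift_t: "tlift A B b t = (\<Sum>i<m. b (x' i) (y' i))"
    unfolding t(2) by (rule tlift_sum[OF A B C b]) (rule t(1))
  let ?X = "\<lambda>i. if i < n then x i else x' (i - n)"
  let ?Y = "\<lambda>i. if i < n then y i else y' (i - n)"
  have split: "(\<Sum>i<n + m. g (?X i) (?Y i)) = (\<Sum>i<n. g (x i) (y i)) + (\<Sum>i<m. g (x' i) (y' i))"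
    for g :: "'a \<Rightarrow> 'b \<Rightarrow> 'z::ab_group_add"
  proof -
    have "(\<Sum>i<n + m. h i) = (\<Sum>i<n. h i) + (\<Sum>i<m. h (n + i))" for h :: "nat \<Rightarrow> 'z"
      by (induction m) (auto simp: add.assoc)
    then show ?thesis by simp
  qed
  have "s + t = (\<Sum>i<n + m. tpure A B (?X i) (?Y i))"
    by (simp only: split s(2) t(2))
  then have "tlift A B b (s + t) = tlift A B b (\<Sum>i<n + m. tpure A B (?X i) (?Y i))" by simp
  also have "\<dots> = (\<Sum>i<n + m. b (?X i) (?Y i))"
    using s(1) t(1) by (intro tlift_sum[OF A B C b]) auto
  finally show "tlift A B b (s + t) = tlift A B b s + tlift A B b t"
    by (simp only: split lift_s lift_t)
qed

lemma linear_map_tensor_unique: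
  fixes A :: "('k::field, 'a::ab_group_add, 'm) kalg_scheme"
    and B :: "('k, 'b::ab_group_add, 'n) kalg_scheme"
    and C :: "('k, 'c::ab_group_add, 'o) kalg_scheme"
  assumes f: "linear_map (A \<otimes> B) C f" and g: "linear_map (A \<otimes> B) C g"
    and eq: "\<And>x y. x \<in> acar A \<Longrightarrow> y \<in> acar B \<Longrightarrow> f (tpure A B x y) = g (tpure A B x y)"
    and t: "t \<in> acar (A \<otimes> B)"
  shows "f t = g t"
proof -
  interpret T: module "tscale :: 'k \<Rightarrow> ('a, 'b, 'k) tens \<Rightarrow> _" by (rule module_tscale)
  let ?P = "{tpure A B x y | x y. x \<in> acar A \<and> y \<in> acar B}"
  have car: "acar (A \<otimes> B) = T.span ?P" and sc: "ascale (A \<otimes> B) = tscale"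
    by (simp_all add: tensor_def)
  have add: "h (u + v) = h u + h v" and scale: "h (tscale c u) = ascale C c (h u)"
    if "linear_map (A \<otimes> B) C h" "u \<in> T.span ?P" "v \<in> T.span ?P" for h u v c
    using that by (auto simp: linear_map_def car sc)
  have zero: "h 0 = 0" if "linear_map (A \<otimes> B) C h" for h
    using add[OF that T.span_zero T.span_zero] by simp
  have "t \<in> T.span ?P" using t car by simp
  then have "t \<in> T.span ?P \<and> f t = g t"
  proof (induction rule: T.span_induct_alt)
    case base
    show ?case by (rule conjI[OF T.span_zero]) (simp only: zero[OF f] zero[OF g])
  next
    case (step c p v)
    then have p: "p \<in> T.span ?P" "f p = g p" using eq by (auto intro: T.span_base)
    then have cp: "tscale c p \<in> T.span ?P" by (intro T.span_scale)
    from step have v: "v \<in> T.span ?P" "f v = g v" by auto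
    have "f (tscale c p + v) = g (tscale c p + v)"
      by (simp only: add[OF f cp v(1)] add[OF g cp v(1)] scale[OF f p(1) p(1)]
          scale[OF g p(1) p(1)] p(2) v(2))
    with T.span_add[OF cp v(1)] show ?case by blast
  qed
  then show ?thesis ..
qed


section \<open>Hopf algebras and Galois objects\<close>

record ('k, 'h) hopf = "('k, 'h) kalg" +
  hcomult :: "'h \<Rightarrow> ('h, 'h, 'k) tens"
  hcounit :: "'h \<Rightarrow> 'k"
  hantipode :: "'h \<Rightarrow> 'h"

definition is_hopf :: "('k::field, 'h::ab_group_add) hopf \<Rightarrow> bool" where
  "is_hopf H \<longleftrightarrow>
     is_algebra H \<and>
     alg_hom H (H \<otimes> H) (hcomult H) \<and>
     alg_hom H ground (hcounit H) \<and>
     linear_map H H (hantipode H) \<and>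
     (\<forall>x\<in>acar H.
        tassoc H H H (tmap H H (H \<otimes> H) H (hcomult H) id (hcomult H x))
          = tmap H H H (H \<otimes> H) id (hcomult H) (hcomult H x) \<and>
        trunit H (tmap H H H ground id (hcounit H) (hcomult H x)) = x \<and>
        tlunit H (tmap H H ground H (hcounit H) id (hcomult H x)) = x \<and>
        tmult H (tmap H H H H id (hantipode H) (hcomult H x)) = ascale H (hcounit H x) (aone H) \<and>
        tmult H (tmap H H H H (hantipode H) id (hcomult H x)) = ascale H (hcounit H x) (aone H))"

definition hopf_iso ::
  "('k::field, 'h::ab_group_add) hopf \<Rightarrow> ('k, 'g::ab_group_add) hopf \<Rightarrow> ('h \<Rightarrow> 'g) \<Rightarrow> bool" where
  "hopf_iso H G \<phi> \<longleftrightarrow>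
     alg_hom H G \<phi> \<and> bij_betw \<phi> (acar H) (acar G) \<and>
     (\<forall>x\<in>acar H.
        hcomult G (\<phi> x) = tmap H H G G \<phi> \<phi> (hcomult H x) \<and>
        hcounit G (\<phi> x) = hcounit H x \<and>
        hantipode G (\<phi> x) = \<phi> (hantipode H x))"

definition left_comodule_algebra ::
  "('k::field, 'h::ab_group_add) hopf \<Rightarrow> ('k, 'a::ab_group_add) kalg
    \<Rightarrow> ('a \<Rightarrow> ('h, 'a, 'k) tens) \<Rightarrow> bool" where
  "left_comodule_algebra H A \<alpha> \<longleftrightarrow>
     is_algebra A \<and> alg_hom A (H \<otimes> A) \<alpha> \<and>
     (\<forall>a\<in>acar A.
        tassoc H H A (tmap H A (H \<otimes> H) A (hcomult H) id (\<alpha> a)) = tmap H A H (H \<otimes> A) id \<alpha> (\<alpha> a) \<and>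
        tlunit A (tmap H A ground A (hcounit H) id (\<alpha> a)) = a)"

text \<open>\<open>(1 \<otimes> m) (\<alpha> \<otimes> 1) : A \<otimes> A \<rightarrow> H \<otimes> A\<close>\<close>

definition galois_map ::
  "('k::field, 'h::ab_group_add) hopf \<Rightarrow> ('k, 'a::ab_group_add) kalg
    \<Rightarrow> ('a \<Rightarrow> ('h, 'a, 'k) tens) \<Rightarrow> ('a, 'a, 'k) tens \<Rightarrow> ('h, 'a, 'k) tens" where
  "galois_map H A \<alpha> t =
     tmap H (A \<otimes> A) H A id (tmult A) (tassoc H A A (tmap A A (H \<otimes> A) A \<alpha> id t))"

definition left_galois_object ::
  "('k::field, 'h::ab_group_add) hopf \<Rightarrow> ('k, 'a::ab_group_add) kalg
    \<Rightarrow> ('a \<Rightarrow> ('h, 'a, 'k) tens) \<Rightarrow> bool" where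
  "left_galois_object H A \<alpha> \<longleftrightarrow>
     left_comodule_algebra H A \<alpha> \<and> acar A \<noteq> {0} \<and>
     bij_betw (galois_map H A \<alpha>) (acar (A \<otimes> A)) (acar (H \<otimes> A))"


section \<open>Cogroupoids\<close>

text \<open>
  \<open>comul C X Y Z\<close> is \<open>\<Delta>\<^sup>Z\<^sub>X\<^sub>,\<^sub>Y : C(X,Y) \<rightarrow> C(X,Z) \<otimes> C(Z,Y)\<close>, with the superscript last, and
  \<open>antip C X Y\<close> is \<open>S\<^sub>X\<^sub>,\<^sub>Y : C(X,Y) \<rightarrow> C(Y,X)\<close>.
  An existence statement has to name the type \<open>'c\<close>: by choice of bases,
  \<open>('h + 'a) list \<Rightarrow> 'k\<close> contains copies of all subspaces of iterated tensor products of spaces over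
  \<open>'h\<close> and \<open>'a\<close>.
\<close>

record ('o, 'k, 'c) cocat =
  ob :: "'o set"
  homalg :: "'o \<Rightarrow> 'o \<Rightarrow> ('k, 'c) kalg"
  comul :: "'o \<Rightarrow> 'o \<Rightarrow> 'o \<Rightarrow> 'c \<Rightarrow> ('c, 'c, 'k) tens"
  couni :: "'o \<Rightarrow> 'c \<Rightarrow> 'k"

record ('o, 'k, 'c) cogpd = "('o, 'k, 'c) cocat" +
  antip :: "'o \<Rightarrow> 'o \<Rightarrow> 'c \<Rightarrow> 'c"

definition is_cocategory :: "('o, 'k::field, 'c::ab_group_add, 'm) cocat_scheme \<Rightarrow> bool" where
  "is_cocategory C \<longleftrightarrow>
     (\<forall>X\<in>ob C. \<forall>Y\<in>ob C. is_algebra (homalg C X Y)) \<and>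
     (\<forall>X\<in>ob C. \<forall>Y\<in>ob C. \<forall>Z\<in>ob C.
        alg_hom (homalg C X Y) (homalg C X Z \<otimes> homalg C Z Y) (comul C X Y Z)) \<and>
     (\<forall>X\<in>ob C. alg_hom (homalg C X X) ground (couni C X)) \<and>
     (\<forall>X\<in>ob C. \<forall>Y\<in>ob C. \<forall>Z\<in>ob C. \<forall>T\<in>ob C. \<forall>a\<in>acar (homalg C X Y).
        tassoc (homalg C X T) (homalg C T Z) (homalg C Z Y)
          (tmap (homalg C X Z) (homalg C Z Y) (homalg C X T \<otimes> homalg C T Z) (homalg C Z Y)
             (comul C X Z T) id (comul C X Y Z a))
        = tmap (homalg C X T) (homalg C T Y) (homalg C X T) (homalg C T Z \<otimes> homalg C Z Y)
            id (comul C T Y Z) (comul C X Y T a)) \<and>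
     (\<forall>X\<in>ob C. \<forall>Y\<in>ob C. \<forall>a\<in>acar (homalg C X Y).
        trunit (homalg C X Y)
          (tmap (homalg C X Y) (homalg C Y Y) (homalg C X Y) ground
             id (couni C Y) (comul C X Y Y a)) = a \<and>
        tlunit (homalg C X Y)
          (tmap (homalg C X X) (homalg C X Y) ground (homalg C X Y)
             (couni C X) id (comul C X Y X a)) = a)"

definition is_cogroupoid :: "('o, 'k::field, 'c::ab_group_add) cogpd \<Rightarrow> bool" where
  "is_cogroupoid C \<longleftrightarrow>
     is_cocategory C \<and>
     (\<forall>X\<in>ob C. \<forall>Y\<in>ob C. linear_map (homalg C X Y) (homalg C Y X) (antip C X Y)) \<and>
     (\<forall>X\<in>ob C. \<forall>Y\<in>ob C. \<forall>a\<in>acar (homalg C X X).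
        tmult (homalg C X Y)
          (tmap (homalg C X Y) (homalg C Y X) (homalg C X Y) (homalg C X Y)
             id (antip C Y X) (comul C X X Y a))
        = ascale (homalg C X Y) (couni C X a) (aone (homalg C X Y)) \<and>
        tmult (homalg C Y X)
          (tmap (homalg C X Y) (homalg C Y X) (homalg C Y X) (homalg C Y X)
             (antip C X Y) id (comul C X X Y a))
        = ascale (homalg C Y X) (couni C X a) (aone (homalg C Y X)))"

definition connected_cogroupoid :: "('o, 'k::field, 'c::ab_group_add) cogpd \<Rightarrow> bool" where
  "connected_cogroupoid C \<longleftrightarrow>
     is_cogroupoid C \<and> (\<forall>X\<in>ob C. \<forall>Y\<in>ob C. acar (homalg C X Y) \<noteq> {0})"

definition hopf_at :: "('o, 'k::field, 'c::ab_group_add) cogpd \<Rightarrow> 'o \<Rightarrow> ('k, 'c) hopf" where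
  "hopf_at C X = kalg.extend (homalg C X X) (hopf.fields (comul C X X X) (couni C X) (antip C X X))"

text \<open>
  Isomorphism of a left comodule algebra \<open>(A, \<alpha>)\<close> over \<open>H\<close> with \<open>(B, \<beta>)\<close> over \<open>G\<close>, along an
  identification \<open>\<phi>\<close> of the Hopf algebras \<open>H\<close> and \<open>G\<close>.
\<close>

definition comodule_algebra_iso ::
  "('k::field, 'h::ab_group_add) hopf \<Rightarrow> ('k, 'a::ab_group_add) kalg \<Rightarrow> ('a \<Rightarrow> ('h, 'a, 'k) tens)
    \<Rightarrow> ('k, 'g::ab_group_add) hopf \<Rightarrow> ('k, 'b::ab_group_add) kalg \<Rightarrow> ('b \<Rightarrow> ('g, 'b, 'k) tens)
    \<Rightarrow> ('h \<Rightarrow> 'g) \<Rightarrow> ('a \<Rightarrow> 'b) \<Rightarrow> bool" where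
  "comodule_algebra_iso H A \<alpha> G B \<beta> \<phi> \<psi> \<longleftrightarrow>
     alg_hom A B \<psi> \<and> bij_betw \<psi> (acar A) (acar B) \<and>
     (\<forall>a\<in>acar A. \<beta> (\<psi> a) = tmap H A G B \<phi> \<psi> (\<alpha> a))"

end

theory Submission
  imports Defs
begin

text \<open>
  The Hopf algebra \<open>H\<close>, coacting on itself by its comultiplication, is itself a left
  \<open>H\<close>-Galois object.  So the theorem is the case \<open>P\<^sub>X = H\<close>, \<open>P\<^sub>Y = A\<close> of a construction that turns an
  arbitrary family of left \<open>H\<close>-Galois objects \<open>P\<^sub>Z\<close> into a connected cogroupoid:
  \<open>C(Z,W) = (P\<^sub>Z \<otimes> P\<^sub>W)\<^sup>c\<^sup>o\<^sup>H\<close>, the coinvariants of the diagonal coaction, which is a subalgebra of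
  \<open>P\<^sub>Z\<^sup>o\<^sup>p \<otimes> P\<^sub>W\<close>.  Let \<open>\<kappa>\<^sub>T : H \<rightarrow> P\<^sub>T \<otimes> P\<^sub>T\<close>, \<open>h \<mapsto> h\<^sup>1 \<otimes> h\<^sup>2\<close>, be the translation map, the inverse of the Galois
  map on \<open>h \<otimes> 1\<close>.  The structure maps are
  \<open>\<Delta>\<^sup>T(p \<otimes> q) = (p \<otimes> \<kappa>\<^sub>T(q\<^sub>-\<^sub>1)\<^sup>1) \<otimes> (\<kappa>\<^sub>T(q\<^sub>-\<^sub>1)\<^sup>2 \<otimes> q\<^sub>0)\<close>; the counit is \<open>p \<otimes> q \<mapsto> p q\<close>, which lies in \<open>k 1\<close>
  because the coinvariants of \<open>P\<^sub>Z\<close> are the scalars (\<open>coinv_product\<close>); and the antipode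
  \<open>C(Z,W) \<rightarrow> C(W,Z)\<close> is \<open>p \<otimes> q \<mapsto> (\<kappa>\<^sub>W(p\<^sub>-\<^sub>1)\<^sup>1 q) (\<kappa>\<^sub>W(p\<^sub>-\<^sub>1)\<^sup>2 \<otimes> p\<^sub>0)\<close>, in which the first factor is again a
  scalar.  On \<open>P\<^sub>X = H\<close> the translation map is \<open>h \<mapsto> h\<^sub>1 \<otimes> S h\<^sub>2\<close>, and \<open>a \<mapsto> S a\<^sub>-\<^sub>1 \<otimes> a\<^sub>0\<close> identifies every
  \<open>P\<^sub>W\<close> with \<open>C(X,W)\<close>, with inverse \<open>\<epsilon> \<otimes> 1\<close>.

  All axioms follow from four properties of \<open>\<kappa>\<close>: it inverts the Galois map; it is colinear for the
  coaction on its first leg (\<open>kappa_left_colinear\<close>); the coaction on its second leg is twisted by the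
  antipode of \<open>H\<close> (\<open>kappa_right_coaction\<close>); and it is an algebra map \<open>H \<rightarrow> P\<^sub>T \<otimes> P\<^sub>T\<^sup>o\<^sup>p\<close>
  (\<open>kappa_mult\<close>).  The last three follow by applying the injective Galois map to both sides.
  Colinearity gives coassociativity (\<open>cosum_coassoc\<close>), multiplicativity gives that \<open>\<Delta>\<^sup>T\<close> is an
  algebra map (\<open>cosum_hom_mult\<close>), and the last two properties, with coinvariance, give the antipode
  laws (\<open>antipode_right\<close>, \<open>antipode_left\<close>).  That \<open>\<Delta>\<^sup>T\<close> takes values in \<open>C(Z,T) \<otimes> C(T,W)\<close> is checked on
  slices (\<open>slices_tensor\<close>).

  Sweedler calculations are done without iterated tensor products.  An element \<open>\<Sum>i. x i \<otimes> y i\<close> is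
  represented by the functional \<open>F \<mapsto> \<Sum>i. F (x i) (y i)\<close>, so that the expression
  \<open>coact Z a (\<lambda>g b. F g b)\<close> is \<open>F a\<^sub>-\<^sub>1 a\<^sub>0\<close> and nested expressions are iterated coactions.  An identity
  between tensors becomes an equality of such sums for all multilinear \<open>F\<close>.  All spaces are realised
  inside one space of functions, and the operations are extended to the whole function space by
  means of a projection \<open>pr Z\<close> onto the carrier, so that the only side conditions are those of
  linearity.
\<close>

section \<open>Multilinear calculus on function spaces\<close>

definition fscale :: "'k::field \<Rightarrow> ('i \<Rightarrow> 'k) \<Rightarrow> ('i \<Rightarrow> 'k)" where
  "fscale c v = (\<lambda>i. c * v i)"

definition linf :: "(('i \<Rightarrow> 'k::field) \<Rightarrow> 'k) \<Rightarrow> bool" where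
  "linf f \<longleftrightarrow> (\<forall>x y. f (x + y) = f x + f y) \<and> (\<forall>c x. f (fscale c x) = c * f x)"

definition linv :: "(('i \<Rightarrow> 'k::field) \<Rightarrow> ('j \<Rightarrow> 'k)) \<Rightarrow> bool" where
  "linv g \<longleftrightarrow> (\<forall>j. linf (\<lambda>x. g x j))"

text \<open>
  A list of pairs represents the tensor that is the sum of \<open>x \<otimes> y\<close> over its entries, and
  \<open>tsum xs F\<close> is the value on this tensor of the linear map induced by a bilinear \<open>F\<close>.  The functional
  \<open>tsum xs\<close> is defined, additive and compatible with rearrangements for arbitrary \<open>F\<close>; bilinearity of
  \<open>F\<close> matters only where two lists represent the same tensor.
\<close>

definition tsum :: "('a \<times> 'b) list \<Rightarrow> ('a \<Rightarrow> 'b \<Rightarrow> 'c::ab_group_add) \<Rightarrow> 'c" where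
  "tsum xs F = (\<Sum>(x, y)\<leftarrow>xs. F x y)"

text \<open>
  The functional of a tensor with legs in the images of the projections \<open>p\<close> and \<open>q\<close>.  It comes from one
  chosen list, so that exchanging two such sums is possible without any linearity.
\<close>

definition fsum :: "('a \<Rightarrow> 'a) \<Rightarrow> ('b \<Rightarrow> 'b) \<Rightarrow> (('a \<Rightarrow> 'b \<Rightarrow> 'k::field) \<Rightarrow> 'k) \<Rightarrow> bool" where
  "fsum p q t \<longleftrightarrow> (\<exists>xs. t = tsum xs \<and> (\<forall>(x, y)\<in>set xs. p x = x \<and> q y = y))"

lemma tsum_simps [simp]:
  "tsum [] F = 0" "tsum ((x, y) # xs) F = F x y + tsum xs F"
  by (simp_all add: tsum_def)

lemma tsum_append: "tsum (xs @ ys) F = tsum xs F + tsum ys F"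
  by (simp add: tsum_def)

text \<open>
  The rules \<open>lin\<close> reduce the linearity of a Sweedler expression in one of its variables to the
  linearity of its parts.
\<close>

named_theorems lin

lemma linf_add: "linf f \<Longrightarrow> f (x + y) = f x + f y"
  and linf_scale: "linf f \<Longrightarrow> f (fscale c x) = c * f x"
  by (auto simp: linf_def)

lemma linf_0: "linf f \<Longrightarrow> f 0 = 0"
  by (metis linf_add add_0 add_cancel_right_right)

lemma linv_add: "linv g \<Longrightarrow> g (x + y) = g x + g y"
  and linv_scale: "linv g \<Longrightarrow> g (fscale c x) = fscale c (g x)"
  by (auto simp: linv_def linf_def fscale_def fun_eq_iff)

lemma linvI: "(\<And>j. linf (\<lambda>x. g x j)) \<Longrightarrow> linv g"
  by (simp add: linv_def)

lemma linv_id [lin]: "linv (\<lambda>x. x)"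
  by (auto simp: linv_def linf_def fscale_def)

lemma linf_comp: "linf f \<Longrightarrow> linv g \<Longrightarrow> linf (\<lambda>x. f (g x))"
  by (simp add: linf_def linv_add[of g] linv_scale[of g])

lemma linv_comp: "linv f \<Longrightarrow> linv g \<Longrightarrow> linv (\<lambda>x. f (g x))"
  by (rule linvI) (auto simp: linv_def[of f] intro: linf_comp)

lemma linf_cmult [lin]: "linf f \<Longrightarrow> linf (\<lambda>x. c * f x)" "linf f \<Longrightarrow> linf (\<lambda>x. f x * c)"
  by (auto simp: linf_def algebra_simps)

lemma linv_fscale [lin]: "linf f \<Longrightarrow> linv (\<lambda>x. fscale (f x) v)" "linv g \<Longrightarrow> linv (\<lambda>x. fscale c (g x))"
  by (auto simp: linv_def linf_def fscale_def algebra_simps)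

text \<open>
  The instances of this lemma are used as congruence rules: they let the simplifier drop the
  projections from every variable that is bound by a Sweedler sum.
\<close>

lemma fsum_cong:
  "fsum p q t \<Longrightarrow> (\<And>x y. p x = x \<Longrightarrow> q y = y \<Longrightarrow> F x y = G x y) \<Longrightarrow> t F = t G"
  unfolding fsum_def tsum_def by (auto intro!: arg_cong[of _ _ sum_list] map_cong)

lemma fsum_linf: "fsum p q t \<Longrightarrow> (\<And>x y. linf (\<lambda>z. F x y z)) \<Longrightarrow> linf (\<lambda>z. t (\<lambda>x y. F x y z))"
proof -
  assume F: "\<And>x y. linf (\<lambda>z. F x y z)" and "fsum p q t"
  then obtain xs where t: "t = tsum xs" by (auto simp: fsum_def)
  show "linf (\<lambda>z. t (\<lambda>x y. F x y z))"
    unfolding t by (induction xs) (use F in \<open>auto simp: linf_def algebra_simps\<close>)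
qed

lemma tsum_add: "tsum xs (\<lambda>x y. F x y + G x y) = tsum xs F + tsum xs G"
  by (induction xs) auto

lemma fsum_fubini:
  assumes "fsum p q t" "fsum p' q' s"
  shows "t (\<lambda>x y. s (\<lambda>u v. F x y u v)) = s (\<lambda>u v. t (\<lambda>x y. F x y u v))"
proof -
  obtain xs ys where t: "t = tsum xs" and s: "s = tsum ys" using assms by (auto simp: fsum_def)
  have 0: "tsum ys (\<lambda>u v. 0) = 0" by (induction ys) auto
  show ?thesis unfolding t s by (induction xs) (auto simp: tsum_add 0)
qed

text \<open>
  Vectors are functions, so a vector-valued Sweedler sum is formed coordinate by coordinate; linear
  functionals commute with it.
\<close>

lemma fsum_app:
  assumes "linf f" "fsum p q t"
  shows "f (\<lambda>i. t (\<lambda>x y. G x y i)) = t (\<lambda>x y. f (G x y))"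
proof -
  obtain xs where t: "t = tsum xs" using assms by (auto simp: fsum_def)
  have z: "f (\<lambda>i. 0) = 0" using linf_0[OF assms(1)] by (simp add: zero_fun_def)
  have a: "f (\<lambda>i. g i + g' i) = f g + f g'" for g g'
    using linf_add[OF assms(1), of g g'] by (simp add: plus_fun_def)
  show ?thesis unfolding t by (induction xs) (auto simp: z a)
qed

lemma fsum_cmult:
  assumes "fsum p q t"
  shows "t (\<lambda>x y. c * F x y) = c * t F" "t (\<lambda>x y. F x y * c) = t F * c"
proof -
  obtain xs where t: "t = tsum xs" using assms by (auto simp: fsum_def)
  show "t (\<lambda>x y. c * F x y) = c * t F" "t (\<lambda>x y. F x y * c) = t F * c"
    unfolding t by (induction xs) (auto simp: algebra_simps)
qed

lemma fsum_nested:
  assumes t: "fsum p q t" and s: "\<And>x y. p x = x \<Longrightarrow> q y = y \<Longrightarrow> fsum p' q' (s x y)"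
  shows "fsum p' q' (\<lambda>B. t (\<lambda>x y. s x y B))"
proof -
  obtain xs where t: "t = tsum xs" and xs: "\<forall>(x, y)\<in>set xs. p x = x \<and> q y = y"
    using t by (auto simp: fsum_def)
  show ?thesis unfolding t using xs
  proof (induction xs)
    case Nil
    have "(\<lambda>B. tsum [] (\<lambda>x y. s x y B)) = tsum []" by (simp add: fun_eq_iff)
    then show ?case unfolding fsum_def by (intro exI[of _ "[]"]) simp
  next
    case (Cons z xs)
    obtain x y where z: "z = (x, y)" by fastforce
    obtain us where us: "s x y = tsum us" "\<forall>(x, y)\<in>set us. p' x = x \<and> q' y = y"
      using s[of x y] Cons.prems z by (auto simp: fsum_def)
    obtain vs where vs: "(\<lambda>B. tsum xs (\<lambda>x y. s x y B)) = tsum vs"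
        "\<forall>(x, y)\<in>set vs. p' x = x \<and> q' y = y"
      using Cons by (auto simp: fsum_def)
    have "(\<lambda>B. tsum (z # xs) (\<lambda>x y. s x y B)) = tsum (us @ vs)"
      using fun_cong[OF vs(1)] by (simp add: z us(1) fun_eq_iff tsum_append)
    then show ?case unfolding fsum_def using us vs by (intro exI[of _ "us @ vs"]) auto
  qed
qed

lemma fsum_map:
  assumes t: "fsum p q t" and "\<And>x y. p x = x \<Longrightarrow> q y = y \<Longrightarrow> p' (f x) = f x \<and> q' (g y) = g y"
  shows "fsum p' q' (\<lambda>B. t (\<lambda>x y. B (f x) (g y)))"
proof (rule fsum_nested[OF t])
  fix x y assume "p x = x" "q y = y"
  then show "fsum p' q' (\<lambda>B. B (f x) (g y))"
    unfolding fsum_def using assms(2) by (intro exI[of _ "[(f x, g y)]"]) (auto simp: fun_eq_iff)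
qed

section \<open>Comodule algebras and Galois objects in Sweedler form\<close>

text \<open>
  A Hopf algebra and a family of left comodule algebras over it.  The index \<open>h\<close> is that of the Hopf
  algebra itself: \<open>coact h\<close> is its comultiplication.  The carrier of the object \<open>Z\<close> is the image of the
  projection \<open>pr Z\<close>, and each operation is extended from the carriers by precomposition with
  projections; this is why a unit law has \<open>pr Z x\<close> on its right-hand side.
\<close>

locale comodule_algebras =
  fixes h :: 'o
    and pr :: "'o \<Rightarrow> ('i \<Rightarrow> 'k::field) \<Rightarrow> ('i \<Rightarrow> 'k)"
    and M :: "'o \<Rightarrow> ('i \<Rightarrow> 'k) \<Rightarrow> ('i \<Rightarrow> 'k) \<Rightarrow> ('i \<Rightarrow> 'k)"
    and e :: "'o \<Rightarrow> ('i \<Rightarrow> 'k)"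
    and coact :: "'o \<Rightarrow> ('i \<Rightarrow> 'k) \<Rightarrow> (('i \<Rightarrow> 'k) \<Rightarrow> ('i \<Rightarrow> 'k) \<Rightarrow> 'k) \<Rightarrow> 'k"
    and eps :: "('i \<Rightarrow> 'k) \<Rightarrow> 'k"
    and S :: "('i \<Rightarrow> 'k) \<Rightarrow> ('i \<Rightarrow> 'k)"
  assumes pr_lin: "linv (pr Z)" and pr_idem [simp]: "pr Z (pr Z x) = pr Z x"
    and M_lin1: "linv (\<lambda>x. M Z x y)" and M_lin2: "linv (M Z x)"
    and pr_M [simp]: "pr Z (M Z x y) = M Z x y"
    and M_pr1 [simp]: "M Z (pr Z x) y = M Z x y" and M_pr2 [simp]: "M Z x (pr Z y) = M Z x y"
    and M_assoc: "M Z (M Z x y) z = M Z x (M Z y z)"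
    and M_e1 [simp]: "M Z (e Z) x = pr Z x" and M_e2 [simp]: "M Z x (e Z) = pr Z x"
    and pr_e [simp]: "pr Z (e Z) = e Z" and e_nz: "e Z \<noteq> 0"
    and coact_fsum: "fsum (pr h) (pr Z) (coact Z a)"
    and coact_lin: "(\<And>y. linf (\<lambda>x. F x y)) \<Longrightarrow> (\<And>x. linf (F x)) \<Longrightarrow> linf (\<lambda>a. coact Z a F)"
    and coact_pr [simp]: "coact Z (pr Z a) = coact Z a"
    and coact_M: "(\<And>y. linf (\<lambda>x. F x y)) \<Longrightarrow> (\<And>x. linf (F x)) \<Longrightarrow>
      coact Z (M Z a b) F = coact Z a (\<lambda>g x. coact Z b (\<lambda>k y. F (M h g k) (M Z x y)))"
    and coact_e: "(\<And>y. linf (\<lambda>x. F x y)) \<Longrightarrow> (\<And>x. linf (F x)) \<Longrightarrow> coact Z (e Z) F = F (e h) (e Z)"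
    and coact_coassoc: "(\<And>y z. linf (\<lambda>x. T x y z)) \<Longrightarrow> (\<And>x z. linf (\<lambda>y. T x y z)) \<Longrightarrow>
      (\<And>x y. linf (T x y)) \<Longrightarrow>
      coact Z a (\<lambda>g b. coact h g (\<lambda>x y. T x y b)) = coact Z a (\<lambda>g b. coact Z b (\<lambda>k c. T g k c))"
    and coact_counit: "linf f \<Longrightarrow> coact Z a (\<lambda>g b. eps g * f b) = f (pr Z a)"
    and eps_lin: "linf eps" and eps_M [simp]: "eps (M h x y) = eps x * eps y"
    and eps_e [simp]: "eps (e h) = 1" and eps_pr [simp]: "eps (pr h x) = eps x"
    and coact_counit': "linf f \<Longrightarrow> coact h a (\<lambda>x y. f x * eps y) = f (pr h a)"
    and S_lin: "linv S" and pr_S [simp]: "pr h (S x) = S x" and S_pr [simp]: "S (pr h x) = S x"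
    and S_right: "linf f \<Longrightarrow> coact h a (\<lambda>x y. f (M h x (S y))) = eps a * f (e h)"
    and S_left: "linf f \<Longrightarrow> coact h a (\<lambda>x y. f (M h (S x) y)) = eps a * f (e h)"
begin

lemmas op_lin [lin] = pr_lin[THEN linv_comp] M_lin1[THEN linv_comp] M_lin2[THEN linv_comp]
  S_lin[THEN linv_comp] eps_lin[THEN linf_comp]

lemma coact_linf [lin]:
  "(\<And>y. linf (\<lambda>x. F x y)) \<Longrightarrow> (\<And>x. linf (F x)) \<Longrightarrow> linv g \<Longrightarrow> linf (\<lambda>a. coact Z (g a) F)"
  using coact_lin[THEN linf_comp] by blast

lemma coact_linf' [lin]: "(\<And>x y. linf (\<lambda>z. F' x y z)) \<Longrightarrow> linf (\<lambda>z. coact Z a (\<lambda>x y. F' x y z))"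
  by (rule fsum_linf[OF coact_fsum])

lemma coact_cong [cong]:
  "a = b \<Longrightarrow> (\<And>x y. pr h x = x \<Longrightarrow> pr Z y = y \<Longrightarrow> F x y = G x y) \<Longrightarrow> coact Z a F = coact Z b G"
  by (auto intro: fsum_cong[OF coact_fsum])

lemma coact_cmult: "coact Z a (\<lambda>x y. c * F x y) = c * coact Z a F" "coact Z a (\<lambda>x y. F x y * c) = coact Z a F * c"
  by (rule fsum_cmult[OF coact_fsum])+

lemma coact_coact: "coact Z a (\<lambda>x y. coact W b (\<lambda>u v. F x y u v)) = coact W b (\<lambda>u v. coact Z a (\<lambda>x y. F x y u v))"
  by (rule fsum_fubini[OF coact_fsum coact_fsum])

end

text \<open>
  The map \<open>kappa Z\<close> is the translation map of the Galois object \<open>Z\<close>.  The assumptions \<open>can_kappa\<close> and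
  \<open>kappa_can\<close> say that \<open>h \<otimes> x \<mapsto> \<kappa>(h) (1 \<otimes> x)\<close> is a right and a left inverse of the Galois map
  \<open>a \<otimes> b \<mapsto> a\<^sub>-\<^sub>1 \<otimes> a\<^sub>0 b\<close>.  For the Hopf algebra itself the translation map is \<open>h\<^sub>1 \<otimes> S h\<^sub>2\<close>.
\<close>

locale galois_family = comodule_algebras +
  fixes kappa :: "'a \<Rightarrow> ('b \<Rightarrow> 'c::field) \<Rightarrow> (('b \<Rightarrow> 'c) \<Rightarrow> ('b \<Rightarrow> 'c) \<Rightarrow> 'c) \<Rightarrow> 'c"
  assumes kappa_fsum: "fsum (pr Z) (pr Z) (kappa Z g)"
    and kappa_lin: "(\<And>y. linf (\<lambda>x. F x y)) \<Longrightarrow> (\<And>x. linf (F x)) \<Longrightarrow> linf (\<lambda>a. kappa Z a F)"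
    and kappa_pr [simp]: "kappa Z (pr h a) = kappa Z a"
    and can_kappa: "(\<And>y. linf (\<lambda>x. F x y)) \<Longrightarrow> (\<And>x. linf (F x)) \<Longrightarrow>
      kappa Z g (\<lambda>u v. coact Z u (\<lambda>k w. F k (M Z w v))) = F (pr h g) (e Z)"
    and kappa_can: "(\<And>y. linf (\<lambda>x. F x y)) \<Longrightarrow> (\<And>x. linf (F x)) \<Longrightarrow>
      coact Z a (\<lambda>g b. kappa Z g (\<lambda>u v. F u (M Z v b))) = F (pr Z a) (e Z)"
    and kappa_h: "(\<And>y. linf (\<lambda>x. F x y)) \<Longrightarrow> (\<And>x. linf (F x)) \<Longrightarrow>
      kappa h g F = coact h g (\<lambda>x y. F x (S y))"
begin

lemma kappa_linf [lin]:
  "(\<And>y. linf (\<lambda>x. F x y)) \<Longrightarrow> (\<And>x. linf (F x)) \<Longrightarrow> linv g \<Longrightarrow> linf (\<lambda>a. kappa Z (g a) F)"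
  using kappa_lin[THEN linf_comp] by blast

lemma kappa_linf' [lin]: "(\<And>x y. linf (\<lambda>z. F' x y z)) \<Longrightarrow> linf (\<lambda>z. kappa Z a (\<lambda>x y. F' x y z))"
  by (rule fsum_linf[OF kappa_fsum])

lemma kappa_cong [cong]:
  "a = b \<Longrightarrow> (\<And>x y. pr Z x = x \<Longrightarrow> pr Z y = y \<Longrightarrow> F x y = G x y) \<Longrightarrow> kappa Z a F = kappa Z b G"
  by (auto intro: fsum_cong[OF kappa_fsum])

lemma kappa_cmult: "kappa Z a (\<lambda>x y. c * F x y) = c * kappa Z a F" "kappa Z a (\<lambda>x y. F x y * c) = kappa Z a F * c"
  by (rule fsum_cmult[OF kappa_fsum])+

lemma kappa_coact: "kappa Z a (\<lambda>x y. coact W b (\<lambda>u v. F x y u v)) = coact W b (\<lambda>u v. kappa Z a (\<lambda>x y. F x y u v))"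
  by (rule fsum_fubini[OF kappa_fsum coact_fsum])

lemma kappa_kappa: "kappa Z a (\<lambda>x y. kappa W b (\<lambda>u v. F x y u v)) = kappa W b (\<lambda>u v. kappa Z a (\<lambda>x y. F x y u v))"
  by (rule fsum_fubini[OF kappa_fsum kappa_fsum])

text \<open>
  Injectivity of the Galois map as a rewrite rule: read from right to left, it writes any
  bilinear \<open>F a b\<close> as a bilinear function of \<open>a\<^sub>-\<^sub>1 \<otimes> a\<^sub>0 b\<close>.
\<close>

lemma can_inj:
  assumes F: "\<And>y. linf (\<lambda>x. F x y)" "\<And>x. linf (F x)"
  shows "coact Z a (\<lambda>g x. kappa Z g (\<lambda>u v. F u (M Z v (M Z x b)))) = F (pr Z a) (pr Z b)"
proof -
  note [lin] = F[THEN linf_comp]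
  have "coact Z a (\<lambda>g x. kappa Z g (\<lambda>u v. (\<lambda>u w. F u (M Z w b)) u (M Z v x)))
      = F (pr Z a) (M Z (e Z) b)"
    by (subst kappa_can) (intro lin | simp)+
  then show ?thesis by (simp add: M_assoc)
qed

text \<open>
  Under the Galois map on the last two factors both sides become \<open>h\<^sub>1 \<otimes> h\<^sub>2 \<otimes> 1\<close>: the left one by
  coassociativity and \<open>h\<^sup>1\<^sub>-\<^sub>1 \<otimes> h\<^sup>1\<^sub>0 h\<^sup>2 = h \<otimes> 1\<close>.
\<close>

lemma kappa_left_colinear:
  assumes F: "\<And>y z. linf (\<lambda>x. F x y z)" "\<And>x z. linf (\<lambda>y. F x y z)" "\<And>x y. linf (F x y)"
  shows "kappa Z a (\<lambda>u v. coact Z u (\<lambda>g w. F g w v)) = coact h a (\<lambda>x y. kappa Z y (\<lambda>u v. F x u v))"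
proof -
  note [lin] = F[THEN linf_comp]
  have "kappa Z a (\<lambda>u v. coact Z u (\<lambda>g w. F g w v))
    = kappa Z a (\<lambda>u v. coact Z u (\<lambda>g w. coact Z w (\<lambda>g' x. kappa Z g' (\<lambda>u' v'. F g u' (M Z v' (M Z x v))))))"
    by (subst can_inj) (intro lin | simp)+
  also have "\<dots> = kappa Z a (\<lambda>u v. coact Z u (\<lambda>g0 x. coact h g0 (\<lambda>g g'. kappa Z g' (\<lambda>u' v'. F g u' (M Z v' (M Z x v))))))"
    by (subst coact_coassoc) (intro lin | simp)+
  also have "\<dots> = coact h (pr h a) (\<lambda>g g'. kappa Z g' (\<lambda>u' v'. F g u' (M Z v' (e Z))))"
    by (subst can_kappa[where F="\<lambda>g0 y. coact h g0 (\<lambda>g g'. kappa Z g' (\<lambda>u' v'. F g u' (M Z v' y)))"]) (intro lin | simp)+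
  finally show ?thesis by simp
qed

text \<open>
  Applying the coaction to the last factor of \<open>h\<^sup>1\<^sub>-\<^sub>1 \<otimes> h\<^sup>1\<^sub>0 h\<^sup>2 = h \<otimes> 1\<close> gives
  \<open>h\<^sup>1\<^sub>-\<^sub>2 \<otimes> h\<^sup>1\<^sub>-\<^sub>1 h\<^sup>2\<^sub>-\<^sub>1 \<otimes> h\<^sup>1\<^sub>0 h\<^sup>2\<^sub>0 = h \<otimes> 1 \<otimes> 1\<close>.  Splitting the first factor and cancelling with the
  antipode isolates the coaction of \<open>h\<^sup>2\<close>, up to the Galois map on \<open>h\<^sup>1 \<otimes> h\<^sup>2\<^sub>0\<close>.
\<close>

lemma kappa_right_coaction:
  assumes F: "\<And>y z. linf (\<lambda>x. F x y z)" "\<And>x z. linf (\<lambda>y. F x y z)" "\<And>x y. linf (F x y)"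
  shows "kappa Z a (\<lambda>u v. coact Z v (\<lambda>g w. F g u w)) = coact h a (\<lambda>x y. kappa Z x (\<lambda>u v. F (S y) u v))"
proof -
  note [lin] = F[THEN linf_comp]
  let ?\<Psi> = "\<lambda>g g' y. kappa Z g' (\<lambda>u' v'. F g u' (M Z v' y))"
  \<comment> \<open>Write the pair of the first leg and the coacted second leg through the Galois map.\<close>
  have "kappa Z a (\<lambda>u v. coact Z v (\<lambda>g w. F g u w))
    = kappa Z a (\<lambda>u v. coact Z v (\<lambda>g w. coact Z u (\<lambda>g' x. ?\<Psi> g g' (M Z x w))))"
    by (subst can_inj) (intro lin | simp)+
  also have "\<dots> = kappa Z a (\<lambda>u v. coact Z u (\<lambda>g' x. coact Z v (\<lambda>g w. ?\<Psi> g g' (M Z x w))))"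
    by (subst coact_coact) simp
  \<comment> \<open>A factor \<open>\<epsilon>(n)\<close>, which becomes \<open>S n\<^sub>1 n\<^sub>2\<close> in front of \<open>l\<close>, so that \<open>n\<^sub>2\<close> can join the coaction of \<open>v\<close>.\<close>
  also have "\<dots> = kappa Z a (\<lambda>u v. coact Z u (\<lambda>k x. coact Z v (\<lambda>l w.
      coact h k (\<lambda>m n. ?\<Psi> l m (M Z x w) * eps n))))"
    by (subst coact_counit'[where f="\<lambda>m. ?\<Psi> _ m _"]) (intro lin | simp)+
  also have "\<dots> = kappa Z a (\<lambda>u v. coact Z u (\<lambda>k x. coact Z v (\<lambda>l w.
      coact h k (\<lambda>m n. coact h n (\<lambda>n1 n2. ?\<Psi> (M h (M h (S n1) n2) l) m (M Z x w))))))"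
    by (subst S_left[where f="\<lambda>z. ?\<Psi> (M h z _) _ _"]) (intro lin | simp add: mult.commute)+
  also have "\<dots> = kappa Z a (\<lambda>u v. coact Z u (\<lambda>k x. coact Z v (\<lambda>l w.
      coact h k (\<lambda>k' n2. coact h k' (\<lambda>m n1. ?\<Psi> (M h (S n1) (M h n2 l)) m (M Z x w))))))"
    by (subst coact_coassoc[where Z=h, symmetric]) (intro lin | simp add: M_assoc)+
  also have "\<dots> = kappa Z a (\<lambda>u v. coact Z u (\<lambda>k x. coact h k (\<lambda>k' n2. coact Z v (\<lambda>l w.
      coact h k' (\<lambda>m n1. ?\<Psi> (M h (S n1) (M h n2 l)) m (M Z x w))))))"
    by (subst coact_coact) simp
  also have "\<dots> = kappa Z a (\<lambda>u v. coact Z u (\<lambda>k' x'. coact Z x' (\<lambda>n2 x. coact Z v (\<lambda>l w.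
      coact h k' (\<lambda>m n1. ?\<Psi> (M h (S n1) (M h n2 l)) m (M Z x w))))))"
    by (subst coact_coassoc[where Z=Z]) (intro lin | simp)+
  \<comment> \<open>The coactions of \<open>u\<close> and \<open>v\<close> now combine to that of the product, and the Galois map cancels.\<close>
  also have "\<dots> = kappa Z a (\<lambda>u v. coact Z u (\<lambda>k' x'. coact Z (M Z x' v) (\<lambda>l y.
      coact h k' (\<lambda>m n1. ?\<Psi> (M h (S n1) l) m y))))"
    by (subst coact_M) (intro lin | simp)+
  also have "\<dots> = coact Z (e Z) (\<lambda>l y. coact h (pr h a) (\<lambda>m n1. ?\<Psi> (M h (S n1) l) m y))"
    by (subst can_kappa[where F="\<lambda>k' y0. coact Z y0 (\<lambda>l y. coact h k' (\<lambda>m n1. ?\<Psi> (M h (S n1) l) m y))"])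
      (intro lin | simp)+
  also have "\<dots> = coact h a (\<lambda>x y. kappa Z x (\<lambda>u v. F (S y) u v))"
    by (subst coact_e) (intro lin | simp)+
  finally show ?thesis .
qed

text \<open>
  The Galois map sends the tensor on the right to \<open>a\<^sup>1\<^sub>-\<^sub>1 b\<^sup>1\<^sub>-\<^sub>1 \<otimes> a\<^sup>1\<^sub>0 b\<^sup>1\<^sub>0 b\<^sup>2 a\<^sup>2\<close>, with the inner pair of \<open>b\<close> enclosed by
  the outer pair of \<open>a\<close>; so first the inner and then the outer pair contracts, to \<open>a b \<otimes> 1\<close>.
\<close>

lemma kappa_mult:
  assumes F: "\<And>y. linf (\<lambda>x. F x y)" "\<And>x. linf (F x)"
  shows "kappa Z (M h a b) F = kappa Z a (\<lambda>u v. kappa Z b (\<lambda>u' v'. F (M Z u u') (M Z v' v)))"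
proof -
  note [lin] = F[THEN linf_comp]
  let ?\<Phi> = "\<lambda>l y. kappa Z l (\<lambda>x x'. F x (M Z x' y))"
  have "kappa Z a (\<lambda>u v. kappa Z b (\<lambda>u' v'. F (M Z u u') (M Z v' v)))
     = kappa Z a (\<lambda>u v. kappa Z b (\<lambda>u' v'. coact Z (M Z u u') (\<lambda>l x. ?\<Phi> l (M Z x (M Z v' v)))))"
    by (subst can_inj) (intro lin | simp)+
  also have "\<dots> = kappa Z a (\<lambda>u v. kappa Z b (\<lambda>u' v'. coact Z u (\<lambda>l x. coact Z u' (\<lambda>l' x'.
      ?\<Phi> (M h l l') (M Z (M Z x x') (M Z v' v))))))"
    by (subst coact_M) (intro lin | simp)+
  also have "\<dots> = kappa Z a (\<lambda>u v. coact Z u (\<lambda>l x. kappa Z b (\<lambda>u' v'. coact Z u' (\<lambda>l' x'.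
      ?\<Phi> (M h l l') (M Z x (M Z (M Z x' v') v))))))"
    by (subst kappa_coact) (simp add: M_assoc)
  also have "\<dots> = kappa Z a (\<lambda>u v. coact Z u (\<lambda>l x. ?\<Phi> (M h l b) (M Z x v)))"
    by (subst can_kappa[where F="\<lambda>l' y. ?\<Phi> (M h _ l') (M Z _ (M Z y _))"]) (intro lin | simp)+
  also have "\<dots> = kappa Z (M h a b) F"
    by (subst can_kappa[where F="\<lambda>l y. ?\<Phi> (M h l b) y"]) (intro lin | simp)+
  finally show ?thesis by simp
qed

lemma kappa_e:
  assumes F: "\<And>y. linf (\<lambda>x. F x y)" "\<And>x. linf (F x)"
  shows "kappa Z (e h) F = F (e Z) (e Z)"
proof -
  note [lin] = F[THEN linf_comp]
  have "coact Z (e Z) (\<lambda>g x. kappa Z g (\<lambda>u v. F u (M Z v x))) = F (e Z) (e Z)"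
    by (subst kappa_can) (intro lin | simp)+
  then show ?thesis
    by (subst (asm) coact_e) (intro lin | simp)+
qed

lemma kappa_contract:
  assumes [THEN linf_comp, lin]: "linf f"
  shows "kappa Z a (\<lambda>u v. f (M Z u v)) = eps a * f (e Z)"
proof -
  have "kappa Z a (\<lambda>u v. f (M Z u v)) = kappa Z a (\<lambda>u v. coact Z u (\<lambda>k w. eps k * f (M Z w v)))"
    by (subst coact_counit[where f="\<lambda>w. f (M Z w _)"]) (intro lin | simp)+
  also have "\<dots> = eps a * f (e Z)"
    by (subst can_kappa[where F="\<lambda>k y. eps k * f y"]) (intro lin | simp)+
  finally show ?thesis .
qed

end

section \<open>The spaces of coinvariants and their structure maps\<close>

text \<open>
  The tensors \<open>P\<^sub>Z \<otimes> P\<^sub>W\<close> have to be vectors of the same function space as the \<open>P\<^sub>Z\<close>, because the \<open>Hom\<close>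
  algebras are to be tensored again.  The bilinear map \<open>tau\<close> is the universal one into that space, and
  \<open>lift Z W c\<close> is the Sweedler sum over the tensor that \<open>c\<close> stands for.  The functional \<open>w Z\<close>, normalised
  at the unit, reads off scalars: \<open>x = w Z x \<cdot> 1\<close> for \<open>x \<in> k 1\<close>.
\<close>

locale galois_cogroupoid = galois_family +
  fixes tau :: "('b \<Rightarrow> 'c::field) \<Rightarrow> ('b \<Rightarrow> 'c) \<Rightarrow> ('b \<Rightarrow> 'c)"
    and lift :: "'a \<Rightarrow> 'a \<Rightarrow> ('b \<Rightarrow> 'c) \<Rightarrow> (('b \<Rightarrow> 'c) \<Rightarrow> ('b \<Rightarrow> 'c) \<Rightarrow> 'c) \<Rightarrow> 'c"
    and w :: "'a \<Rightarrow> ('b \<Rightarrow> 'c) \<Rightarrow> 'c"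
  assumes tau_lin1: "linv (\<lambda>x. tau x y)" and tau_lin2: "linv (tau x)"
    and lift_fsum: "fsum (pr Z) (pr W) (lift Z W c)"
    and lift_lin: "(\<And>y. linf (\<lambda>x. F x y)) \<Longrightarrow> (\<And>x. linf (F x)) \<Longrightarrow> linf (\<lambda>c. lift Z W c F)"
    and lift_tau: "pr Z x = x \<Longrightarrow> pr W y = y \<Longrightarrow> (\<And>y. linf (\<lambda>x. F x y)) \<Longrightarrow> (\<And>x. linf (F x)) \<Longrightarrow>
      lift Z W (tau x y) F = F x y"
    and w_lin: "linf (w Z)" and w_e [simp]: "w Z (e Z) = 1"
begin

lemmas op_lin' [lin] = tau_lin1[THEN linv_comp] tau_lin2[THEN linv_comp] w_lin[THEN linf_comp]

lemma lift_linf [lin]: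
  "(\<And>y. linf (\<lambda>x. F x y)) \<Longrightarrow> (\<And>x. linf (F x)) \<Longrightarrow> linv g \<Longrightarrow> linf (\<lambda>a. lift Z W (g a) F)"
  using lift_lin[THEN linf_comp] by blast

lemma lift_linf' [lin]: "(\<And>x y. linf (\<lambda>z. F' x y z)) \<Longrightarrow> linf (\<lambda>z. lift Z W a (\<lambda>x y. F' x y z))"
  by (rule fsum_linf[OF lift_fsum])

lemma lift_cong [cong]:
  "a = b \<Longrightarrow> (\<And>x y. pr Z x = x \<Longrightarrow> pr W y = y \<Longrightarrow> F x y = G x y) \<Longrightarrow> lift Z W a F = lift Z W b G"
  by (auto intro: fsum_cong[OF lift_fsum])

lemma lift_cmult: "lift Z W a (\<lambda>x y. c * F x y) = c * lift Z W a F"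
    "lift Z W a (\<lambda>x y. F x y * c) = lift Z W a F * c"
  by (rule fsum_cmult[OF lift_fsum])+

lemma lift_app: "linf f \<Longrightarrow> f (\<lambda>i. lift Z W c (\<lambda>p q. G p q i)) = lift Z W c (\<lambda>p q. f (G p q))"
  by (rule fsum_app[OF _ lift_fsum])

lemma coact_app: "linf f \<Longrightarrow> f (\<lambda>i. coact Z c (\<lambda>p q. G p q i)) = coact Z c (\<lambda>p q. f (G p q))"
  by (rule fsum_app[OF _ coact_fsum])

lemma kappa_app: "linf f \<Longrightarrow> f (\<lambda>i. kappa Z c (\<lambda>p q. G p q i)) = kappa Z c (\<lambda>p q. f (G p q))"
  by (rule fsum_app[OF _ kappa_fsum])

lemma scale_app: "linf f \<Longrightarrow> f (\<lambda>i. c * v i) = c * f v"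
  using linf_scale[of f c v] by (simp add: fscale_def)

lemma lift_lift: "lift Z W a (\<lambda>x y. lift Z' W' b (\<lambda>u v. F x y u v))
    = lift Z' W' b (\<lambda>u v. lift Z W a (\<lambda>x y. F x y u v))"
  by (rule fsum_fubini[OF lift_fsum lift_fsum])

text \<open>
  The structure maps of the cogroupoid.  They are defined on the whole function space; \<open>cosum\<close> is the
  comultiplication as a Sweedler sum.  The first tensor factor carries the opposite multiplication.
\<close>

definition hom_mult where
  "hom_mult Z W c d = (\<lambda>i. lift Z W c (\<lambda>p q. lift Z W d (\<lambda>p' q'. tau (M Z p' p) (M W q q') i)))"

definition hom_one where "hom_one Z W = tau (e Z) (e W)"

definition cosum where
  "cosum Z W T c B = lift Z W c (\<lambda>p q. coact W q (\<lambda>g q0. kappa T g (\<lambda>u v. B (tau p u) (tau v q0))))"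

definition counit where "counit Z c = lift Z Z c (\<lambda>p q. w Z (M Z p q))"

definition antipode where
  "antipode Z W c = (\<lambda>i. lift Z W c (\<lambda>p q. coact Z p (\<lambda>g p0. kappa W g (\<lambda>u v. w W (M W u q) * tau v p0 i))))"

text \<open>
  The first condition says that \<open>c\<close> is a tensor in \<open>P\<^sub>Z \<otimes> P\<^sub>W\<close>, the second that this tensor is
  coinvariant: \<open>p\<^sub>-\<^sub>1 q\<^sub>-\<^sub>1 \<otimes> p\<^sub>0 \<otimes> q\<^sub>0 = 1 \<otimes> p \<otimes> q\<close>.
\<close>

definition hom_car where
  "hom_car Z W = {c. (\<forall>i. c i = lift Z W c (\<lambda>p q. tau p q i)) \<and>
    (\<forall>F. (\<forall>y z. linf (\<lambda>x. F x y z)) \<longrightarrow> (\<forall>x z. linf (\<lambda>y. F x y z)) \<longrightarrow> (\<forall>x y. linf (F x y)) \<longrightarrow>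
      lift Z W c (\<lambda>p q. coact Z p (\<lambda>g p0. coact W q (\<lambda>k q0. F (M h g k) p0 q0)))
      = lift Z W c (\<lambda>p q. F (e h) p q))}"

lemma hom_carI:
  assumes "\<And>i. c i = lift Z W c (\<lambda>p q. tau p q i)"
    and "\<And>F. (\<And>y z. linf (\<lambda>x. F x y z)) \<Longrightarrow> (\<And>x z. linf (\<lambda>y. F x y z)) \<Longrightarrow> (\<And>x y. linf (F x y)) \<Longrightarrow>
      lift Z W c (\<lambda>p q. coact Z p (\<lambda>g p0. coact W q (\<lambda>k q0. F (M h g k) p0 q0)))
      = lift Z W c (\<lambda>p q. F (e h) p q)"
  shows "c \<in> hom_car Z W"
  using assms unfolding hom_car_def by blast

lemma hom_car_app:
  assumes "c \<in> hom_car Z W" "linf f"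
  shows "lift Z W c (\<lambda>p q. f (tau p q)) = f c"
proof -
  have "c = (\<lambda>i. lift Z W c (\<lambda>p q. tau p q i))" using assms(1) by (auto simp: hom_car_def)
  then have "f c = f (\<lambda>i. lift Z W c (\<lambda>p q. tau p q i))" by simp
  then show ?thesis by (simp add: lift_app[OF assms(2)])
qed

lemma coinv:
  assumes "c \<in> hom_car Z W" "\<And>y z. linf (\<lambda>x. F x y z)" "\<And>x z. linf (\<lambda>y. F x y z)" "\<And>x y. linf (F x y)"
  shows "lift Z W c (\<lambda>p q. coact Z p (\<lambda>g p0. coact W q (\<lambda>k q0. F (M h g k) p0 q0)))
      = lift Z W c (\<lambda>p q. F (e h) p q)"
  using assms unfolding hom_car_def by blast

text \<open>
  Coinvariance in the form \<open>p\<^sub>-\<^sub>1 \<otimes> p\<^sub>0 \<otimes> q = S q\<^sub>-\<^sub>1 \<otimes> p \<otimes> q\<^sub>0\<close>: multiply \<open>p\<^sub>-\<^sub>1 q\<^sub>-\<^sub>2 \<otimes> p\<^sub>0 \<otimes> q\<^sub>-\<^sub>1 \<otimes> q\<^sub>0\<close> by \<open>S q\<^sub>-\<^sub>1\<close> on the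
  right.
\<close>

lemma coinv_antipode:
  assumes c: "c \<in> hom_car Z W" and F: "\<And>y z. linf (\<lambda>x. F x y z)" "\<And>x z. linf (\<lambda>y. F x y z)" "\<And>x y. linf (F x y)"
  shows "lift Z W c (\<lambda>p q. coact Z p (\<lambda>g p0. F g p0 q)) = lift Z W c (\<lambda>p q. coact W q (\<lambda>k q0. F (S k) p q0))"
proof -
  note [lin] = F[THEN linf_comp]
  have "lift Z W c (\<lambda>p q. coact Z p (\<lambda>g p0. F g p0 q))
      = lift Z W c (\<lambda>p q. coact Z p (\<lambda>g p0. coact W q (\<lambda>k q0. eps k * F g p0 q0)))"
    by (subst coact_counit) (intro lin | simp)+
  also have "\<dots> = lift Z W c (\<lambda>p q. coact Z p (\<lambda>g p0. coact W q (\<lambda>m q0. coact h m (\<lambda>k l. F (M h g (M h k (S l))) p0 q0))))"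
    by (subst S_right[where f="\<lambda>z. F (M h _ z) _ _"]) (intro lin | simp)+
  also have "\<dots> = lift Z W c (\<lambda>p q. coact Z p (\<lambda>g p0. coact W q (\<lambda>k q'. coact W q' (\<lambda>l q0. F (M h (M h g k) (S l)) p0 q0))))"
    by (subst coact_coassoc) (intro lin | simp add: M_assoc)+
  also have "\<dots> = lift Z W c (\<lambda>p q. coact W q (\<lambda>l q0. F (M h (e h) (S l)) p q0))"
    by (subst coinv[OF c, where F="\<lambda>m p0 q'. coact W q' (\<lambda>l q0. F (M h m (S l)) p0 q0)"]) (intro lin | simp)+
  finally show ?thesis by simp
qed

text \<open>
  The product \<open>x = p q\<close> is coinvariant in \<open>P\<^sub>Z\<close>, so the Galois map takes the same value on \<open>x \<otimes> 1\<close> and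
  \<open>1 \<otimes> x\<close>.  Hence \<open>x \<otimes> 1 = 1 \<otimes> x\<close>, and applying \<open>w Z\<close> to one factor gives \<open>x = w Z x \<cdot> 1\<close>.
\<close>

lemma coinv_product:
  assumes c: "c \<in> hom_car Z Z" and [THEN linf_comp, lin]: "linf f"
  shows "lift Z Z c (\<lambda>p q. f (M Z p q)) = counit Z c * f (e Z)"
proof -
  have "lift Z Z c (\<lambda>p q. f (M Z p q))
    = lift Z Z c (\<lambda>p q. coact Z (M Z p q) (\<lambda>k x. kappa Z k (\<lambda>u v. f u * w Z (M Z v x))))"
    by (subst kappa_can[where F="\<lambda>x y. f x * w Z y"]) (intro lin | simp)+
  also have "\<dots> = lift Z Z c (\<lambda>p q. coact Z p (\<lambda>g p0. coact Z q (\<lambda>k q0. 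
      kappa Z (M h g k) (\<lambda>u v. f u * w Z (M Z v (M Z p0 q0))))))"
    by (subst coact_M) (intro lin | simp)+
  also have "\<dots> = lift Z Z c (\<lambda>p q. kappa Z (e h) (\<lambda>u v. f u * w Z (M Z v (M Z p q))))"
    by (subst coinv[OF c, where F="\<lambda>k p0 q0. kappa Z k (\<lambda>u v. f u * w Z (M Z v (M Z p0 q0)))"]) (intro lin | simp)+
  also have "\<dots> = counit Z c * f (e Z)"
    unfolding counit_def
    by (subst kappa_e) (intro lin | simp add: lift_cmult mult.commute)+
  finally show ?thesis .
qed

lemma cosum_fsum: "fsum (\<lambda>x. x) (\<lambda>x. x) (cosum Z W T c)"
  unfolding cosum_def
  by (intro fsum_nested[OF lift_fsum] fsum_nested[OF coact_fsum] fsum_map[OF kappa_fsum]) simp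

lemma cosum_linf [lin]:
  "(\<And>y. linf (\<lambda>x. F x y)) \<Longrightarrow> (\<And>x. linf (F x)) \<Longrightarrow> linv g \<Longrightarrow> linf (\<lambda>a. cosum Z W T (g a) F)"
proof -
  assume F: "\<And>y. linf (\<lambda>x. F x y)" "\<And>x. linf (F x)" and g: "linv g"
  note [lin] = F[THEN linf_comp]
  show ?thesis unfolding cosum_def by (intro lin g)
qed

lemma cosum_linf' [lin]: "(\<And>x y. linf (\<lambda>z. F' x y z)) \<Longrightarrow> linf (\<lambda>z. cosum Z W T a (\<lambda>x y. F' x y z))"
  by (rule fsum_linf[OF cosum_fsum])

lemma cosum_app: "linf f \<Longrightarrow> f (\<lambda>i. cosum Z W T c (\<lambda>p q. G p q i)) = cosum Z W T c (\<lambda>p q. f (G p q))"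
  by (rule fsum_app[OF _ cosum_fsum])

lemma linf_coord: "linv g \<Longrightarrow> linf (\<lambda>x. g x i)" by (simp add: linv_def)

lemma linv_mult [lin]: "linv g \<Longrightarrow> linv (\<lambda>x i. c * g x i)" "linf f \<Longrightarrow> linv (\<lambda>x i. f x * v i)"
  by (auto intro!: linvI lin intro: linf_coord)

lemma linv_bind [lin]:
  "(\<And>y. linv (\<lambda>x. G x y)) \<Longrightarrow> (\<And>x. linv (G x)) \<Longrightarrow> linv g \<Longrightarrow> linv (\<lambda>z i. lift Z W (g z) (\<lambda>p q. G p q i))"
  "(\<And>y. linv (\<lambda>x. G x y)) \<Longrightarrow> (\<And>x. linv (G x)) \<Longrightarrow> linv g \<Longrightarrow> linv (\<lambda>z i. coact Z (g z) (\<lambda>p q. G p q i))"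
  "(\<And>y. linv (\<lambda>x. G x y)) \<Longrightarrow> (\<And>x. linv (G x)) \<Longrightarrow> linv g \<Longrightarrow> linv (\<lambda>z i. kappa Z (g z) (\<lambda>p q. G p q i))"
  "(\<And>p q. linv (K p q)) \<Longrightarrow> linv (\<lambda>z i. lift Z W c (\<lambda>p q. K p q z i))"
  "(\<And>p q. linv (K p q)) \<Longrightarrow> linv (\<lambda>z i. coact Z c (\<lambda>p q. K p q z i))"
  "(\<And>p q. linv (K p q)) \<Longrightarrow> linv (\<lambda>z i. kappa Z c (\<lambda>p q. K p q z i))"
  by (rule linvI, intro lin, (erule linf_coord | assumption | rule linf_coord, simp)+)+

lemma hom_mult_lin [lin]: "linv g \<Longrightarrow> linv (\<lambda>x. hom_mult Z W (g x) d)" "linv g \<Longrightarrow> linv (\<lambda>x. hom_mult Z W c (g x))"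
  unfolding hom_mult_def by (intro lin, assumption)+

lemma counit_lin [lin]: "linv g \<Longrightarrow> linf (\<lambda>x. counit Z (g x))"
  unfolding counit_def by (intro lin)

lemma antipode_lin [lin]: "linv g \<Longrightarrow> linv (\<lambda>x. antipode Z W (g x))"
  unfolding antipode_def by (intro lin)

lemma hom_mult_app:
  assumes [THEN linf_comp, lin]: "linf f"
  shows "f (hom_mult Z W c d) = lift Z W c (\<lambda>p q. lift Z W d (\<lambda>p' q'. f (tau (M Z p' p) (M W q q'))))"
  unfolding hom_mult_def
  by (subst lift_app[where f=f], (intro lin)[1], subst lift_app[where f=f], (intro lin)[1]) simp

lemma lift_hom_mult:
  assumes "\<And>y. linf (\<lambda>x. F x y)" "\<And>x. linf (F x)"
  shows "lift Z W (hom_mult Z W c d) F = lift Z W c (\<lambda>p q. lift Z W d (\<lambda>p' q'. F (M Z p' p) (M W q q')))"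
  using assms by (subst hom_mult_app[where f="\<lambda>c. lift Z W c F"]) (auto intro!: lin lift_cong lift_tau)

lemma antipode_app:
  assumes [THEN linf_comp, lin]: "linf f"
  shows "f (antipode Z W c) = lift Z W c (\<lambda>p q. coact Z p (\<lambda>g p0. kappa W g (\<lambda>u v. w W (M W u q) * f (tau v p0))))"
  unfolding antipode_def
  by (subst lift_app[where f=f], (intro lin)[1], subst coact_app[where f=f], (intro lin)[1],
      subst kappa_app[where f=f], (intro lin)[1], subst scale_app[where f=f], (intro lin)[1]) simp

lemma lift_antipode:
  assumes "\<And>y. linf (\<lambda>x. F x y)" "\<And>x. linf (F x)"
  shows "lift W Z (antipode Z W c) F = lift Z W c (\<lambda>p q. coact Z p (\<lambda>g p0. kappa W g (\<lambda>u v. w W (M W u q) * F v p0)))"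
  using assms by (subst antipode_app[where f="\<lambda>c. lift W Z c F"]) (auto intro!: lin lift_cong coact_cong kappa_cong arg_cong2[where f="(*)"] lift_tau)

end

context galois_cogroupoid
begin

section \<open>The algebra structure and the comultiplication\<close>

lemma tau_coord [lin]: "linv g \<Longrightarrow> linf (\<lambda>x. tau (g x) y i)" "linv g \<Longrightarrow> linf (\<lambda>x. tau y (g x) i)"
  by (auto intro!: linf_coord lin)

lemma hom_one_hom_car: "hom_one Z W \<in> hom_car Z W"
proof (rule hom_carI)
  show "hom_one Z W i = lift Z W (hom_one Z W) (\<lambda>p q. tau p q i)" for i
    unfolding hom_one_def by (subst lift_tau) (intro lin | simp)+
  fix F :: "('b \<Rightarrow> 'c) \<Rightarrow> ('b \<Rightarrow> 'c) \<Rightarrow> ('b \<Rightarrow> 'c) \<Rightarrow> 'c"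
  assume F: "\<And>y z. linf (\<lambda>x. F x y z)" "\<And>x z. linf (\<lambda>y. F x y z)" "\<And>x y. linf (F x y)"
  note [lin] = F F[THEN linf_comp]
  have "coact Z (e Z) (\<lambda>g p0. coact W (e W) (\<lambda>k q0. F (M h g k) p0 q0)) = F (e h) (e Z) (e W)"
    by (subst coact_e[where Z=W], (intro lin)[1], (intro lin)[1], subst coact_e[where Z=Z]) (intro lin | simp)+
  then show "lift Z W (hom_one Z W) (\<lambda>p q. coact Z p (\<lambda>g p0. coact W q (\<lambda>k q0. F (M h g k) p0 q0)))
      = lift Z W (hom_one Z W) (\<lambda>p q. F (e h) p q)"
    unfolding hom_one_def by (subst (1 2) lift_tau) (intro lin | simp)+
qed

lemma hom_car_combination:
  assumes c: "c \<in> hom_car Z W" and d: "d \<in> hom_car Z W"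
  shows "fscale r c + d \<in> hom_car Z W"
proof -
  have L: "lift Z W (fscale r c + d) F = r * lift Z W c F + lift Z W d F"
    if F: "\<And>y. linf (\<lambda>x. F x y)" "\<And>x. linf (F x)" for F
    using lift_lin[OF F, of Z W] by (simp add: linf_add[of "\<lambda>c. lift Z W c F"] linf_scale[of "\<lambda>c. lift Z W c F"])
  show ?thesis
  proof (rule hom_carI)
    show "(fscale r c + d) i = lift Z W (fscale r c + d) (\<lambda>p q. tau p q i)" for i
      using c d by (subst L) (intro lin | simp add: hom_car_def fscale_def)+
    fix F :: "('b \<Rightarrow> 'c) \<Rightarrow> ('b \<Rightarrow> 'c) \<Rightarrow> ('b \<Rightarrow> 'c) \<Rightarrow> 'c"
    assume F: "\<And>y z. linf (\<lambda>x. F x y z)" "\<And>x z. linf (\<lambda>y. F x y z)" "\<And>x y. linf (F x y)"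
    note [lin] = F F[THEN linf_comp]
    show "lift Z W (fscale r c + d) (\<lambda>p q. coact Z p (\<lambda>g p0. coact W q (\<lambda>k q0. F (M h g k) p0 q0)))
        = lift Z W (fscale r c + d) (\<lambda>p q. F (e h) p q)"
      by (subst (1 2) L) (intro lin | simp add: coinv[OF c F] coinv[OF d F])+
  qed
qed

lemma hom_car_subspace:
  shows "0 \<in> hom_car Z W" and "c \<in> hom_car Z W \<Longrightarrow> d \<in> hom_car Z W \<Longrightarrow> c + d \<in> hom_car Z W"
    and "c \<in> hom_car Z W \<Longrightarrow> fscale r c \<in> hom_car Z W"
proof -
  have "fscale (- 1) v + v = 0" "fscale 1 v = v" for v :: "'b \<Rightarrow> 'c" by (auto simp: fscale_def)
  with hom_car_combination[OF hom_one_hom_car hom_one_hom_car, of "- 1" Z W]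
  show 0: "0 \<in> hom_car Z W" by simp
  show "c + d \<in> hom_car Z W" if "c \<in> hom_car Z W" "d \<in> hom_car Z W"
    using hom_car_combination[OF that, of 1] \<open>\<And>v. fscale 1 v = v\<close> by simp
  show "fscale r c \<in> hom_car Z W" if "c \<in> hom_car Z W"
    using hom_car_combination[OF that 0, of r] by simp
qed

text \<open>
  The coaction of \<open>p' p \<otimes> q q'\<close> has \<open>p'\<^sub>-\<^sub>1 p\<^sub>-\<^sub>1 q\<^sub>-\<^sub>1 q'\<^sub>-\<^sub>1\<close> in its first factor.  The opposite multiplication on
  the left leg puts \<open>p\<^sub>-\<^sub>1\<close> next to \<open>q\<^sub>-\<^sub>1\<close>, so coinvariance of \<open>c\<close> applies first, and then that of \<open>d\<close>.
\<close>

lemma hom_mult_hom_car: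
  assumes c: "c \<in> hom_car Z W" and d: "d \<in> hom_car Z W"
  shows "hom_mult Z W c d \<in> hom_car Z W"
proof (rule hom_carI)
  show "hom_mult Z W c d i = lift Z W (hom_mult Z W c d) (\<lambda>p q. tau p q i)" for i
    by (subst lift_hom_mult) (intro lin | simp add: hom_mult_def)+
  fix F :: "('b \<Rightarrow> 'c) \<Rightarrow> ('b \<Rightarrow> 'c) \<Rightarrow> ('b \<Rightarrow> 'c) \<Rightarrow> 'c"
  assume F: "\<And>y z. linf (\<lambda>x. F x y z)" "\<And>x z. linf (\<lambda>y. F x y z)" "\<And>x y. linf (F x y)"
  note [lin] = F F[THEN linf_comp]
  have "lift Z W (hom_mult Z W c d) (\<lambda>p q. coact Z p (\<lambda>g p0. coact W q (\<lambda>k q0. F (M h g k) p0 q0)))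
    = lift Z W c (\<lambda>p q. lift Z W d (\<lambda>p' q'. coact Z (M Z p' p) (\<lambda>g p0. coact W (M W q q') (\<lambda>k q0. F (M h g k) p0 q0))))"
    by (subst lift_hom_mult) (intro lin | simp)+
  also have "\<dots> = lift Z W c (\<lambda>p q. lift Z W d (\<lambda>p' q'. coact Z p' (\<lambda>g' p0'. coact Z p (\<lambda>g p0.
      coact W q (\<lambda>k q0. coact W q' (\<lambda>k' q0'. F (M h g' (M h (M h g k) k')) (M Z p0' p0) (M W q0 q0')))))))"
    by (subst coact_M[where Z=Z], (intro lin)[1], (intro lin)[1], subst coact_M[where Z=W], (intro lin)[1], (intro lin)[1]) (simp add: M_assoc)
  also have "\<dots> = lift Z W d (\<lambda>p' q'. coact Z p' (\<lambda>g' p0'. lift Z W c (\<lambda>p q. coact Z p (\<lambda>g p0.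
      coact W q (\<lambda>k q0. coact W q' (\<lambda>k' q0'. F (M h g' (M h (M h g k) k')) (M Z p0' p0) (M W q0 q0')))))))"
    by (subst lift_lift) (rule lift_cong[OF refl], rule fsum_fubini[OF lift_fsum coact_fsum])
  also have "\<dots> = lift Z W d (\<lambda>p' q'. coact Z p' (\<lambda>g' p0'. lift Z W c (\<lambda>p q. 
      coact W q' (\<lambda>k' q0'. F (M h g' (M h (e h) k')) (M Z p0' p) (M W q q0')))))"
    by (subst coinv[OF c, where F="\<lambda>m p0 q0. coact W _ (\<lambda>k' q0'. F (M h _ (M h m k')) (M Z _ p0) (M W q0 q0'))"])
      (intro lin | simp)+
  also have "\<dots> = lift Z W c (\<lambda>p q. lift Z W d (\<lambda>p' q'. coact Z p' (\<lambda>g' p0'.  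
      coact W q' (\<lambda>k' q0'. F (M h g' k') (M Z p0' p) (M W q q0')))))"
    by (subst lift_lift) (rule lift_cong[OF refl], subst fsum_fubini[OF lift_fsum coact_fsum], simp)
  also have "\<dots> = lift Z W c (\<lambda>p q. lift Z W d (\<lambda>p' q'. F (e h) (M Z p' p) (M W q q')))"
    by (subst coinv[OF d, where F="\<lambda>m p0 q0. F m (M Z p0 _) (M W _ q0)"])
      (intro lin | simp)+
  also have "\<dots> = lift Z W (hom_mult Z W c d) (\<lambda>p q. F (e h) p q)"
    by (subst lift_hom_mult) (intro lin | simp)+
  finally show "lift Z W (hom_mult Z W c d) (\<lambda>p q. coact Z p (\<lambda>g p0. coact W q (\<lambda>k q0. F (M h g k) p0 q0)))
      = lift Z W (hom_mult Z W c d) (\<lambda>p q. F (e h) p q)" .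
qed

lemma hom_mult_assoc: "hom_mult Z W (hom_mult Z W b c) d = hom_mult Z W b (hom_mult Z W c d)"
proof
  fix i
  have "hom_mult Z W (hom_mult Z W b c) d i = lift Z W b (\<lambda>p q. lift Z W c (\<lambda>p' q'. lift Z W d (\<lambda>p'' q''.
      tau (M Z p'' (M Z p' p)) (M W (M W q q') q'') i)))"
    by (subst hom_mult_def, subst lift_hom_mult) (intro lin | simp)+
  also have "\<dots> = hom_mult Z W b (hom_mult Z W c d) i"
    by (subst hom_mult_def, subst lift_hom_mult) (intro lin | simp add: M_assoc)+
  finally show "hom_mult Z W (hom_mult Z W b c) d i = hom_mult Z W b (hom_mult Z W c d) i" .
qed

lemma hom_mult_hom_one:
  assumes "c \<in> hom_car Z W"
  shows "hom_mult Z W (hom_one Z W) c = c" "hom_mult Z W c (hom_one Z W) = c"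
proof -
  have "lift Z W c (\<lambda>p q. tau p q i) = c i" for i
    using hom_car_app[OF assms linf_coord[OF linv_id]] .
  then show "hom_mult Z W (hom_one Z W) c = c" "hom_mult Z W c (hom_one Z W) = c"
    unfolding fun_eq_iff hom_mult_def hom_one_def
    by - (intro allI, subst lift_tau, (intro lin | simp)+)+
qed

lemma hom_mult_tau:
  assumes "pr Z p = p" "pr W q = q" "pr Z p' = p'" "pr W q' = q'"
  shows "hom_mult Z W (tau p q) (tau p' q') = tau (M Z p' p) (M W q q')"
  by (rule ext, unfold hom_mult_def, (subst lift_tau, (rule assms | intro lin)+)+, rule refl)

lemma cosum_hom_mult:
  assumes "\<And>y. linf (\<lambda>x. F x y)" "\<And>x. linf (F x)"
  shows "cosum Z W T (hom_mult Z W c d) F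
    = cosum Z W T c (\<lambda>x y. cosum Z W T d (\<lambda>x' y'. F (hom_mult Z T x x') (hom_mult T W y y')))"
proof -
  note [lin] = assms assms[THEN linf_comp]
  have "cosum Z W T (hom_mult Z W c d) F = lift Z W c (\<lambda>p q. lift Z W d (\<lambda>p' q'. coact W (M W q q') (\<lambda>g q0.
      kappa T g (\<lambda>u v. F (tau (M Z p' p) u) (tau v q0)))))"
    unfolding cosum_def by (subst lift_hom_mult) (intro lin | simp)+
  also have "\<dots> = lift Z W c (\<lambda>p q. lift Z W d (\<lambda>p' q'. coact W q (\<lambda>g q0. coact W q' (\<lambda>k q0'.
      kappa T g (\<lambda>u v. kappa T k (\<lambda>u' v'. F (tau (M Z p' p) (M T u u')) (tau (M T v' v) (M W q0 q0'))))))))"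
    by (subst coact_M, (intro lin)[1], (intro lin)[1], subst kappa_mult, (intro lin)[1], (intro lin)[1]) simp
  also have "\<dots> = lift Z W c (\<lambda>p q. coact W q (\<lambda>g q0. kappa T g (\<lambda>u v. lift Z W d (\<lambda>p' q'. coact W q' (\<lambda>k q0'. 
      kappa T k (\<lambda>u' v'. F (tau (M Z p' p) (M T u u')) (tau (M T v' v) (M W q0 q0'))))))))"
    by (subst fsum_fubini[OF coact_fsum lift_fsum, symmetric], subst fsum_fubini[OF kappa_fsum lift_fsum], subst kappa_coact) simp
  also have "\<dots> = cosum Z W T c (\<lambda>x y. cosum Z W T d (\<lambda>x' y'. F (hom_mult Z T x x') (hom_mult T W y y')))"
    unfolding cosum_def by (simp add: hom_mult_tau)
  finally show ?thesis .
qed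

lemma cosum_hom_one:
  assumes "\<And>y. linf (\<lambda>x. F x y)" "\<And>x. linf (F x)"
  shows "cosum Z W T (hom_one Z W) F = F (hom_one Z T) (hom_one T W)"
proof -
  note [lin] = assms assms[THEN linf_comp]
  show ?thesis
    unfolding cosum_def hom_one_def
    by (subst lift_tau, (intro lin | simp)+, subst coact_e, (intro lin)[1], (intro lin)[1], subst kappa_e, (intro lin)[1], (intro lin)[1]) simp
qed

lemma counit_hom_one: "counit Z (hom_one Z Z) = 1"
  unfolding counit_def hom_one_def by (subst lift_tau) (intro lin | simp)+

lemma counit_hom_mult:
  assumes c: "c \<in> hom_car Z Z"
  shows "counit Z (hom_mult Z Z c d) = counit Z c * counit Z d"
proof -
  have "counit Z (hom_mult Z Z c d) = lift Z Z c (\<lambda>p q. lift Z Z d (\<lambda>p' q'. w Z (M Z p' (M Z (M Z p q) q'))))"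
    unfolding counit_def by (subst lift_hom_mult) (intro lin | simp add: M_assoc)+
  also have "\<dots> = counit Z c * lift Z Z d (\<lambda>p' q'. w Z (M Z p' (M Z (e Z) q')))"
    by (subst lift_lift, subst coinv_product[OF c, where f="\<lambda>x. w Z (M Z _ (M Z x _))"])
       (intro lin | simp add: lift_cmult)+
  finally show ?thesis by (simp add: counit_def)
qed

lemma cosum_tau:
  assumes "pr Z p = p" "pr W q = q" "\<And>y. linf (\<lambda>x. F x y)" "\<And>x. linf (F x)"
  shows "cosum Z W T (tau p q) F = coact W q (\<lambda>g q0. kappa T g (\<lambda>u v. F (tau p u) (tau v q0)))"
proof -
  note [lin] = assms(3,4) assms(3,4)[THEN linf_comp]
  show ?thesis unfolding cosum_def by (subst lift_tau) (rule assms(1,2) | intro lin | simp)+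
qed

lemma counit_tau: "pr Z p = p \<Longrightarrow> pr Z q = q \<Longrightarrow> counit Z (tau p q) = w Z (M Z p q)"
  unfolding counit_def by (subst lift_tau) (assumption | intro lin | simp)+

text \<open>
  Evaluates a Sweedler sum over the comultiplication on pure tensors with legs in the carriers.
\<close>

lemma cosum_cong:
  "(\<And>p u v q. pr Z p = p \<Longrightarrow> pr T u = u \<Longrightarrow> pr T v = v \<Longrightarrow> pr W q = q \<Longrightarrow>
    F (tau p u) (tau v q) = G p u v q) \<Longrightarrow>
    cosum Z W T c F = lift Z W c (\<lambda>p q. coact W q (\<lambda>g q0. kappa T g (\<lambda>u v. G p u v q0)))"
  unfolding cosum_def by simp

text \<open>
  Both sides are \<open>p \<otimes> \<kappa>\<^sub>T(q\<^sub>-\<^sub>2) \<otimes> \<kappa>\<^sub>Z(q\<^sub>-\<^sub>1) \<otimes> q\<^sub>0\<close>; on the left this uses colinearity of \<open>\<kappa>\<^sub>Z\<close> in its first leg.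
\<close>

lemma cosum_coassoc:
  assumes "\<And>y z. linf (\<lambda>x. F x y z)" "\<And>x z. linf (\<lambda>y. F x y z)" "\<And>x y. linf (F x y)"
  shows "cosum X Y Z c (\<lambda>x y. cosum X Z T x (\<lambda>u v. F u v y)) = cosum X Y T c (\<lambda>x y. cosum T Y Z y (\<lambda>u v. F x u v))"
proof -
  note [lin] = assms assms[THEN linf_comp]
  have "cosum X Y Z c (\<lambda>x y. cosum X Z T x (\<lambda>u v. F u v y)) =
     lift X Y c (\<lambda>p q. coact Y q (\<lambda>g q0. kappa Z g (\<lambda>u v. coact Z u (\<lambda>g' u0. kappa T g' (\<lambda>u' v'. 
        F (tau p u') (tau v' u0) (tau v q0))))))"
    by (rule cosum_cong, rule cosum_tau) (assumption | intro lin)+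
  also have "\<dots> = lift X Y c (\<lambda>p q. coact Y q (\<lambda>g q0. coact h g (\<lambda>g1 g2. kappa Z g2 (\<lambda>u v. kappa T g1 (\<lambda>u' v'. 
        F (tau p u') (tau v' u) (tau v q0))))))"
    by (subst kappa_left_colinear) (intro lin | simp)+
  also have "\<dots> = lift X Y c (\<lambda>p q. coact Y q (\<lambda>g1 r. coact Y r (\<lambda>g2 q0. kappa Z g2 (\<lambda>u v. kappa T g1 (\<lambda>u' v'. 
        F (tau p u') (tau v' u) (tau v q0))))))"
    by (subst coact_coassoc) (intro lin | simp)+
  also have "\<dots> = lift X Y c (\<lambda>p q. coact Y q (\<lambda>g1 r. kappa T g1 (\<lambda>u' v'. coact Y r (\<lambda>g2 q0. kappa Z g2 (\<lambda>u v. 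
        F (tau p u') (tau v' u) (tau v q0))))))"
    by (subst kappa_kappa, subst kappa_coact) simp
  also have "\<dots> = cosum X Y T c (\<lambda>x y. cosum T Y Z y (\<lambda>u v. F x u v))"
    by (rule cosum_cong[symmetric], rule cosum_tau) (assumption | intro lin)+
  finally show ?thesis .
qed

lemma cosum_counit_right:
  assumes c: "c \<in> hom_car Z W" and f: "linf f"
  shows "cosum Z W W c (\<lambda>x y. f x * counit W y) = f c"
proof -
  note [lin] = f f[THEN linf_comp]
  have "cosum Z W W c (\<lambda>x y. f x * counit W y)
      = lift Z W c (\<lambda>p q. coact W q (\<lambda>g q0. kappa W g (\<lambda>u v. f (tau p u) * w W (M W v q0))))"
    by (rule cosum_cong) (simp add: counit_tau)
  also have "\<dots> = lift Z W c (\<lambda>p q. f (tau p q))"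
    by (subst kappa_can[where F="\<lambda>x y. f (tau _ x) * w W y"]) (intro lin | simp)+
  finally show ?thesis by (simp add: hom_car_app[OF c f])
qed

text \<open>
  The claim is \<open>p \<kappa>(q\<^sub>-\<^sub>1)\<^sup>1 \<otimes> \<kappa>(q\<^sub>-\<^sub>1)\<^sup>2 \<otimes> q\<^sub>0 = 1 \<otimes> p \<otimes> q\<close>, paired with \<open>w Z\<close>.  The Galois map takes the left-hand
  side to \<open>p\<^sub>-\<^sub>1 q\<^sub>-\<^sub>1 \<otimes> p\<^sub>0 \<otimes> q\<^sub>0\<close>, which is \<open>1 \<otimes> p \<otimes> q\<close> by coinvariance.
\<close>

lemma cosum_counit_left:
  assumes c: "c \<in> hom_car Z W" and f: "linf f"
  shows "cosum Z W Z c (\<lambda>x y. counit Z x * f y) = f c"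
proof -
  note [lin] = f f[THEN linf_comp]
  let ?F = "\<lambda>k x v. kappa Z k (\<lambda>u' v'. w Z u' * f (tau (M Z v' x) v))"
  have "cosum Z W Z c (\<lambda>x y. counit Z x * f y)
      = lift Z W c (\<lambda>p q. coact W q (\<lambda>g q0. kappa Z g (\<lambda>u v. w Z (M Z p u) * f (tau v q0))))"
    by (rule cosum_cong) (simp add: counit_tau)
  also have "\<dots> = lift Z W c (\<lambda>p q. coact W q (\<lambda>g q0. kappa Z g (\<lambda>u v. 
      coact Z (M Z p u) (\<lambda>k x. kappa Z k (\<lambda>u' v'. w Z u' * f (tau (M Z v' (M Z x v)) q0))))))"
    by (subst can_inj[where F="\<lambda>x y. w Z x * f (tau y _)"]) (intro lin | simp)+
  also have "\<dots> = lift Z W c (\<lambda>p q. coact W q (\<lambda>g q0. kappa Z g (\<lambda>u v. 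
      coact Z p (\<lambda>l p0. coact Z u (\<lambda>k x. ?F (M h l k) (M Z p0 (M Z x v)) q0)))))"
    by (subst coact_M) (intro lin | simp add: M_assoc)+
  also have "\<dots> = lift Z W c (\<lambda>p q. coact Z p (\<lambda>l p0. coact W q (\<lambda>g q0. kappa Z g (\<lambda>u v. 
       coact Z u (\<lambda>k x. ?F (M h l k) (M Z p0 (M Z x v)) q0)))))"
    by (subst kappa_coact, subst coact_coact) simp
  also have "\<dots> = lift Z W c (\<lambda>p q. coact Z p (\<lambda>l p0. coact W q (\<lambda>g q0. ?F (M h l g) p0 q0)))"
    by (subst can_kappa[where F="\<lambda>k y. ?F (M h _ k) (M Z _ y) _"]) (intro lin | simp)+
  also have "\<dots> = lift Z W c (\<lambda>p q. ?F (e h) p q)"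
    by (subst coinv[OF c, where F="?F"]) (intro lin | simp)+
  also have "\<dots> = lift Z W c (\<lambda>p q. f (tau p q))"
    by (subst kappa_e) (intro lin | simp)+
  finally show ?thesis by (simp add: hom_car_app[OF c f])
qed

end

context galois_cogroupoid
begin

section \<open>Values of the comultiplication, and the antipode\<close>

text \<open>
  Applying a linear functional to the right factor of \<open>\<Delta>\<^sup>T(c)\<close> leaves a coinvariant of \<open>P\<^sub>Z \<otimes> P\<^sub>T\<close>: by
  colinearity of \<open>\<kappa>\<^sub>T\<close> the coaction on \<open>p \<otimes> \<kappa>\<^sub>T(q\<^sub>-\<^sub>1)\<^sup>1\<close> produces \<open>p\<^sub>-\<^sub>1 q\<^sub>-\<^sub>2\<close>, and the coinvariance of \<open>c\<close> removes it.
\<close>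

lemma cosum_left_slice:
  assumes c: "c \<in> hom_car Z W" and f: "linf f"
  shows "(\<lambda>i. cosum Z W T c (\<lambda>x y. f y * x i)) \<in> hom_car Z T"
proof -
  let ?s = "\<lambda>i. cosum Z W T c (\<lambda>x y. f y * x i)"
  note [lin] = f f[THEN linf_comp]
  have lift_s: "lift Z T ?s F = lift Z W c (\<lambda>p q. coact W q (\<lambda>g q0. kappa T g (\<lambda>u v. f (tau v q0) * F p u)))"
    if F: "\<And>y. linf (\<lambda>x. F x y)" "\<And>x. linf (F x)" for F
  proof -
    note [lin] = F F[THEN linf_comp]
    have "lift Z T ?s F = cosum Z W T c (\<lambda>x y. f y * lift Z T x F)"
      by (subst cosum_app[where f="\<lambda>s. lift Z T s F"], (intro lin)[1], subst scale_app[where f="\<lambda>s. lift Z T s F"]) (intro lin refl)+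
    also have "\<dots> = lift Z W c (\<lambda>p q. coact W q (\<lambda>g q0. kappa T g (\<lambda>u v. f (tau v q0) * F p u)))"
      by (rule cosum_cong, subst lift_tau) (assumption | intro lin | rule refl)+
    finally show ?thesis .
  qed
  show ?thesis
  proof (rule hom_carI)
    show "?s i = lift Z T ?s (\<lambda>p q. tau p q i)" for i
      by (subst lift_s) (intro lin | simp add: cosum_def)+
    fix F :: "('b \<Rightarrow> 'c) \<Rightarrow> ('b \<Rightarrow> 'c) \<Rightarrow> ('b \<Rightarrow> 'c) \<Rightarrow> 'c"
    assume F: "\<And>y z. linf (\<lambda>x. F x y z)" "\<And>x z. linf (\<lambda>y. F x y z)" "\<And>x y. linf (F x y)"
    note [lin] = F F[THEN linf_comp]
    have "lift Z T ?s (\<lambda>p q. coact Z p (\<lambda>g p0. coact T q (\<lambda>k q0. F (M h g k) p0 q0)))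
      = lift Z W c (\<lambda>p q. coact W q (\<lambda>g q0. kappa T g (\<lambda>u v. f (tau v q0) *
          coact Z p (\<lambda>l p0. coact T u (\<lambda>m u0. F (M h l m) p0 u0)))))"
      by (subst lift_s) (intro lin refl)+
    also have "\<dots> = lift Z W c (\<lambda>p q. coact W q (\<lambda>g q0. coact Z p (\<lambda>l p0. kappa T g (\<lambda>u v. 
          coact T u (\<lambda>m u0. f (tau v q0) * F (M h l m) p0 u0)))))"
      by (simp only: coact_cmult[symmetric], subst kappa_coact, rule refl)
    also have "\<dots> = lift Z W c (\<lambda>p q. coact W q (\<lambda>g q0. coact Z p (\<lambda>l p0. coact h g (\<lambda>m g'. kappa T g' (\<lambda>u v. 
          f (tau v q0) * F (M h l m) p0 u)))))"
      by (subst kappa_left_colinear) (intro lin refl)+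
    also have "\<dots> = lift Z W c (\<lambda>p q. coact Z p (\<lambda>l p0. coact W q (\<lambda>g q0. coact h g (\<lambda>m g'. kappa T g' (\<lambda>u v. 
          f (tau v q0) * F (M h l m) p0 u)))))"
      by (subst coact_coact) (rule refl)
    also have "\<dots> = lift Z W c (\<lambda>p q. coact Z p (\<lambda>l p0. coact W q (\<lambda>m r. coact W r (\<lambda>g' q0. kappa T g' (\<lambda>u v. 
          f (tau v q0) * F (M h l m) p0 u)))))"
      by (subst coact_coassoc) (intro lin refl)+
    also have "\<dots> = lift Z W c (\<lambda>p q. coact W q (\<lambda>g' q0. kappa T g' (\<lambda>u v. f (tau v q0) * F (e h) p u)))"
      by (subst coinv[OF c, where F="\<lambda>m p r. coact W r (\<lambda>g' q0. kappa T g' (\<lambda>u v. f (tau v q0) * F m p u))"])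
        (intro lin refl)+
    also have "\<dots> = lift Z T ?s (\<lambda>p q. F (e h) p q)"
      by (subst lift_s) (intro lin refl)+
    finally show "lift Z T ?s (\<lambda>p q. coact Z p (\<lambda>g p0. coact T q (\<lambda>k q0. F (M h g k) p0 q0)))
      = lift Z T ?s (\<lambda>p q. F (e h) p q)" .
  qed
qed

text \<open>
  For every \<open>q\<close>, the tensor \<open>\<kappa>\<^sub>T(q\<^sub>-\<^sub>1)\<^sup>2 \<otimes> q\<^sub>0\<close> is coinvariant: the twisted coaction on the second leg of
  \<open>\<kappa>\<^sub>T\<close> contributes \<open>S q\<^sub>-\<^sub>2\<close>, which cancels with \<open>q\<^sub>-\<^sub>1\<close>.  The right factor of the comultiplication and
  the values of the antipode are both of this form.
\<close>

lemma coact_kappa_coinv: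
  assumes F: "\<And>y z r. linf (\<lambda>x. F x y z r)" "\<And>x z r. linf (\<lambda>y. F x y z r)" "\<And>x y r. linf (\<lambda>z. F x y z r)" "\<And>x y z. linf (F x y z)"
  shows "coact W q (\<lambda>g b. kappa T g (\<lambda>u v. coact T v (\<lambda>k v0. coact W b (\<lambda>l b0. F (M h k l) u v0 b0))))
    = coact W q (\<lambda>g b. kappa T g (\<lambda>u v. F (e h) u v b))"
proof -
  note [lin] = F F[THEN linf_comp]
  have "coact W q (\<lambda>g b. kappa T g (\<lambda>u v. coact T v (\<lambda>k v0. coact W b (\<lambda>l b0. F (M h k l) u v0 b0))))
    = coact W q (\<lambda>g b. coact h g (\<lambda>x y. kappa T x (\<lambda>u v. coact W b (\<lambda>l b0. F (M h (S y) l) u v b0))))"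
    by (subst kappa_right_coaction) (intro lin refl)+
  also have "\<dots> = coact W q (\<lambda>x r. coact W r (\<lambda>y b. kappa T x (\<lambda>u v. coact W b (\<lambda>l b0. F (M h (S y) l) u v b0))))"
    by (subst coact_coassoc) (intro lin refl)+
  also have "\<dots> = coact W q (\<lambda>x r. coact W r (\<lambda>y b. coact W b (\<lambda>l b0. kappa T x (\<lambda>u v. F (M h (S y) l) u v b0))))"
    by (subst kappa_coact) (rule refl)
  also have "\<dots> = coact W q (\<lambda>x r. coact W r (\<lambda>m b0. coact h m (\<lambda>y l. kappa T x (\<lambda>u v. F (M h (S y) l) u v b0))))"
    by (subst coact_coassoc) (intro lin refl)+
  also have "\<dots> = coact W q (\<lambda>x r. coact W r (\<lambda>m b0. eps m * kappa T x (\<lambda>u v. F (e h) u v b0)))"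
    by (subst S_left[where f="\<lambda>z. kappa T _ (\<lambda>u v. F z u v _)"]) (intro lin refl)+
  also have "\<dots> = coact W q (\<lambda>x r. kappa T x (\<lambda>u v. F (e h) u v r))"
    by (subst coact_counit[where f="\<lambda>b0. kappa T _ (\<lambda>u v. F (e h) u v b0)"]) (intro lin | simp)+
  finally show ?thesis .
qed

lemma cosum_right_slice:
  assumes f: "linf f"
  shows "(\<lambda>i. cosum Z W T c (\<lambda>x y. f x * y i)) \<in> hom_car T W"
proof -
  let ?s = "\<lambda>i. cosum Z W T c (\<lambda>x y. f x * y i)"
  note [lin] = f f[THEN linf_comp]
  have lift_s: "lift T W ?s F = lift Z W c (\<lambda>p q. coact W q (\<lambda>g q0. kappa T g (\<lambda>u v. f (tau p u) * F v q0)))"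
    if F: "\<And>y. linf (\<lambda>x. F x y)" "\<And>x. linf (F x)" for F
  proof -
    note [lin] = F F[THEN linf_comp]
    have "lift T W ?s F = cosum Z W T c (\<lambda>x y. f x * lift T W y F)"
      by (subst cosum_app[where f="\<lambda>s. lift T W s F"], (intro lin)[1], subst scale_app[where f="\<lambda>s. lift T W s F"]) (intro lin refl)+
    also have "\<dots> = lift Z W c (\<lambda>p q. coact W q (\<lambda>g q0. kappa T g (\<lambda>u v. f (tau p u) * F v q0)))"
      by (rule cosum_cong, subst lift_tau) (assumption | intro lin | rule refl)+
    finally show ?thesis .
  qed
  show ?thesis
  proof (rule hom_carI)
    show "?s i = lift T W ?s (\<lambda>p q. tau p q i)" for i
      by (subst lift_s) (intro lin | simp add: cosum_def)+
    fix F :: "('b \<Rightarrow> 'c) \<Rightarrow> ('b \<Rightarrow> 'c) \<Rightarrow> ('b \<Rightarrow> 'c) \<Rightarrow> 'c"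
    assume F: "\<And>y z. linf (\<lambda>x. F x y z)" "\<And>x z. linf (\<lambda>y. F x y z)" "\<And>x y. linf (F x y)"
    note [lin] = F F[THEN linf_comp]
    have "lift T W ?s (\<lambda>p q. coact T p (\<lambda>g p0. coact W q (\<lambda>k q0. F (M h g k) p0 q0)))
      = lift Z W c (\<lambda>p q. coact W q (\<lambda>g q0. kappa T g (\<lambda>u v. f (tau p u) *
          coact T v (\<lambda>l p0. coact W q0 (\<lambda>m u0. F (M h l m) p0 u0)))))"
      by (subst lift_s) (intro lin refl)+
    also have "\<dots> = lift Z W c (\<lambda>p q. coact W q (\<lambda>g q0. kappa T g (\<lambda>u v. f (tau p u) * F (e h) v q0)))"
      by (simp only: coact_cmult[symmetric], 
        subst coact_kappa_coinv[where F="\<lambda>k u v b. f (tau _ u) * F k v b"]) (intro lin refl)+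
    also have "\<dots> = lift T W ?s (\<lambda>p q. F (e h) p q)"
      by (subst lift_s) (intro lin refl)+
    finally show "lift T W ?s (\<lambda>p q. coact T p (\<lambda>g p0. coact W q (\<lambda>k q0. F (M h g k) p0 q0)))
      = lift T W ?s (\<lambda>p q. F (e h) p q)" .
  qed
qed

lemma antipode_hom_car: "antipode Z W c \<in> hom_car W Z"
proof (rule hom_carI)
  show "antipode Z W c i = lift W Z (antipode Z W c) (\<lambda>p q. tau p q i)" for i
    by (subst lift_antipode) (intro lin | simp add: antipode_def)+
  fix F :: "('b \<Rightarrow> 'c) \<Rightarrow> ('b \<Rightarrow> 'c) \<Rightarrow> ('b \<Rightarrow> 'c) \<Rightarrow> 'c"
  assume F: "\<And>y z. linf (\<lambda>x. F x y z)" "\<And>x z. linf (\<lambda>y. F x y z)" "\<And>x y. linf (F x y)"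
  note [lin] = F F[THEN linf_comp]
  show "lift W Z (antipode Z W c) (\<lambda>p q. coact W p (\<lambda>g p0. coact Z q (\<lambda>k q0. F (M h g k) p0 q0)))
      = lift W Z (antipode Z W c) (\<lambda>p q. F (e h) p q)"
    by (subst lift_antipode, (intro lin)[1], (intro lin)[1], subst lift_antipode, (intro lin)[1], (intro lin)[1], simp only: coact_cmult[symmetric], 
       subst coact_kappa_coinv[where F="\<lambda>k u v b. w W (M W u _) * F k v b"]) (intro lin refl)+
qed

lemma antipode_tau:
  assumes "pr Z p = p" "pr W q = q" "linf f"
  shows "f (antipode Z W (tau p q)) = coact Z p (\<lambda>g p0. kappa W g (\<lambda>u v. w W (M W u q) * f (tau v p0)))"
proof -
  note [lin] = assms(3) assms(3)[THEN linf_comp]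
  show ?thesis
    by (subst antipode_app, (intro lin)[1], subst lift_tau) (rule assms(1,2) | intro lin | simp)+
qed

text \<open>
  The expression is a function of \<open>p\<close>, \<open>q\<^sub>0\<close>, \<open>\<kappa>\<^sub>T(q\<^sub>-\<^sub>1)\<^sup>1\<close> and the coaction of \<open>\<kappa>\<^sub>T(q\<^sub>-\<^sub>1)\<^sup>2\<close>.  Moving the latter to
  \<open>S q\<^sub>-\<^sub>1\<close> allows the two legs of \<open>\<kappa>\<^sub>T\<close> to be multiplied to a scalar; \<open>coinv_antipode\<close> then turns \<open>S q\<^sub>-\<^sub>1\<close>
  into \<open>p\<^sub>-\<^sub>1\<close>, and \<open>\<kappa>\<^sub>Z(p\<^sub>-\<^sub>1)(1 \<otimes> p\<^sub>0)\<close> is \<open>p \<otimes> 1\<close>.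
\<close>

lemma antipode_right:
  assumes c: "c \<in> hom_car Z Z" and f: "linf f"
  shows "cosum Z Z T c (\<lambda>x y. f (hom_mult Z T x (antipode T Z y))) = counit Z c * f (hom_one Z T)"
proof -
  note [lin] = f f[THEN linf_comp]
  have "f (hom_mult Z T (tau p u) (antipode T Z (tau v q0))) = coact T v (\<lambda>g v0. kappa Z g (\<lambda>u' v'. w Z (M Z u' q0) * f (tau (M Z v' p) (M T u v0))))"
    if "pr Z p = p" "pr T u = u" "pr T v = v" "pr Z q0 = q0" for p u v q0
  proof -
    have "f (hom_mult Z T (tau p u) (antipode T Z (tau v q0))) = coact T v (\<lambda>g v0. kappa Z g (\<lambda>u' v'. w Z (M Z u' q0) * f (hom_mult Z T (tau p u) (tau v' v0))))"
      by (rule antipode_tau[where f="\<lambda>z. f (hom_mult Z T (tau p u) z)"]) (rule that | intro lin)+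
    then show ?thesis using that by (simp add: hom_mult_tau)
  qed
  then have "cosum Z Z T c (\<lambda>x y. f (hom_mult Z T x (antipode T Z y))) =
    lift Z Z c (\<lambda>p q. coact Z q (\<lambda>g q0. kappa T g (\<lambda>u v.
      coact T v (\<lambda>g v0. kappa Z g (\<lambda>u' v'. w Z (M Z u' q0) * f (tau (M Z v' p) (M T u v0)))))))"
    by (rule cosum_cong)
  also have "\<dots> = lift Z Z c (\<lambda>p q. coact Z q (\<lambda>g q0. coact h g (\<lambda>x y. kappa T x (\<lambda>u v.
      kappa Z (S y) (\<lambda>u' v'. w Z (M Z u' q0) * f (tau (M Z v' p) (M T u v)))))))"
    by (subst kappa_right_coaction) (intro lin refl)+
  also have "\<dots> = lift Z Z c (\<lambda>p q. coact Z q (\<lambda>g q0. coact h g (\<lambda>x y. eps x * 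
      kappa Z (S y) (\<lambda>u' v'. w Z (M Z u' q0) * f (tau (M Z v' p) (e T))))))"
    by (subst kappa_contract[where f="\<lambda>z. kappa Z _ (\<lambda>u' v'. w Z (M Z u' _) * f (tau (M Z v' _) z))"]) (intro lin refl)+
  also have "\<dots> = lift Z Z c (\<lambda>p q. coact Z q (\<lambda>g q0.
      kappa Z (S g) (\<lambda>u' v'. w Z (M Z u' q0) * f (tau (M Z v' p) (e T)))))"
    by (subst coact_counit[where f="\<lambda>y. kappa Z (S y) (\<lambda>u' v'. w Z (M Z u' _) * f (tau (M Z v' _) (e T)))"]) 
      (intro lin | simp)+
  also have "\<dots> = lift Z Z c (\<lambda>p q. coact Z p (\<lambda>g p0.
      kappa Z g (\<lambda>u' v'. w Z (M Z u' q) * f (tau (M Z v' p0) (e T)))))"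
    by (subst coinv_antipode[OF c, where F="\<lambda>g p q. kappa Z g (\<lambda>u' v'. w Z (M Z u' q) * f (tau (M Z v' p) (e T)))"]) 
      (intro lin | simp)+
  also have "\<dots> = lift Z Z c (\<lambda>p q. w Z (M Z p q) * f (hom_one Z T))"
    by (subst kappa_can[where F="\<lambda>x y. w Z (M Z x _) * f (tau y (e T))"]) 
      (intro lin | simp add: hom_one_def)+
  finally show ?thesis by (simp add: lift_cmult counit_def)
qed

text \<open>
  Here \<open>\<kappa>\<^sub>T(p\<^sub>-\<^sub>1)\<close> and \<open>\<kappa>\<^sub>T(q\<^sub>-\<^sub>1)\<close> multiply to \<open>\<kappa>\<^sub>T(p\<^sub>-\<^sub>1 q\<^sub>-\<^sub>1)\<close>, and coinvariance makes the argument \<open>1\<close>.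
\<close>

lemma antipode_left:
  assumes c: "c \<in> hom_car Z Z" and f: "linf f"
  shows "cosum Z Z T c (\<lambda>x y. f (hom_mult T Z (antipode Z T x) y)) = counit Z c * f (hom_one T Z)"
proof -
  note [lin] = f f[THEN linf_comp]
  have "f (hom_mult T Z (antipode Z T (tau p u)) (tau v q0)) = coact Z p (\<lambda>g p0. kappa T g (\<lambda>u' v'. w T (M T u' u) * f (tau (M T v v') (M Z p0 q0))))"
    if "pr Z p = p" "pr T u = u" "pr T v = v" "pr Z q0 = q0" for p u v q0
  proof -
    have "f (hom_mult T Z (antipode Z T (tau p u)) (tau v q0)) = coact Z p (\<lambda>g p0. kappa T g (\<lambda>u' v'. w T (M T u' u) * f (hom_mult T Z (tau v' p0) (tau v q0))))"
      by (rule antipode_tau[where f="\<lambda>z. f (hom_mult T Z z (tau v q0))"]) (rule that | intro lin)+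
    then show ?thesis using that by (simp add: hom_mult_tau)
  qed
  then have "cosum Z Z T c (\<lambda>x y. f (hom_mult T Z (antipode Z T x) y)) =
    lift Z Z c (\<lambda>p q. coact Z q (\<lambda>k q0. kappa T k (\<lambda>u v.
      coact Z p (\<lambda>g p0. kappa T g (\<lambda>u' v'. w T (M T u' u) * f (tau (M T v v') (M Z p0 q0)))))))"
    by (rule cosum_cong)
  also have "\<dots> = lift Z Z c (\<lambda>p q. coact Z p (\<lambda>g p0. coact Z q (\<lambda>k q0. 
      kappa T g (\<lambda>u' v'. kappa T k (\<lambda>u v. w T (M T u' u) * f (tau (M T v v') (M Z p0 q0)))))))"
    by (subst kappa_coact, subst coact_coact, subst kappa_kappa, rule refl)
  also have "\<dots> = lift Z Z c (\<lambda>p q. coact Z p (\<lambda>g p0. coact Z q (\<lambda>k q0. 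
      kappa T (M h g k) (\<lambda>u v. w T u * f (tau v (M Z p0 q0))))))"
    by (subst kappa_mult) (intro lin refl)+
  also have "\<dots> = lift Z Z c (\<lambda>p q. kappa T (e h) (\<lambda>u v. w T u * f (tau v (M Z p q))))"
    by (subst coinv[OF c, where F="\<lambda>k p q. kappa T k (\<lambda>u v. w T u * f (tau v (M Z p q)))"]) (intro lin refl)+
  also have "\<dots> = lift Z Z c (\<lambda>p q. f (tau (e T) (M Z p q)))"
    by (subst kappa_e) (intro lin | simp)+
  also have "\<dots> = counit Z c * f (hom_one T Z)"
    by (subst coinv_product[OF c, where f="\<lambda>z. f (tau (e T) z)"]) (intro lin | simp add: hom_one_def)+
  finally show ?thesis .
qed

section \<open>Recovering the Hopf algebra and its comodule algebras\<close>

text \<open>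
  The map \<open>a \<mapsto> S a\<^sub>-\<^sub>1 \<otimes> a\<^sub>0\<close> from \<open>P\<^sub>W\<close> to \<open>C(h,W)\<close>; for \<open>W = h\<close> it is the embedding of the Hopf algebra.
\<close>

definition to_hom where "to_hom W a = (\<lambda>i. coact W a (\<lambda>g b. tau (S g) b i))"

lemma to_hom_lin [lin]: "linv g \<Longrightarrow> linv (\<lambda>x. to_hom W (g x))"
  unfolding to_hom_def by (intro lin)

lemma to_hom_app:
  assumes "linf f"
  shows "f (to_hom W a) = coact W a (\<lambda>g b. f (tau (S g) b))"
  unfolding to_hom_def by (rule coact_app[OF assms])

lemma lift_to_hom:
  assumes F: "\<And>y. linf (\<lambda>x. F x y)" "\<And>x. linf (F x)"
  shows "lift h W (to_hom W a) F = coact W a (\<lambda>g b. F (S g) b)"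
proof -
  note [lin] = F F[THEN linf_comp]
  have "lift h W (to_hom W a) F = coact W a (\<lambda>g b. lift h W (tau (S g) b) F)"
    by (rule to_hom_app[where f="\<lambda>c. lift h W c F"]) (intro lin)
  also have "\<dots> = coact W a (\<lambda>g b. F (S g) b)"
    by (rule coact_cong[OF refl], subst lift_tau) (assumption | intro lin | simp)+
  finally show ?thesis .
qed

text \<open>
  The antipode reverses the comultiplication and the multiplication: apply the counit to the first
  leg of \<open>\<kappa>(a) = a\<^sub>1 \<otimes> S a\<^sub>2\<close> in \<open>kappa_right_coaction\<close> and in \<open>kappa_mult\<close>.
\<close>

lemma S_comult:
  assumes F: "\<And>y. linf (\<lambda>x. F x y)" "\<And>x. linf (F x)"
  shows "coact h (S a) F = coact h a (\<lambda>x y. F (S y) (S x))"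
proof -
  note [lin] = F F[THEN linf_comp]
  have "coact h (S a) F = coact h a (\<lambda>x y. eps x * coact h (S y) F)"
    by (subst coact_counit[where f="\<lambda>y. coact h (S y) F"]) (intro lin | simp)+
  also have "\<dots> = kappa h a (\<lambda>u v. coact h v (\<lambda>g w. eps u * F g w))"
    by (subst kappa_h) (intro lin | simp add: coact_cmult)+
  also have "\<dots> = coact h a (\<lambda>x y. coact h x (\<lambda>u v. eps u * F (S y) (S v)))"
    by (subst kappa_right_coaction, (intro lin)[1], (intro lin)[1], (intro lin)[1], subst kappa_h) (intro lin refl)+
  also have "\<dots> = coact h a (\<lambda>x y. F (S y) (S x))"
    by (subst coact_counit[where f="\<lambda>v. F (S _) (S v)"]) (intro lin | simp)+
  finally show ?thesis .
qed

lemma eps_S [simp]: "eps (S a) = eps a"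
proof -
  have "eps (S a) = coact h a (\<lambda>x y. eps x * eps (S y))"
    by (subst coact_counit[where f="\<lambda>y. eps (S y)"]) (intro lin | simp)+
  also have "\<dots> = coact h a (\<lambda>x y. eps (M h x (S y)))" by simp
  also have "\<dots> = eps a" by (subst S_right) (intro lin | simp)+
  finally show ?thesis .
qed

lemma S_M:
  assumes f: "linf f"
  shows "f (S (M h a b)) = f (M h (S b) (S a))"
proof -
  note [lin] = f f[THEN linf_comp]
  have *: "kappa h c (\<lambda>u v. eps u * F v) = F (S c)" if "linf F" for F c
  proof -
    note [lin] = that that[THEN linf_comp]
    show ?thesis
      by (subst kappa_h, (intro lin)[1], (intro lin)[1], subst coact_counit[where f="\<lambda>y. F (S y)"])
        (intro lin | simp)+
  qed
  have "f (S (M h a b)) = kappa h (M h a b) (\<lambda>u v. eps u * f v)"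
    by (rule *[symmetric]) (intro lin)
  also have "\<dots> = kappa h a (\<lambda>u v. eps u * kappa h b (\<lambda>u' v'. eps u' * f (M h v' v)))"
    by (subst kappa_mult) (intro lin | simp add: kappa_cmult mult.assoc)+
  also have "\<dots> = f (M h (S b) (S a))"
    by (subst *, (intro lin)[1], subst *) (intro lin refl)+
  finally show ?thesis .
qed

lemma S_e: "S (e h) = e h"
proof
  fix i
  have "coact h (e h) (\<lambda>x y. M h x (S y) i) = e h i"
    by (subst S_right[where f="\<lambda>z. z i"]) (intro lin linf_coord | simp)+
  then show "S (e h) i = e h i"
    by (subst (asm) coact_e) (intro lin linf_coord | simp)+
qed

lemma to_hom_hom_car: "to_hom W a \<in> hom_car h W"
proof (rule hom_carI)
  show "to_hom W a i = lift h W (to_hom W a) (\<lambda>p q. tau p q i)" for i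
    by (subst lift_to_hom) (intro lin | simp add: to_hom_def)+
  fix F :: "('b \<Rightarrow> 'c) \<Rightarrow> ('b \<Rightarrow> 'c) \<Rightarrow> ('b \<Rightarrow> 'c) \<Rightarrow> 'c"
  assume F: "\<And>y z. linf (\<lambda>x. F x y z)" "\<And>x z. linf (\<lambda>y. F x y z)" "\<And>x y. linf (F x y)"
  note [lin] = F F[THEN linf_comp]
  have "lift h W (to_hom W a) (\<lambda>p q. coact h p (\<lambda>g p0. coact W q (\<lambda>k q0. F (M h g k) p0 q0)))
    = coact W a (\<lambda>g b. coact h g (\<lambda>x y. coact W b (\<lambda>k q0. F (M h (S y) k) (S x) q0)))"
    by (subst lift_to_hom, (intro lin)[1], (intro lin)[1], subst S_comult) (intro lin refl)+
  also have "\<dots> = coact W a (\<lambda>x c. coact W c (\<lambda>y b. coact W b (\<lambda>k q0. F (M h (S y) k) (S x) q0)))"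
    by (subst coact_coassoc) (intro lin refl)+
  also have "\<dots> = coact W a (\<lambda>x c. coact W c (\<lambda>m b. coact h m (\<lambda>y k. F (M h (S y) k) (S x) b)))"
    by (rule coact_cong[OF refl], subst coact_coassoc) (intro lin refl)+
  also have "\<dots> = coact W a (\<lambda>x c. F (e h) (S x) c)"
    by (subst S_left[where f="\<lambda>z. F z (S _) _"], (intro lin)[1], 
      subst coact_counit[where f="\<lambda>b. F (e h) (S _) b"]) (intro lin | simp)+
  also have "\<dots> = lift h W (to_hom W a) (\<lambda>p q. F (e h) p q)"
    by (subst lift_to_hom) (intro lin refl)+
  finally show "lift h W (to_hom W a) (\<lambda>p q. coact h p (\<lambda>g p0. coact W q (\<lambda>k q0. F (M h g k) p0 q0)))
    = lift h W (to_hom W a) (\<lambda>p q. F (e h) p q)" .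
qed

lemma to_hom_M: "to_hom W (M W a b) = hom_mult h W (to_hom W a) (to_hom W b)"
proof
  fix i
  have "to_hom W (M W a b) i = coact W a (\<lambda>g a0. coact W b (\<lambda>k b0. tau (S (M h g k)) (M W a0 b0) i))"
    unfolding to_hom_def by (subst coact_M) (intro lin | simp)+
  also have "\<dots> = coact W a (\<lambda>g a0. coact W b (\<lambda>k b0. tau (M h (S k) (S g)) (M W a0 b0) i))"
    by (subst S_M[where f="\<lambda>z. tau z _ i"]) (intro lin refl)+
  also have "\<dots> = hom_mult h W (to_hom W a) (to_hom W b) i"
    unfolding hom_mult_def by (subst lift_to_hom, (intro lin)[1], (intro lin)[1], subst lift_to_hom) (intro lin refl)+
  finally show "to_hom W (M W a b) i = hom_mult h W (to_hom W a) (to_hom W b) i" .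
qed

lemma to_hom_e: "to_hom W (e W) = hom_one h W"
  unfolding to_hom_def hom_one_def by (rule ext, subst coact_e) (intro lin | simp add: S_e)+

definition to_hom_inv where "to_hom_inv W c = (\<lambda>i. lift h W c (\<lambda>p q. eps p * q i))"

lemma pr_to_hom_inv: "pr W (to_hom_inv W c) = to_hom_inv W c"
proof
  fix i
  have "pr W (to_hom_inv W c) i = lift h W c (\<lambda>p q. pr W (\<lambda>i. eps p * q i) i)"
    unfolding to_hom_inv_def by (rule lift_app[where f="\<lambda>z. pr W z i"]) (intro lin linf_coord)
  also have "\<dots> = lift h W c (\<lambda>p q. eps p * pr W q i)"
    by (subst scale_app[where f="\<lambda>z. pr W z i"]) (intro lin linf_coord refl)+
  finally show "pr W (to_hom_inv W c) i = to_hom_inv W c i" by (simp add: to_hom_inv_def)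
qed

lemma to_hom_inv_to_hom: "to_hom_inv W (to_hom W a) = pr W a"
proof
  fix i
  have "to_hom_inv W (to_hom W a) i = coact W a (\<lambda>g b. eps g * b i)"
    unfolding to_hom_inv_def by (subst lift_to_hom) (intro lin linf_coord | simp)+
  then show "to_hom_inv W (to_hom W a) i = pr W a i"
    by (subst (asm) coact_counit[where f="\<lambda>z. z i"]) (intro lin linf_coord | simp)+
qed

text \<open>
  For coinvariant \<open>p \<otimes> q\<close>, \<open>\<epsilon>(p) S q\<^sub>-\<^sub>1 \<otimes> q\<^sub>0 = \<epsilon>(p\<^sub>0) p\<^sub>-\<^sub>1 \<otimes> q = p \<otimes> q\<close> by \<open>coinv_antipode\<close>.
\<close>

lemma to_hom_to_hom_inv:
  assumes c: "c \<in> hom_car h W"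
  shows "to_hom W (to_hom_inv W c) = c"
proof
  fix i
  have "to_hom W (to_hom_inv W c) i = lift h W c (\<lambda>p q. to_hom W (\<lambda>i. eps p * q i) i)"
    unfolding to_hom_inv_def by (rule lift_app[where f="\<lambda>z. to_hom W z i"]) (intro lin linf_coord)
  also have "\<dots> = lift h W c (\<lambda>p q. eps p * to_hom W q i)"
    by (subst scale_app[where f="\<lambda>z. to_hom W z i"]) (intro lin linf_coord refl)+
  also have "\<dots> = lift h W c (\<lambda>p q. coact W q (\<lambda>g q0. eps p * tau (S g) q0 i))"
    by (simp add: to_hom_def coact_cmult)
  also have "\<dots> = lift h W c (\<lambda>p q. coact h p (\<lambda>g p0. eps p0 * tau g q i))"
    by (subst coinv_antipode[OF c, where F="\<lambda>g p q. eps p * tau g q i"]) (intro lin refl)+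
  also have "\<dots> = lift h W c (\<lambda>p q. tau p q i)"
    by (subst mult.commute, subst coact_counit'[where f="\<lambda>g. tau g _ i"]) (intro lin | simp)+
  also have "\<dots> = c i"
    by (rule hom_car_app[OF c linf_coord[OF linv_id]])
  finally show "to_hom W (to_hom_inv W c) i = c i" .
qed

lemma cosum_to_hom:
  assumes F: "\<And>y. linf (\<lambda>x. F x y)" "\<And>x. linf (F x)"
  shows "cosum h W h (to_hom W a) F = coact W a (\<lambda>g b. F (to_hom h g) (to_hom W b))"
proof -
  note [lin] = F F[THEN linf_comp]
  have "cosum h W h (to_hom W a) F = coact W a (\<lambda>g b. coact W b (\<lambda>g' q0. coact h g' (\<lambda>x y. F (tau (S g) x) (tau (S y) q0))))"
    unfolding cosum_def 
    by (subst lift_to_hom, (intro lin)[1], (intro lin)[1], subst kappa_h) (intro lin refl)+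
  also have "\<dots> = coact W a (\<lambda>g b. coact W b (\<lambda>x b'. coact W b' (\<lambda>y q0. F (tau (S g) x) (tau (S y) q0))))"
    by (rule coact_cong[OF refl], subst coact_coassoc) (intro lin refl)+
  also have "\<dots> = coact W a (\<lambda>m b'. coact h m (\<lambda>g x. coact W b' (\<lambda>y q0. F (tau (S g) x) (tau (S y) q0))))"
    by (subst coact_coassoc) (intro lin refl)+
  also have "\<dots> = coact W a (\<lambda>m b'. coact h m (\<lambda>g x. F (tau (S g) x) (to_hom W b')))"
    by (subst to_hom_app) (intro lin refl)+
  also have "\<dots> = coact W a (\<lambda>g b. F (to_hom h g) (to_hom W b))"
    by (rule coact_cong[OF refl], subst to_hom_app[where f="\<lambda>z. F z _"]) (intro lin refl)+
  finally show ?thesis .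
qed

lemma counit_to_hom: "counit h (to_hom h a) = eps a"
  unfolding counit_def
  by (subst lift_to_hom, (intro lin)[1], (intro lin)[1], subst S_left) (intro lin | simp)+

text \<open>
  Both sides are \<open>S S a\<^sub>2 \<otimes> S a\<^sub>1\<close>.
\<close>

lemma antipode_to_hom: "antipode h h (to_hom h a) = to_hom h (S a)"
proof
  fix i
  have "antipode h h (to_hom h a) i = coact h a (\<lambda>g b. coact h (S g) (\<lambda>k p0. kappa h k (\<lambda>u v. w h (M h u b) * tau v p0 i)))"
    unfolding antipode_def by (subst lift_to_hom) (intro lin refl)+
  also have "\<dots> = coact h a (\<lambda>g b. coact h g (\<lambda>x y. coact h (S y) (\<lambda>u v. w h (M h u b) * tau (S v) (S x) i)))"
    by (subst S_comult, (intro lin)[1], (intro lin)[1], subst kappa_h) (intro lin refl)+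
  also have "\<dots> = coact h a (\<lambda>x c. coact h c (\<lambda>y b. coact h y (\<lambda>v u. w h (M h (S u) b) * tau (S (S v)) (S x) i)))"
    by (subst coact_coassoc, (intro lin)[1], (intro lin)[1], (intro lin)[1], subst S_comult) (intro lin refl)+
  also have "\<dots> = coact h a (\<lambda>x c. coact h c (\<lambda>v d. coact h d (\<lambda>u b. w h (M h (S u) b) * tau (S (S v)) (S x) i)))"
    by (rule coact_cong[OF refl], subst coact_coassoc) (intro lin refl)+
  also have "\<dots> = coact h a (\<lambda>x c. coact h c (\<lambda>v d. tau (S (S v)) (S x) i * eps d))"
    by (subst S_left[where f="\<lambda>z. w h z * tau _ _ i"]) (intro lin | simp add: mult.commute)+
  also have "\<dots> = coact h a (\<lambda>x c. tau (S (S c)) (S x) i)"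
    by (subst coact_counit'[where f="\<lambda>v. tau (S (S v)) _ i"]) (intro lin | simp)+
  also have "\<dots> = to_hom h (S a) i"
    unfolding to_hom_def by (subst S_comult) (intro lin refl)+
  finally show "antipode h h (to_hom h a) i = to_hom h (S a) i" .
qed

end

section \<open>Tensor products through lists of representatives\<close>

lemma tsum_cong: "(\<And>x y. (x, y) \<in> set xs \<Longrightarrow> F x y = G x y) \<Longrightarrow> tsum xs F = tsum xs G"
  unfolding tsum_def by (intro arg_cong[of _ _ sum_list] map_cong) auto

lemma tsum_map: "tsum (map (\<lambda>(x, y). (f x, g y)) xs) F = tsum xs (\<lambda>x y. F (f x) (g y))"
  by (induction xs) auto

lemma tsum_zero: "tsum xs (\<lambda>x y. 0) = 0"
  by (induction xs) auto

definition legs_in where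
  "legs_in A B xs \<longleftrightarrow> (\<forall>(x, y)\<in>set xs. x \<in> acar A \<and> y \<in> acar B)"

text \<open>
  On tensors given by lists, the canonical maps between tensor products are finite sums over the
  lists.  The lemmas below compute \<open>tlift\<close>, \<open>tmap\<close>, \<open>tassoc\<close> and the product of a tensor product of
  algebras in this form, which reduces diagrams of such maps to equalities of sums.
\<close>

definition tlist where
  "tlist A B xs = tsum xs (tpure A B)"

lemma legs_in_simps [simp]:
  "legs_in A B []" "legs_in A B ((x, y) # xs) \<longleftrightarrow> x \<in> acar A \<and> y \<in> acar B \<and> legs_in A B xs"
  by (auto simp: legs_in_def)

lemma legs_inD: "legs_in A B xs \<Longrightarrow> (x, y) \<in> set xs \<Longrightarrow> x \<in> acar A \<and> y \<in> acar B"
  by (auto simp: legs_in_def)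

lemma tsum_apply: "tsum xs F i = tsum xs (\<lambda>x y. F x y i)"
  by (induction xs) auto

lemma tlist_apply: "tlist A B xs \<beta> = (if bilinear_form A B \<beta> then tsum xs \<beta> else 0)"
  unfolding tlist_def tsum_apply by (auto simp: tpure_def tsum_zero)

lemma acar_tensorE:
  assumes A: "is_space A" and t: "t \<in> acar (A \<otimes> B)"
  obtains xs where "legs_in A B xs" "t = tlist A B xs"
proof -
  obtain n x y where xy: "\<forall>i<n::nat. x i \<in> acar A \<and> y i \<in> acar B" "t = (\<Sum>i<n. tpure A B (x i) (y i))"
    using t unfolding acar_tensor_iff[OF A] by blast
  have "t = tlist A B (map (\<lambda>i. (x i, y i)) [0..<n])"
    unfolding xy(2) tlist_def tsum_def by (simp add: comp_def sum_list_sum_nth atLeast0LessThan)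
  moreover have "legs_in A B (map (\<lambda>i. (x i, y i)) [0..<n])" using xy(1) by (auto simp: legs_in_def)
  ultimately show ?thesis using that by blast
qed

lemma tlist_nth: "tsum xs f = (\<Sum>i<length xs. f (fst (xs ! i)) (snd (xs ! i)))"
  unfolding tsum_def by (simp add: sum_list_sum_nth atLeast0LessThan case_prod_beta)

lemma legs_in_nth: "legs_in A B xs \<Longrightarrow> i < length xs \<Longrightarrow> fst (xs ! i) \<in> acar A \<and> snd (xs ! i) \<in> acar B"
  unfolding legs_in_def using nth_mem by fastforce

lemma tlist_mem:
  assumes A: "is_space A" and xs: "legs_in A B xs" 
  shows "tlist A B xs \<in> acar (A \<otimes> B)"
  unfolding acar_tensor_iff[OF A] tlist_def tlist_nth using legs_in_nth[OF xs]
  by (intro exI[of _ "length xs"] exI[of _ "\<lambda>i. fst (xs ! i)"] exI[of _ "\<lambda>i. snd (xs ! i)"]) auto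

lemma tlift_tlist:
  assumes "is_space A" "is_space B" "is_space C" "bilinear_map A B C b" and xs: "legs_in A B xs"
  shows "tlift A B b (tlist A B xs) = tsum xs b"
  unfolding tlist_def tlist_nth by (rule tlift_sum[OF assms(1-4)]) (use legs_in_nth[OF xs] in auto)

lemma space_add: "is_space A \<Longrightarrow> x \<in> acar A \<Longrightarrow> y \<in> acar A \<Longrightarrow> x + y \<in> acar A"
  by (rule is_space_closed)

lemma space_scale: "is_space A \<Longrightarrow> x \<in> acar A \<Longrightarrow> ascale A c x \<in> acar A"
  by (rule is_space_closed)

lemma tensor_sel [simp]: "ascale (A \<otimes> B) = tscale" "aone (A \<otimes> B) = tpure A B (aone A) (aone B)"
  by (simp_all add: tensor_def)

lemma is_space_tensor: "is_space (A \<otimes> B)"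
proof -
  interpret T: vector_space "tscale :: 'a::field \<Rightarrow> ('b, 'c, 'a) tens \<Rightarrow> _" by (rule vector_space_tscale)
  show ?thesis unfolding is_space_def
    by (simp add: tensor_def vector_space_tscale T.subspace_span)
qed

lemma is_space_ground: "is_space ground"
proof -
  interpret vector_space "(*) :: 'a::field \<Rightarrow> 'a \<Rightarrow> 'a" by (rule vector_space_ground)
  show ?thesis by (simp add: is_space_def ground_def vector_space_ground)
qed

lemma ground_sel [simp]: "acar ground = UNIV" "ascale ground = (*)" "amult ground = (*)" "aone ground = 1"
  by (simp_all add: ground_def)

lemma tpure_mem:
  fixes A :: "('k::field, 'a::ab_group_add, 'm) kalg_scheme"
    and B :: "('k, 'b::ab_group_add, 'n) kalg_scheme"
  shows "x \<in> acar A \<Longrightarrow> y \<in> acar B \<Longrightarrow> tpure A B x y \<in> acar (A \<otimes> B)"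
proof -
  interpret T: module "tscale :: 'k \<Rightarrow> ('a, 'b, 'k) tens \<Rightarrow> _" by (rule module_tscale)
  assume "x \<in> acar A" "y \<in> acar B"
  then show ?thesis by (auto simp: tensor_def intro!: T.span_base)
qed

lemma bilinear_tpure:
  assumes "linear_map A A' f" "linear_map B B' g"
  shows "bilinear_map A B (A' \<otimes> B') (\<lambda>a b. tpure A' B' (f a) (g b))"
  using assms by (auto simp: bilinear_map_def linear_map_def tpure_bilinear intro!: tpure_mem)

lemma linear_map_id: "linear_map A A id" "linear_map A A (\<lambda>x. x)"
  by (auto simp: linear_map_def)

lemma tmap_tlist:
  assumes "is_space A" "is_space B" "is_space A'" "is_space B'" and f: "linear_map A A' f" and g: "linear_map B B' g"
    and xs: "legs_in A B xs"
  shows "tmap A B A' B' f g (tlist A B xs) = tlist A' B' (map (\<lambda>(x, y). (f x, g y)) xs)"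
  unfolding tmap_def tlist_def[of A' B']
  by (simp only: tlift_tlist[OF assms(1,2) is_space_tensor bilinear_tpure[OF f g] xs] tsum_map)

lemma legs_in_map:
  assumes "linear_map A A' f" "linear_map B B' g" "legs_in A B xs"
  shows "legs_in A' B' (map (\<lambda>(x, y). (f x, g y)) xs)"
  using assms by (auto simp: legs_in_def linear_map_def)

lemma space_sum: "is_space C \<Longrightarrow> (\<And>x y. (x, y) \<in> set xs \<Longrightarrow> f x y \<in> acar C) \<Longrightarrow> tsum xs f \<in> acar C"
proof (induction xs)
  case (Cons z xs)
  then show ?case by (cases z) (auto intro!: space_add)
qed (simp add: is_space_closed)

lemma linear_map_sum:
  assumes g: "linear_map C D g" and C: "is_space C" and f: "\<And>x y. (x, y) \<in> set xs \<Longrightarrow> f x y \<in> acar C"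
  shows "g (tsum xs f) = tsum xs (\<lambda>x y. g (f x y))"
  using f
proof (induction xs)
  case Nil
  have "g (0 + 0) = g 0 + g 0" using g is_space_closed(1)[OF C] unfolding linear_map_def by blast
  then show ?case by simp
next
  case (Cons z xs)
  obtain x y where z: "z = (x, y)" by fastforce
  have "tsum xs f \<in> acar C" by (rule space_sum[OF C]) (use Cons.prems in auto)
  then show ?case using Cons g by (auto simp: z linear_map_def)
qed

lemma tsum_scale:
  assumes "vector_space s"
  shows "s c (tsum xs f) = tsum xs (\<lambda>x y. s c (f x y))"
proof -
  interpret vector_space s by (rule assms)
  show ?thesis by (induction xs) (auto simp: scale_right_distrib)
qed

text \<open>
  Linearity in a parameter of the map that a bilinear map induces; it makes nested uses of
  \<open>tlift\<close> bilinear.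
\<close>

lemma bilinear_map_bind:
  assumes A: "is_space A" and B: "is_space B" and C: "is_space C" and D: "is_space D" and t: "t \<in> acar (A \<otimes> B)"
    and b: "\<And>z. z \<in> acar C \<Longrightarrow> bilinear_map A B D (b z)" 
    and l: "\<And>x y. x \<in> acar A \<Longrightarrow> y \<in> acar B \<Longrightarrow> linear_map C D (\<lambda>z. b z x y)"
  shows "linear_map C D (\<lambda>z. tlift A B (b z) t)"
proof -
  obtain xs where xs: "legs_in A B xs" "t = tlist A B xs" using acar_tensorE[OF A t] .
  have *: "tlift A B (b z) t = tsum xs (b z)" if "z \<in> acar C" for z
    unfolding xs(2) by (rule tlift_tlist[OF A B D b[OF that] xs(1)])
  have V: "vector_space (ascale D)" using D by (simp add: is_space_def)
  have "b z x y \<in> acar D" if "z \<in> acar C" "(x, y) \<in> set xs" for z x y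
    using l[of x y] legs_inD[OF xs(1) that(2)] that by (auto simp: linear_map_def)
  moreover have "tsum xs (b (z + z')) = tsum xs (b z) + tsum xs (b z')" if "z \<in> acar C" "z' \<in> acar C" for z z'
  proof -
    have "tsum xs (b (z + z')) = tsum xs (\<lambda>x y. b z x y + b z' x y)"
      using l legs_inD[OF xs(1)] that by (intro tsum_cong) (auto simp: linear_map_def)
    then show ?thesis by (induction xs) (auto simp: tsum_def sum_list_addf split_def)
  qed
  moreover have "tsum xs (b (ascale C r z)) = ascale D r (tsum xs (b z))" if "z \<in> acar C" for z r
    unfolding tsum_scale[OF V] using l legs_inD[OF xs(1)] that by (intro tsum_cong) (auto simp: linear_map_def)
  ultimately show ?thesis
    using space_add[OF C] space_scale[OF C] by (auto simp: linear_map_def * intro!: space_sum[OF D])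
qed

lemma bilinear_assoc:
  assumes "c \<in> acar C"
  shows "bilinear_map A B (A \<otimes> (B \<otimes> C)) (\<lambda>a b. tpure A (B \<otimes> C) a (tpure B C b c))"
  using tpure_bilinear[of A "B \<otimes> C"] assms
  by (auto simp: bilinear_map_def linear_map_def tpure_bilinear intro!: tpure_mem)

lemma bilinear_tassoc:
  assumes A: "is_space A" and B: "is_space B" and C: "is_space C"
  shows "bilinear_map (A \<otimes> B) C (A \<otimes> B \<otimes> C)
     (\<lambda>t c. tlift A B (\<lambda>a b. tpure A (B \<otimes> C) a (tpure B C b c)) t)"
  unfolding bilinear_map_def
proof (intro conjI ballI)
  fix t assume "t \<in> acar (A \<otimes> B)"
  then show "linear_map C (A \<otimes> B \<otimes> C) (\<lambda>c. tlift A B (\<lambda>a b. tpure A (B \<otimes> C) a (tpure B C b c)) t)"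
    using tpure_bilinear[of A "B \<otimes> C"]
    by (intro bilinear_map_bind[OF A B C is_space_tensor] bilinear_assoc)
      (auto simp: linear_map_def tpure_bilinear intro!: tpure_mem)
qed (intro tlift_linear[OF A B is_space_tensor] bilinear_assoc)

lemma tassoc_linear:
  "is_space A \<Longrightarrow> is_space B \<Longrightarrow> is_space C \<Longrightarrow> linear_map ((A \<otimes> B) \<otimes> C) (A \<otimes> B \<otimes> C) (tassoc A B C)"
  unfolding tassoc_def by (intro tlift_linear is_space_tensor bilinear_tassoc)

lemma tassoc_tlist:
  assumes A: "is_space A" and B: "is_space B" and C: "is_space C" and xs: "legs_in (A \<otimes> B) C xs"
  shows "tassoc A B C (tlist (A \<otimes> B) C xs) =
    tsum xs (\<lambda>t c. tlift A B (\<lambda>a b. tpure A (B \<otimes> C) a (tpure B C b c)) t)"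
  unfolding tassoc_def
  by (rule tlift_tlist[OF is_space_tensor C is_space_tensor bilinear_tassoc[OF A B C] xs])

lemma tmap_linear:
  assumes "is_space A" "is_space B" "linear_map A A' f" "linear_map B B' g"
  shows "linear_map (A \<otimes> B) (A' \<otimes> B') (tmap A B A' B' f g)"
  unfolding tmap_def by (rule tlift_linear[OF assms(1,2) is_space_tensor bilinear_tpure[OF assms(3,4)]])

lemma tmult_linear: "is_algebra A \<Longrightarrow> linear_map (A \<otimes> A) A (tmult A)"
  unfolding tmult_def by (intro tlift_linear) (auto simp: is_algebra_def)

lemma linear_map_compose:
  "linear_map A B f \<Longrightarrow> linear_map B C g \<Longrightarrow> linear_map A C (\<lambda>x. g (f x))"
  by (simp add: linear_map_def)

lemma amult_tlist:
  assumes A: "is_algebra A" and B: "is_algebra B" and xs: "legs_in A B xs" and ys: "legs_in A B ys"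
  shows "amult (A \<otimes> B) (tlist A B xs) (tlist A B ys)
    = tsum xs (\<lambda>a b. tsum ys (\<lambda>c d. tpure A B (amult A a c) (amult B b d)))"
proof -
  have sA: "is_space A" and sB: "is_space B" and mA: "bilinear_map A A A (amult A)" and mB: "bilinear_map B B B (amult B)"
    using A B by (auto simp: is_algebra_def)
  have *: "bilinear_map A B (A \<otimes> B) (\<lambda>c d. tpure A B (amult A a c) (amult B b d))"
    if "a \<in> acar A" "b \<in> acar B" for a b
    using mA mB that by (intro bilinear_tpure) (auto simp: bilinear_map_def)
  have **: "bilinear_map A B (A \<otimes> B) (\<lambda>a b. tpure A B (amult A a c) (amult B b d))"
    if "c \<in> acar A" "d \<in> acar B" for c d
    using mA mB that by (intro bilinear_tpure) (auto simp: bilinear_map_def)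
  have "amult (A \<otimes> B) (tlist A B xs) (tlist A B ys) = tlift A B
     (\<lambda>a b. tlift A B (\<lambda>c d. tpure A B (amult A a c) (amult B b d)) (tlist A B ys)) (tlist A B xs)"
    by (simp add: tensor_def)
  also have "\<dots> = tsum xs (\<lambda>a b. tlift A B (\<lambda>c d. tpure A B (amult A a c) (amult B b d)) (tlist A B ys))"
  proof (rule tlift_tlist[OF sA sB is_space_tensor _ xs])
    show "bilinear_map A B (A \<otimes> B) (\<lambda>a b. tlift A B (\<lambda>c d. tpure A B (amult A a c) (amult B b d)) (tlist A B ys))"
      unfolding bilinear_map_def
      using ** by (intro conjI ballI bilinear_map_bind[OF sA sB _ is_space_tensor tlist_mem[OF sA ys]] sA sB * )
         (auto simp: bilinear_map_def)
  qed
  also have "\<dots> = tsum xs (\<lambda>a b. tsum ys (\<lambda>c d. tpure A B (amult A a c) (amult B b d)))"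
    using legs_inD[OF xs] by (intro tsum_cong tlift_tlist[OF sA sB is_space_tensor * ys]) auto
  finally show ?thesis .
qed

lemma trunit_tlist:
  assumes A: "is_space A" and xs: "legs_in A ground xs"
  shows "trunit A (tlist A ground xs) = tsum xs (\<lambda>a c. ascale A c a)"
proof -
  interpret vector_space "ascale A" using A by (simp add: is_space_def)
  show ?thesis unfolding trunit_def
    by (rule tlift_tlist[OF A is_space_ground A _ xs])
      (auto simp: bilinear_map_def linear_map_def scale_right_distrib scale_left_distrib mult.commute intro!: space_scale[OF A])
qed

lemma tlunit_tlist:
  assumes A: "is_space A" and xs: "legs_in ground A xs"
  shows "tlunit A (tlist ground A xs) = tsum xs (\<lambda>c a. ascale A c a)"
proof -
  interpret vector_space "ascale A" using A by (simp add: is_space_def)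
  show ?thesis unfolding tlunit_def
    by (rule tlift_tlist[OF is_space_ground A A _ xs])
      (auto simp: bilinear_map_def linear_map_def scale_right_distrib scale_left_distrib mult.commute intro!: space_scale[OF A])
qed

lemma tmult_tlist:
  assumes A: "is_algebra A" and xs: "legs_in A A xs"
  shows "tmult A (tlist A A xs) = tsum xs (amult A)"
  using A unfolding tmult_def by (intro tlift_tlist xs) (auto simp: is_algebra_def)

lemma tensor_eqI:
  assumes "s \<in> acar (A \<otimes> B)" "t \<in> acar (A \<otimes> B)" "is_space A" "\<And>\<beta>. bilinear_form A B \<beta> \<Longrightarrow> s \<beta> = t \<beta>"
  shows "s = t"
proof
  fix \<beta>
  obtain xs ys where "s = tlist A B xs" "t = tlist A B ys" using assms(1-3) by (metis acar_tensorE)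
  then show "s \<beta> = t \<beta>" using assms(4)[of \<beta>] by (cases "bilinear_form A B \<beta>") (auto simp: tlist_apply)
qed

text \<open>
  The composite that occurs on the left of every coassociativity axiom.
\<close>

lemma tassoc_tmap:
  assumes sp: "is_space A" "is_space B" "is_space C" "is_space P" and f: "linear_map P (A \<otimes> B) f"
    and xs: "legs_in P C xs" and L: "\<And>x y. (x, y) \<in> set xs \<Longrightarrow> legs_in A B (L x) \<and> f x = tlist A B (L x)"
  shows "tassoc A B C (tmap P C (A \<otimes> B) C f id (tlist P C xs)) =
    tsum xs (\<lambda>x y. tsum (L x) (\<lambda>u v. tpure A (B \<otimes> C) u (tpure B C v y)))"
proof -
  have "tassoc A B C (tmap P C (A \<otimes> B) C f id (tlist P C xs)) = 
    tsum xs (\<lambda>x y. tlift A B (\<lambda>a b. tpure A (B \<otimes> C) a (tpure B C b y)) (f x))"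
    using tmap_tlist[OF sp(4,3) is_space_tensor sp(3) f linear_map_id(1) xs]
      tassoc_tlist[OF sp(1-3) legs_in_map[OF f linear_map_id(1) xs]] 
    by (simp only: tsum_map id_apply)
  also have "\<dots> = tsum xs (\<lambda>x y. tsum (L x) (\<lambda>u v. tpure A (B \<otimes> C) u (tpure B C v y)))"
    using L legs_inD[OF xs] by (intro tsum_cong) (simp add: tlift_tlist[OF sp(1,2) is_space_tensor bilinear_assoc])
  finally show ?thesis .
qed

section \<open>Tensors with prescribed slices\<close>

lemma vector_space_fscale: "vector_space (fscale :: 'k::field \<Rightarrow> ('i \<Rightarrow> 'k) \<Rightarrow> _)"
  by unfold_locales (auto simp: fscale_def fun_eq_iff algebra_simps)

lemma linear_linf: "Vector_Spaces.linear fscale (*) f \<longleftrightarrow> linf f"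
  using vector_space_fscale vector_space_ground
  by (auto simp: Vector_Spaces.linear_iff linf_def)

lemma bilinear_form_linf:
  assumes "ascale A = fscale" "ascale B = fscale"
  shows "bilinear_form A B F \<longleftrightarrow> (\<forall>y. linf (\<lambda>x. F x y)) \<and> (\<forall>x. linf (F x))"
  using assms by (auto simp: bilinear_form_def linear_linf)

lemma tsum_swap: "tsum (map prod.swap xs) F = tsum xs (\<lambda>x y. F y x)"
  by (induction xs) auto

lemma tsum_sum: "tsum xs (\<lambda>x y. \<Sum>b\<in>B. G b x y) = (\<Sum>b\<in>B. tsum xs (G b))"
  by (induction xs) (auto simp: sum.distrib)

lemma linf_sum: "linf f \<Longrightarrow> f (\<Sum>b\<in>B. g b) = (\<Sum>b\<in>B. f (g b))"
  by (induction B rule: infinite_finite_induct) (auto simp: linf_0 linf_add)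

lemma linf_tsum: "linf f \<Longrightarrow> f (tsum xs g) = tsum xs (\<lambda>x y. f (g x y))"
  by (induction xs) (auto simp: linf_0 linf_add)

text \<open>
  Expanding the right legs in a basis selected from them makes the left legs slices of the tensor,
  taken with the coordinate functionals of that basis.
\<close>

lemma tensor_right_basis:
  fixes xs :: "(('i \<Rightarrow> 'k::field) \<times> ('i \<Rightarrow> 'k)) list"
  obtains ys where "\<And>F. (\<And>y. linf (\<lambda>x. F x y)) \<Longrightarrow> (\<And>x. linf (F x)) \<Longrightarrow> tsum xs F = tsum ys F"
    "\<And>a b. (a, b) \<in> set ys \<Longrightarrow> b \<in> snd ` set xs \<and> (\<exists>f. linf f \<and> a = tsum xs (\<lambda>x y. fscale (f y) x))"
proof -
  interpret V: vector_space "fscale :: 'k \<Rightarrow> ('i \<Rightarrow> 'k) \<Rightarrow> _" by (rule vector_space_fscale)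
  interpret VK: vector_space_pair "fscale :: 'k \<Rightarrow> ('i \<Rightarrow> 'k) \<Rightarrow> _" "(*) :: 'k \<Rightarrow> 'k \<Rightarrow> 'k"
    by (simp add: vector_space_pair_def vector_space_fscale vector_space_ground)
  obtain B where B: "B \<subseteq> snd ` set xs" "V.independent B" "snd ` set xs \<subseteq> V.span B"
    using V.maximal_independent_subset by blast
  have fin: "finite B" using B(1) finite_subset by blast
  have "\<exists>g. linf g \<and> (\<forall>x\<in>B. g x = (if x = b then 1 else 0))" for b
    using VK.linear_independent_extend[OF B(2), of "\<lambda>x. if x = b then 1 else 0"] by (auto simp: linear_linf)
  then obtain g where g: "\<And>b. linf (g b)" "\<And>b x. x \<in> B \<Longrightarrow> g b x = (if x = b then 1 else 0)"
    by metis
  have expand: "y = (\<Sum>b\<in>B. fscale (g b y) b)" if y: "y \<in> snd ` set xs" for y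
  proof -
    obtain u where u: "y = (\<Sum>b\<in>B. fscale (u b) b)"
      using y B(3) V.span_finite[OF fin] by auto
    have "g b y = u b" if b: "b \<in> B" for b
    proof -
      have "g b y = (\<Sum>b'\<in>B. u b' * g b b')"
        unfolding u by (simp add: linf_sum[OF g(1)] linf_scale[OF g(1)])
      also have "\<dots> = (\<Sum>b'\<in>B. if b' = b then u b' else 0)"
        using g(2) by (intro sum.cong) auto
      finally show ?thesis using b fin by simp
    qed
    then show ?thesis using u by (auto intro: sum.cong)
  qed
  obtain bs where bs: "set bs = B" "distinct bs" using finite_distinct_list[OF fin] by blast
  define ys where "ys = map (\<lambda>b. (tsum xs (\<lambda>x y. fscale (g b y) x), b)) bs"
  show ?thesis
  proof (rule that[of ys])
    fix F :: "('i \<Rightarrow> 'k) \<Rightarrow> ('i \<Rightarrow> 'k) \<Rightarrow> 'k"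
    assume F: "\<And>y. linf (\<lambda>x. F x y)" "\<And>x. linf (F x)"
    have "tsum ys F = (\<Sum>b\<in>B. F (tsum xs (\<lambda>x y. fscale (g b y) x)) b)"
      unfolding ys_def tsum_def by (simp add: comp_def sum_list_distinct_conv_sum_set[OF bs(2)] bs(1))
    also have "\<dots> = (\<Sum>b\<in>B. tsum xs (\<lambda>x y. g b y * F x b))"
      by (simp add: linf_tsum[OF F(1)] linf_scale[OF F(1)])
    also have "\<dots> = tsum xs (\<lambda>x y. \<Sum>b\<in>B. g b y * F x b)"
      by (simp add: tsum_sum)
    also have "\<dots> = tsum xs F"
    proof (rule tsum_cong)
      fix x y assume "(x, y) \<in> set xs"
      then have "y = (\<Sum>b\<in>B. fscale (g b y) b)" by (intro expand) force
      then have "F x y = F x (\<Sum>b\<in>B. fscale (g b y) b)" by simp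
      then show "(\<Sum>b\<in>B. g b y * F x b) = F x y"
        by (simp add: linf_sum[OF F(2)] linf_scale[OF F(2)])
    qed
    finally show "tsum xs F = tsum ys F" ..
  qed (use B(1) bs(1) g(1) in \<open>auto simp: ys_def\<close>)
qed

text \<open>
  Expanding in a basis of the right legs turns the left legs into slices, which lie in \<open>U\<close>; expanding
  the result in a basis of its left legs keeps these in \<open>U\<close> and turns the right legs into slices,
  which lie in \<open>V\<close>.  Used to show that the comultiplication takes values in \<open>C(X,Z) \<otimes> C(Z,Y)\<close>.
\<close>

lemma slices_tensor:
  fixes xs :: "(('i \<Rightarrow> 'k::field) \<times> ('i \<Rightarrow> 'k)) list"
  assumes U: "\<And>f. linf f \<Longrightarrow> tsum xs (\<lambda>x y. fscale (f y) x) \<in> U"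
    and V: "\<And>f. linf f \<Longrightarrow> tsum xs (\<lambda>x y. fscale (f x) y) \<in> V"
  obtains ys where "\<And>F. (\<And>y. linf (\<lambda>x. F x y)) \<Longrightarrow> (\<And>x. linf (F x)) \<Longrightarrow> tsum xs F = tsum ys F"
    "\<And>a b. (a, b) \<in> set ys \<Longrightarrow> a \<in> U \<and> b \<in> V"
proof -
  obtain ys where ys: "\<And>F. (\<And>y. linf (\<lambda>x. F x y)) \<Longrightarrow> (\<And>x. linf (F x)) \<Longrightarrow> tsum xs F = tsum ys F"
    "\<And>a b. (a, b) \<in> set ys \<Longrightarrow> b \<in> snd ` set xs \<and> (\<exists>f. linf f \<and> a = tsum xs (\<lambda>x y. fscale (f y) x))"
    using tensor_right_basis[of xs] by blast
  obtain zs where zs: "\<And>F. (\<And>y. linf (\<lambda>x. F x y)) \<Longrightarrow> (\<And>x. linf (F x)) \<Longrightarrow>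
      tsum (map prod.swap ys) F = tsum zs F"
    "\<And>a b. (a, b) \<in> set zs \<Longrightarrow> b \<in> snd ` set (map prod.swap ys) \<and>
      (\<exists>f. linf f \<and> a = tsum (map prod.swap ys) (\<lambda>x y. fscale (f y) x))"
    using tensor_right_basis[of "map prod.swap ys"] by blast
  show ?thesis
  proof (rule that[of "map prod.swap zs"])
    fix F :: "('i \<Rightarrow> 'k) \<Rightarrow> ('i \<Rightarrow> 'k) \<Rightarrow> 'k"
    assume F: "\<And>y. linf (\<lambda>x. F x y)" "\<And>x. linf (F x)"
    show "tsum xs F = tsum (map prod.swap zs) F"
      using ys(1)[OF F] zs(1)[of "\<lambda>y x. F x y"] F by (simp add: tsum_swap)
  next
    fix a b assume "(a, b) \<in> set (map prod.swap zs)"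
    then have ba: "(b, a) \<in> set zs" by auto
    from zs(2)[OF ba] obtain b' where "(a, b') \<in> set ys" by auto
    with ys(2) U have a: "a \<in> U" by blast
    from zs(2)[OF ba] obtain f where f: "linf f" "b = tsum ys (\<lambda>x y. fscale (f x) y)"
      by (auto simp: tsum_swap)
    have "b = tsum xs (\<lambda>x y. fscale (f x) y)"
      unfolding f(2) fun_eq_iff tsum_apply fscale_def
      by (intro allI ys(1)[symmetric]) (use f(1) in \<open>auto simp: linf_def fscale_def algebra_simps\<close>)
    then show "a \<in> U \<and> b \<in> V" using V f(1) a by blast
  qed
qed

context galois_cogroupoid
begin

section \<open>The cogroupoid of a family of Galois objects\<close>

definition hom_alg :: "'a \<Rightarrow> 'a \<Rightarrow> ('c, 'b \<Rightarrow> 'c) kalg" where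
  "hom_alg Z W = \<lparr>acar = hom_car Z W, ascale = fscale, amult = hom_mult Z W, aone = hom_one Z W\<rparr>"

lemma hom_alg_sel [simp]: "acar (hom_alg Z W) = hom_car Z W" "ascale (hom_alg Z W) = fscale" "amult (hom_alg Z W) = hom_mult Z W"
    "aone (hom_alg Z W) = hom_one Z W"
  by (simp_all add: hom_alg_def)

lemma hom_alg_space: "is_space (hom_alg Z W)"
proof -
  interpret V: vector_space "fscale :: 'c \<Rightarrow> ('b \<Rightarrow> 'c) \<Rightarrow> _" by (rule vector_space_fscale)
  show ?thesis
    by (simp add: is_space_def vector_space_fscale V.subspace_def hom_car_subspace)
qed

lemma hom_alg_algebra: "is_algebra (hom_alg Z W)"
proof -
  have "hom_mult Z W (x + y) z = hom_mult Z W x z + hom_mult Z W y z" "hom_mult Z W z (x + y) = hom_mult Z W z x + hom_mult Z W z y"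
    "hom_mult Z W (fscale r x) z = fscale r (hom_mult Z W x z)" "hom_mult Z W z (fscale r x) = fscale r (hom_mult Z W z x)" for x y z r
    using hom_mult_lin[OF linv_id, THEN linv_add] hom_mult_lin[OF linv_id, THEN linv_scale] by blast+
  then show ?thesis
    by (auto simp: is_algebra_def hom_alg_space bilinear_map_def linear_map_def hom_mult_hom_car hom_one_hom_car hom_mult_assoc hom_mult_hom_one)
qed

lemma bil_hom_alg: "bilinear_form (hom_alg Z W) (hom_alg Z' W') F \<longleftrightarrow> (\<forall>y. linf (\<lambda>x. F x y)) \<and> (\<forall>x. linf (F x))"
  by (rule bilinear_form_linf) simp_all

text \<open>
  A Sweedler sum \<open>tsum xs\<close> depends on the list \<open>xs\<close>; cutting it off outside the bilinear forms leaves
  the tensor that \<open>xs\<close> represents.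
\<close>

definition comult where
  "comult X Y Z c = (\<lambda>\<beta>. if bilinear_form (hom_alg X Z) (hom_alg Z Y) \<beta> then cosum X Y Z c \<beta> else 0)"

lemma cosum_list:
  assumes c: "c \<in> hom_car X Y"
  shows "\<exists>xs. legs_in (hom_alg X Z) (hom_alg Z Y) xs \<and>
    (\<forall>F. (\<forall>y. linf (\<lambda>x. F x y)) \<longrightarrow> (\<forall>x. linf (F x)) \<longrightarrow> cosum X Y Z c F = tsum xs F)"
proof -
  obtain xs where xs: "cosum X Y Z c = tsum xs" using cosum_fsum[of X Y Z c] by (auto simp: fsum_def)
  have l: "tsum xs (\<lambda>x y. fscale (f y) x) \<in> hom_car X Z" if f: "linf f" for f
  proof -
    have "tsum xs (\<lambda>x y. fscale (f y) x) = (\<lambda>i. cosum X Y Z c (\<lambda>x y. f y * x i))"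
      by (rule ext) (simp only: tsum_apply xs fscale_def)
    then show ?thesis using cosum_left_slice[OF c f] by (simp only:)
  qed
  have r: "tsum xs (\<lambda>x y. fscale (f x) y) \<in> hom_car Z Y" if f: "linf f" for f
  proof -
    have "tsum xs (\<lambda>x y. fscale (f x) y) = (\<lambda>i. cosum X Y Z c (\<lambda>x y. f x * y i))"
      by (rule ext) (simp only: tsum_apply xs fscale_def)
    then show ?thesis using cosum_right_slice[OF f] by (simp only:)
  qed
  obtain ys where ys: "\<And>F. (\<And>y. linf (\<lambda>x. F x y)) \<Longrightarrow> (\<And>x. linf (F x)) \<Longrightarrow> tsum xs F = tsum ys F"
    "\<And>a b. (a, b) \<in> set ys \<Longrightarrow> a \<in> hom_car X Z \<and> b \<in> hom_car Z Y"
  proof (rule slices_tensor[OF l r])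
    fix ys
    assume "\<And>F. (\<And>y. linf (\<lambda>x. F x y)) \<Longrightarrow> (\<And>x. linf (F x)) \<Longrightarrow> tsum xs F = tsum ys F"
      "\<And>a b. (a, b) \<in> set ys \<Longrightarrow> a \<in> hom_car X Z \<and> b \<in> hom_car Z Y"
    then show thesis by (rule that)
  qed
  show ?thesis unfolding xs
  proof (intro exI[of _ ys] conjI allI impI)
    show "legs_in (hom_alg X Z) (hom_alg Z Y) ys" using ys(2) by (auto simp: legs_in_def)
  qed (rule ys(1), auto)
qed

text \<open>
  A representation of \<open>\<Delta>\<^sup>Z(c)\<close> with legs in \<open>C(X,Z)\<close> and \<open>C(Z,Y)\<close>, whereas \<open>cosum X Y Z c\<close> sums over pure
  tensors \<open>tau p u\<close> and \<open>tau v q\<close> that need not be coinvariant.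
\<close>

definition comult_rep where
  "comult_rep X Y Z c = (SOME xs. legs_in (hom_alg X Z) (hom_alg Z Y) xs \<and>
    (\<forall>F. (\<forall>y. linf (\<lambda>x. F x y)) \<longrightarrow> (\<forall>x. linf (F x)) \<longrightarrow> cosum X Y Z c F = tsum xs F))"

lemma comult_rep_legs_in: "c \<in> hom_car X Y \<Longrightarrow> legs_in (hom_alg X Z) (hom_alg Z Y) (comult_rep X Y Z c)"
  using someI_ex[OF cosum_list, of c X Y Z] unfolding comult_rep_def by (rule conjunct1)

lemma comult_rep_cosum:
  assumes "c \<in> hom_car X Y" "\<And>y. linf (\<lambda>x. F x y)" "\<And>x. linf (F x)"
  shows "tsum (comult_rep X Y Z c) F = cosum X Y Z c F"
proof -
  have "\<forall>F. (\<forall>y. linf (\<lambda>x. F x y)) \<longrightarrow> (\<forall>x. linf (F x)) \<longrightarrow> cosum X Y Z c F = tsum (comult_rep X Y Z c) F"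
    using someI_ex[OF cosum_list[OF assms(1)], of Z] unfolding comult_rep_def by (rule conjunct2)
  then have "cosum X Y Z c F = tsum (comult_rep X Y Z c) F"
    using assms(2,3) by (elim allE[of _ F]) (drule mp, rule allI, assumption, drule mp, rule allI)
  then show ?thesis ..
qed

lemma comult_comult_rep: "c \<in> hom_car X Y \<Longrightarrow> comult X Y Z c = tlist (hom_alg X Z) (hom_alg Z Y) (comult_rep X Y Z c)"
  by (rule ext) (simp add: comult_def tlist_apply bil_hom_alg comult_rep_cosum)

lemma comult_rep_hom_car: "c \<in> hom_car X Y \<Longrightarrow> (x, y) \<in> set (comult_rep X Y Z c) \<Longrightarrow> x \<in> hom_car X Z \<and> y \<in> hom_car Z Y"
  by (drule comult_rep_legs_in, drule (1) legs_inD) simp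

lemma comult_linear: "linear_map (hom_alg X Y) (hom_alg X Z \<otimes> hom_alg Z Y) (comult X Y Z)"
proof -
  have "cosum X Y Z (x + y) \<beta> = cosum X Y Z x \<beta> + cosum X Y Z y \<beta>" "cosum X Y Z (fscale c x) \<beta> = c * cosum X Y Z x \<beta>"
    if "\<forall>y. linf (\<lambda>x. \<beta> x y)" "\<forall>x. linf (\<beta> x)" for x y \<beta> c
    using cosum_linf[OF _ _ linv_id, of \<beta> X Y Z] that linf_add linf_scale by blast+
  moreover have "comult X Y Z x \<in> acar (hom_alg X Z \<otimes> hom_alg Z Y)" if "x \<in> hom_car X Y" for x
    using that by (simp add: comult_comult_rep tlist_mem hom_alg_space comult_rep_legs_in)
  ultimately show ?thesis
    by (auto simp: linear_map_def) (auto simp: comult_def bil_hom_alg tscale_def)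
qed

lemma comult_alg_hom: "alg_hom (hom_alg X Y) (hom_alg X Z \<otimes> hom_alg Z Y) (comult X Y Z)"
  unfolding alg_hom_def
proof (intro conjI ballI comult_linear)
  show "comult X Y Z (aone (hom_alg X Y)) = aone (hom_alg X Z \<otimes> hom_alg Z Y)"
    by (auto simp: comult_def tpure_def bil_hom_alg cosum_hom_one)
  fix c d assume "c \<in> acar (hom_alg X Y)" "d \<in> acar (hom_alg X Y)"
  then have cd: "c \<in> hom_car X Y" "d \<in> hom_car X Y" "hom_mult X Y c d \<in> hom_car X Y" by (auto simp: hom_mult_hom_car)
  show "comult X Y Z (amult (hom_alg X Y) c d) = amult (hom_alg X Z \<otimes> hom_alg Z Y) (comult X Y Z c) (comult X Y Z d)"
  proof
    fix \<beta>
    show "comult X Y Z (amult (hom_alg X Y) c d) \<beta> = amult (hom_alg X Z \<otimes> hom_alg Z Y) (comult X Y Z c) (comult X Y Z d) \<beta>"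
    proof (cases "bilinear_form (hom_alg X Z) (hom_alg Z Y) \<beta>")
      case True
      then have \<beta>: "\<And>y. linf (\<lambda>x. \<beta> x y)" "\<And>x. linf (\<beta> x)" by (auto simp: bil_hom_alg)
      note [lin] = \<beta> \<beta>[THEN linf_comp]
      have "amult (hom_alg X Z \<otimes> hom_alg Z Y) (comult X Y Z c) (comult X Y Z d) \<beta>
        = tsum (comult_rep X Y Z c) (\<lambda>a b. tsum (comult_rep X Y Z d) (\<lambda>a' b'. \<beta> (hom_mult X Z a a') (hom_mult Z Y b b')))"
        using cd True by (simp add: comult_comult_rep amult_tlist hom_alg_algebra comult_rep_legs_in tsum_apply tpure_def)
      also have "\<dots> = tsum (comult_rep X Y Z c) (\<lambda>a b. cosum X Y Z d (\<lambda>a' b'. \<beta> (hom_mult X Z a a') (hom_mult Z Y b b')))"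
        by (subst comult_rep_cosum[OF cd(2)]) (intro lin refl)+
      also have "\<dots> = cosum X Y Z c (\<lambda>a b. cosum X Y Z d (\<lambda>a' b'. \<beta> (hom_mult X Z a a') (hom_mult Z Y b b')))"
        by (subst comult_rep_cosum[OF cd(1)]) (intro lin refl)+
      also have "\<dots> = cosum X Y Z (hom_mult X Y c d) \<beta>"
        by (subst cosum_hom_mult) (intro lin refl)+
      finally show ?thesis using True by (simp add: comult_def)
    next
      case False
      then show ?thesis using cd
        by (simp add: comult_comult_rep amult_tlist hom_alg_algebra comult_rep_legs_in tsum_apply tpure_def tsum_zero) (simp add: comult_def tlist_apply False)
    qed
  qed
qed

lemma counit_alg_hom: "alg_hom (hom_alg X X) ground (counit X)"
  using counit_lin[OF linv_id, of X] 
  by (auto simp: alg_hom_def linear_map_def linf_add linf_scale counit_hom_one counit_hom_mult)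

lemma antipode_linear: "linear_map (hom_alg X Y) (hom_alg Y X) (antipode X Y)"
  using antipode_lin[OF linv_id, of X Y] by (auto simp: linear_map_def linv_add linv_scale antipode_hom_car)

lemma comult_coassoc:
  assumes c: "c \<in> hom_car X Y"
  shows "tassoc (hom_alg X T) (hom_alg T Z) (hom_alg Z Y)
          (tmap (hom_alg X Z) (hom_alg Z Y) (hom_alg X T \<otimes> hom_alg T Z) (hom_alg Z Y) (comult X Z T) id (comult X Y Z c))
        = tmap (hom_alg X T) (hom_alg T Y) (hom_alg X T) (hom_alg T Z \<otimes> hom_alg Z Y) id (comult T Y Z) (comult X Y T c)"
    (is "?l = ?r")
proof
  fix \<beta>
  have l: "?l = tsum (comult_rep X Y Z c) (\<lambda>x y. tsum (comult_rep X Z T x) (\<lambda>u v. tpure (hom_alg X T) (hom_alg T Z \<otimes> hom_alg Z Y) u (tpure (hom_alg T Z) (hom_alg Z Y) v y)))"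
    unfolding comult_comult_rep[OF c] using comult_rep_hom_car[OF c]
    by (intro tassoc_tmap hom_alg_space comult_linear comult_rep_legs_in c) (auto simp: comult_comult_rep comult_rep_legs_in)
  have r: "?r = tlist (hom_alg X T) (hom_alg T Z \<otimes> hom_alg Z Y) (map (\<lambda>(x, y). (id x, comult T Y Z y)) (comult_rep X Y T c))"
    unfolding comult_comult_rep[OF c]
    by (intro tmap_tlist hom_alg_space is_space_tensor linear_map_id comult_linear comult_rep_legs_in c)
  show "?l \<beta> = ?r \<beta>"
  proof (cases "bilinear_form (hom_alg X T) (hom_alg T Z \<otimes> hom_alg Z Y) \<beta>")
    case True
    let ?F = "\<lambda>u v y. \<beta> u (tpure (hom_alg T Z) (hom_alg Z Y) v y)"
    have \<beta>1: "\<beta> x (s + t) = \<beta> x s + \<beta> x t" "\<beta> x (tscale a s) = a * \<beta> x s" for x s t a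
      using True by (auto simp: bilinear_form_def Vector_Spaces.linear_iff)
    have \<beta>2: "linf (\<lambda>x. \<beta> x s)" for s using True by (auto simp: bilinear_form_def linear_linf)
    have F: "\<And>y z. linf (\<lambda>x. ?F x y z)" "\<And>x z. linf (\<lambda>y. ?F x y z)" "\<And>x y. linf (?F x y)"
      using tpure_bilinear[of "hom_alg T Z" "hom_alg Z Y"] by (auto simp: \<beta>2 linf_def[of "?F _ _"] linf_def[of "\<lambda>y. ?F _ y _"] \<beta>1)
    note [lin] = F F[THEN linf_comp]
    have \<beta>sum: "\<beta> x (tsum xs f) = tsum xs (\<lambda>u v. \<beta> x (f u v))" for x xs and f :: "('b \<Rightarrow> 'c) \<Rightarrow> ('b \<Rightarrow> 'c) \<Rightarrow> _"
      using \<beta>1(2)[of x 0 0] by (induction xs) (auto simp: \<beta>1 tscale_def zero_fun_def)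
    have "?l \<beta> = tsum (comult_rep X Y Z c) (\<lambda>x y. tsum (comult_rep X Z T x) (\<lambda>u v. ?F u v y))"
      using True by (simp add: l tsum_apply tpure_def[of "hom_alg X T"])
    also have "\<dots> = tsum (comult_rep X Y Z c) (\<lambda>x y. cosum X Z T x (\<lambda>u v. ?F u v y))"
      using comult_rep_hom_car[OF c] by (intro tsum_cong comult_rep_cosum) (auto intro: F)
    also have "\<dots> = cosum X Y Z c (\<lambda>x y. cosum X Z T x (\<lambda>u v. ?F u v y))"
      by (subst comult_rep_cosum[OF c]) (intro lin refl)+
    also have "\<dots> = cosum X Y T c (\<lambda>x y. cosum T Y Z y (\<lambda>u v. ?F x u v))"
      by (rule cosum_coassoc) (rule F)+
    also have "\<dots> = tsum (comult_rep X Y T c) (\<lambda>x y. cosum T Y Z y (\<lambda>u v. ?F x u v))"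
      by (subst comult_rep_cosum[OF c]) (intro lin refl)+
    also have "\<dots> = tsum (comult_rep X Y T c) (\<lambda>x y. tsum (comult_rep T Y Z y) (\<lambda>u v. ?F x u v))"
      using comult_rep_hom_car[OF c] by (intro tsum_cong comult_rep_cosum[symmetric]) (auto intro: F)
    also have "\<dots> = tsum (comult_rep X Y T c) (\<lambda>x y. \<beta> x (comult T Y Z y))"
      using comult_rep_hom_car[OF c] by (intro tsum_cong) (auto simp: comult_comult_rep tlist_def \<beta>sum)
    also have "\<dots> = ?r \<beta>"
      using True by (simp add: r tlist_apply tsum_map)
    finally show ?thesis .
  next
    case False
    then show ?thesis by (simp add: l r tlist_apply tsum_apply tpure_def[of "hom_alg X T"] tsum_zero)
  qed
qed

text \<open>
  Transfers the identities for Sweedler sums, which are stated for functionals, to vectors.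
\<close>

lemma comult_rep_vec:
  assumes "c \<in> hom_car X Y" "\<And>y. linv (\<lambda>x. f x y)" "\<And>x. linv (f x)"
  shows "tsum (comult_rep X Y Z c) f = (\<lambda>i. cosum X Y Z c (\<lambda>x y. f x y i))"
  unfolding fun_eq_iff tsum_apply
  by (intro allI comult_rep_cosum[OF assms(1)] linf_coord assms(2,3))

lemma comult_counit_right:
  assumes c: "c \<in> hom_car X Y"
  shows "trunit (hom_alg X Y) (tmap (hom_alg X Y) (hom_alg Y Y) (hom_alg X Y) ground id (counit Y) (comult X Y Y c)) = c"
proof -
  have e: "linear_map (hom_alg Z Z) ground (counit Z)" for Z using counit_alg_hom by (simp add: alg_hom_def)
  note [lin] = linf_coord
  have "trunit (hom_alg X Y) (tmap (hom_alg X Y) (hom_alg Y Y) (hom_alg X Y) ground id (counit Y) (comult X Y Y c))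
    = tsum (comult_rep X Y Y c) (\<lambda>x y. fscale (counit Y y) x)"
    unfolding comult_comult_rep[OF c] tmap_tlist[OF hom_alg_space hom_alg_space hom_alg_space is_space_ground linear_map_id(1) e comult_rep_legs_in[OF c]]
    by (subst trunit_tlist[OF hom_alg_space legs_in_map[OF linear_map_id(1) e comult_rep_legs_in[OF c]]]) (simp add: tsum_map)
  also have "\<dots> = c"
    by (subst comult_rep_vec[OF c], (intro lin)[1], (intro lin)[1])
      (simp add: fscale_def fun_eq_iff cosum_counit_right[OF c, of "\<lambda>x. x _"] linf_coord[OF linv_id] mult.commute[of "counit _ _"])
  finally show ?thesis .
qed

lemma comult_counit_left:
  assumes c: "c \<in> hom_car X Y"
  shows "tlunit (hom_alg X Y) (tmap (hom_alg X X) (hom_alg X Y) ground (hom_alg X Y) (counit X) id (comult X Y X c)) = c"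
proof -
  have e: "linear_map (hom_alg Z Z) ground (counit Z)" for Z using counit_alg_hom by (simp add: alg_hom_def)
  note [lin] = linf_coord
  have "tlunit (hom_alg X Y) (tmap (hom_alg X X) (hom_alg X Y) ground (hom_alg X Y) (counit X) id (comult X Y X c))
    = tsum (comult_rep X Y X c) (\<lambda>x y. fscale (counit X x) y)"
    unfolding comult_comult_rep[OF c] tmap_tlist[OF hom_alg_space hom_alg_space is_space_ground hom_alg_space e linear_map_id(1) comult_rep_legs_in[OF c]]
    by (subst tlunit_tlist[OF hom_alg_space legs_in_map[OF e linear_map_id(1) comult_rep_legs_in[OF c]]]) (simp add: tsum_map)
  also have "\<dots> = c"
    by (subst comult_rep_vec[OF c], (intro lin)[1], (intro lin)[1])
      (simp add: fscale_def fun_eq_iff cosum_counit_left[OF c, of "\<lambda>x. x _"] linf_coord[OF linv_id])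
  finally show ?thesis .
qed

lemma comult_antipode_right:
  assumes c: "c \<in> hom_car X X"
  shows "tmult (hom_alg X Y) (tmap (hom_alg X Y) (hom_alg Y X) (hom_alg X Y) (hom_alg X Y) id (antipode Y X) (comult X X Y c)) = fscale (counit X c) (hom_one X Y)"
proof -
  note [lin] = linf_coord
  have "tmult (hom_alg X Y) (tmap (hom_alg X Y) (hom_alg Y X) (hom_alg X Y) (hom_alg X Y) id (antipode Y X) (comult X X Y c))
    = tsum (comult_rep X X Y c) (\<lambda>x y. hom_mult X Y x (antipode Y X y))"
    unfolding comult_comult_rep[OF c] tmap_tlist[OF hom_alg_space hom_alg_space hom_alg_space hom_alg_space linear_map_id(1) antipode_linear comult_rep_legs_in[OF c]]
    by (subst tmult_tlist[OF hom_alg_algebra legs_in_map[OF linear_map_id(1) antipode_linear comult_rep_legs_in[OF c]]]) (simp add: tsum_map)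
  also have "\<dots> = fscale (counit X c) (hom_one X Y)"
    by (subst comult_rep_vec[OF c], (intro lin)[1], (intro lin)[1])
      (simp add: fscale_def fun_eq_iff antipode_right[OF c, of "\<lambda>x. x _"] linf_coord[OF linv_id])
  finally show ?thesis .
qed

lemma comult_antipode_left:
  assumes c: "c \<in> hom_car X X"
  shows "tmult (hom_alg Y X) (tmap (hom_alg X Y) (hom_alg Y X) (hom_alg Y X) (hom_alg Y X) (antipode X Y) id (comult X X Y c)) = fscale (counit X c) (hom_one Y X)"
proof -
  note [lin] = linf_coord
  have "tmult (hom_alg Y X) (tmap (hom_alg X Y) (hom_alg Y X) (hom_alg Y X) (hom_alg Y X) (antipode X Y) id (comult X X Y c))
    = tsum (comult_rep X X Y c) (\<lambda>x y. hom_mult Y X (antipode X Y x) y)"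
    unfolding comult_comult_rep[OF c] tmap_tlist[OF hom_alg_space hom_alg_space hom_alg_space hom_alg_space antipode_linear linear_map_id(1) comult_rep_legs_in[OF c]]
    by (subst tmult_tlist[OF hom_alg_algebra legs_in_map[OF antipode_linear linear_map_id(1) comult_rep_legs_in[OF c]]]) (simp add: tsum_map)
  also have "\<dots> = fscale (counit X c) (hom_one Y X)"
    by (subst comult_rep_vec[OF c], (intro lin)[1], (intro lin)[1])
      (simp add: fscale_def fun_eq_iff antipode_left[OF c, of "\<lambda>x. x _"] linf_coord[OF linv_id])
  finally show ?thesis .
qed

definition galois_cogpd :: "'a set \<Rightarrow> ('a, 'c, 'b \<Rightarrow> 'c) cogpd" where
  "galois_cogpd O' = \<lparr>ob = O', homalg = hom_alg, comul = comult, couni = counit, antip = antipode\<rparr>"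

lemma hom_one_nz: "hom_one X Y \<noteq> 0"
proof
  assume *: "hom_one X Y = 0"
  have "lift X Y (hom_one X Y) (\<lambda>p q. w X p * w Y q) = 1"
    unfolding hom_one_def by (subst lift_tau) (intro lin | simp)+
  moreover have "lift X Y 0 (\<lambda>p q. w X p * w Y q) = 0"
    by (rule linf_0[of "\<lambda>c. lift X Y c (\<lambda>p q. w X p * w Y q)"]) (intro lin)
  ultimately show False by (simp add: *)
qed

lemma galois_cogpd_connected: "connected_cogroupoid (galois_cogpd O')"
proof -
  have "hom_car X Y \<noteq> {0}" for X Y using hom_one_nz hom_one_hom_car by blast
  then show ?thesis
    using hom_alg_algebra comult_alg_hom counit_alg_hom comult_coassoc comult_counit_right comult_counit_left antipode_linear comult_antipode_right comult_antipode_left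
    by (simp add: connected_cogroupoid_def is_cogroupoid_def is_cocategory_def galois_cogpd_def)
qed

end

section \<open>The regular Galois object\<close>

text \<open>
  The two composites of the Galois map of \<open>H\<close> with \<open>g \<otimes> x \<mapsto> g\<^sub>1 \<otimes> S g\<^sub>2 x\<close>: a Hopf algebra is a Galois object
  over itself.
\<close>

lemma (in comodule_algebras) can_kappa_regular:
  assumes F: "\<And>y. linf (\<lambda>x. F x y)" "\<And>x. linf (F x)"
  shows "coact h g (\<lambda>u v. coact h u (\<lambda>k w. F k (M h w (S v)))) = F (pr h g) (e h)"
proof -
  note [lin] = F F[THEN linf_comp]
  have "coact h g (\<lambda>u v. coact h u (\<lambda>k w. F k (M h w (S v)))) = coact h g (\<lambda>k c. coact h c (\<lambda>w v. F k (M h w (S v))))"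
    by (subst coact_coassoc) (intro lin refl)+
  also have "\<dots> = coact h g (\<lambda>k c. F k (e h) * eps c)"
    by (subst S_right[where f="F _"]) (intro lin | simp add: mult.commute)+
  also have "\<dots> = F (pr h g) (e h)"
    by (subst coact_counit'[where f="\<lambda>k. F k (e h)"]) (intro lin refl)+
  finally show ?thesis .
qed

lemma (in comodule_algebras) kappa_can_regular:
  assumes F: "\<And>y. linf (\<lambda>x. F x y)" "\<And>x. linf (F x)"
  shows "coact h a (\<lambda>g b. coact h g (\<lambda>u v. F u (M h (S v) b))) = F (pr h a) (e h)"
proof -
  note [lin] = F F[THEN linf_comp]
  have "coact h a (\<lambda>g b. coact h g (\<lambda>u v. F u (M h (S v) b))) = coact h a (\<lambda>u c. coact h c (\<lambda>v b. F u (M h (S v) b)))"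
    by (subst coact_coassoc) (intro lin refl)+
  also have "\<dots> = coact h a (\<lambda>k c. F k (e h) * eps c)"
    by (subst S_left[where f="F _"]) (intro lin | simp add: mult.commute)+
  also have "\<dots> = F (pr h a) (e h)"
    by (subst coact_counit'[where f="\<lambda>k. F k (e h)"]) (intro lin refl)+
  finally show ?thesis .
qed

section \<open>Realising spaces by functions\<close>

text \<open>
  \<open>E\<close> embeds the space into functions and \<open>R\<close> is a linear map of the function space onto the carrier
  that inverts \<open>E\<close> there; so \<open>\<lambda>v. E (R v)\<close> is a projection onto the embedded carrier.
\<close>

definition realisation :: "('k::field, 'a::ab_group_add, 'm) kalg_scheme \<Rightarrow> ('a \<Rightarrow> 'i \<Rightarrow> 'k) \<Rightarrow> (('i \<Rightarrow> 'k) \<Rightarrow> 'a) \<Rightarrow> bool" where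
  "realisation A E R \<longleftrightarrow>
    (\<forall>x y. E (x + y) = E x + E y) \<and> (\<forall>c x. E (ascale A c x) = fscale c (E x)) \<and>
    (\<forall>v w. R (v + w) = R v + R w) \<and> (\<forall>c v. R (fscale c v) = ascale A c (R v)) \<and>
    (\<forall>v. R v \<in> acar A) \<and> (\<forall>x\<in>acar A. R (E x) = x)"

text \<open>
  The coordinates with respect to a basis of the ambient space are such an embedding; they have
  finite support, and the indices in that support lie in the range of \<open>j\<close>.
\<close>

lemma realisation_exists:
  fixes A :: "('k::field, 'a::ab_group_add, 'm) kalg_scheme" and j :: "'a \<Rightarrow> 'i"
  assumes A: "is_space A" and j: "inj j"
  shows "\<exists>E R. realisation A E R \<and> (\<forall>x. finite {i. E x i \<noteq> 0} \<and> {i. E x i \<noteq> 0} \<subseteq> range j)"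
proof -
  interpret V: vector_space "ascale A" using A by (simp add: is_space_def)
  interpret VF: vector_space_pair "ascale A" "fscale :: 'k \<Rightarrow> ('i \<Rightarrow> 'k) \<Rightarrow> _"
    by (simp add: vector_space_pair_def vector_space_fscale V.vector_space_axioms)
  obtain B where "V.independent B" "UNIV \<subseteq> V.span B"
    by (rule V.maximal_independent_subset[of UNIV])
  then have B: "V.independent B" "V.span B = UNIV" by (auto simp only:)
  define E where "E x i = (if i \<in> range j then V.representation B x (inv j i) else 0)" for x i
  have E: "E (x + y) = E x + E y" "E (ascale A c x) = fscale c (E x)" for x y c
    using B by (auto simp: E_def fun_eq_iff fscale_def V.representation_add V.representation_scale)
  have supp: "E x i \<noteq> 0 \<Longrightarrow> i \<in> range j" for x i by (auto simp: E_def split: if_splits)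
  have "{i. E x i \<noteq> 0} \<subseteq> j ` {b. V.representation B x b \<noteq> 0}" for x
    using j by (auto simp: E_def split: if_splits)
  then have fin: "finite {i. E x i \<noteq> 0}" for x
    by (rule finite_subset) (rule finite_imageI[OF V.finite_representation])
  have lin: "Vector_Spaces.linear (ascale A) fscale E"
    unfolding Vector_Spaces.linear_iff
    by (intro conjI allI V.vector_space_axioms vector_space_fscale E)
  have inj: "inj E"
  proof (rule injI)
    fix x y assume xy: "E x = E y"
    have rep: "V.representation B z b = E z (j b)" for z b
      by (simp add: E_def j)
    have eq: "V.representation B x = V.representation B y"
      by (rule ext) (simp only: rep xy)
    have z: "(\<Sum>b | V.representation B z b \<noteq> 0. ascale A (V.representation B z b) b) = z" for z
      by (rule V.sum_nonzero_representation_eq[OF B(1)]) (simp only: B(2) UNIV_I)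
    show "x = y" using z[of x] z[of y] unfolding eq by (rule trans[OF sym])
  qed
  obtain R where R: "R ` UNIV \<subseteq> acar A" "Vector_Spaces.linear fscale (ascale A) R" "\<forall>v\<in>acar A. R (E v) = v"
    using VF.linear_exists_left_inverse_on[OF lin _ inj_on_subset[OF inj subset_UNIV], of "acar A"] A
    unfolding is_space_def by blast
  have "realisation A E R"
    using R(1,3) R(2)[unfolded Vector_Spaces.linear_iff] 
    unfolding realisation_def by (intro conjI allI E) blast+
  then show ?thesis using fin supp by (intro exI[of _ E] exI[of _ R]) auto
qed

definition rep_list where
  "rep_list A B c a = (SOME xs. legs_in A B xs \<and> c a = tlist A B xs)"

text \<open>
  The Sweedler sum over the tensor \<open>c (R v)\<close>, transported to function spaces.
\<close>

definition rep_fun where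
  "rep_fun A B c EA EB R v F = tsum (rep_list A B c (R v)) (\<lambda>x y. F (EA x) (EB y))"

lemma rep_list:
  assumes "is_space A" "c a \<in> acar (A \<otimes> B)"
  shows "legs_in A B (rep_list A B c a)" "c a = tlist A B (rep_list A B c a)"
proof -
  have "\<exists>xs. legs_in A B xs \<and> c a = tlist A B xs" using acar_tensorE[OF assms] by metis
  from someI_ex[OF this] show "legs_in A B (rep_list A B c a)" "c a = tlist A B (rep_list A B c a)"
    unfolding rep_list_def by auto
qed

lemma realisationD:
  assumes "realisation A E R"
  shows "E (x + y) = E x + E y" "E (ascale A c x) = fscale c (E x)" "R (v + w) = R v + R w"
    "R (fscale c v) = ascale A c (R v)" "R v \<in> acar A" "x \<in> acar A \<Longrightarrow> R (E x) = x"
  using assms by (auto simp: realisation_def)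

lemma realisation_linv: "realisation A E R \<Longrightarrow> linv (\<lambda>v. E (R v))"
  by (simp add: linv_def linf_def realisationD) (simp add: fscale_def)

lemma linear_map_linv:
  assumes A: "realisation A E R" and B: "realisation B E' R'" and g: "linear_map A B g"
  shows "linv (\<lambda>v. E' (g (R v)))"
  using g realisationD(5)[OF A] realisationD(1-2)[OF B] realisationD(3,4)[OF A]
  unfolding linv_def linf_def linear_map_def by (auto simp: fscale_def)

lemma realisation_bilinear:
  assumes A: "realisation A EA RA" and B: "realisation B EB RB" and "is_space A" "is_space B" 
    and F: "\<And>y. linf (\<lambda>x. F x y)" "\<And>x. linf (F x)"
  shows "bilinear_form A B (\<lambda>x y. F (EA x) (EB y))"
  using assms linf_add[OF F(1)] linf_scale[OF F(1)] linf_add[OF F(2)] linf_scale[OF F(2)]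
  by (auto simp: bilinear_form_def Vector_Spaces.linear_iff is_space_def vector_space_ground 
      realisationD(1,2)[OF A] realisationD(1,2)[OF B])

lemma E_tsum: "realisation A E R \<Longrightarrow> E (tsum xs f) = tsum xs (\<lambda>x y. E (f x y))"
proof (induction xs)
  case Nil
  have "E (0 + 0) = E 0 + E 0" using Nil by (simp only: realisationD(1))
  then show ?case by simp
next
  case (Cons z xs)
  then show ?case by (cases z) (auto simp: realisationD(1))
qed

text \<open>
  A linear map \<open>c\<close> into a tensor product, between realised spaces: the common part of what is needed
  for a comultiplication, a coaction and a translation map.
\<close>

locale realised_tensor =
  fixes A :: "('k::field, 'a::ab_group_add, 'm) kalg_scheme"
    and B :: "('k, 'b::ab_group_add, 'n) kalg_scheme"
    and Q :: "('k, 'q::ab_group_add, 'o) kalg_scheme"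
    and c :: "'q \<Rightarrow> ('a, 'b, 'k) tens"
    and EA :: "'a \<Rightarrow> 'i \<Rightarrow> 'k" and RA EB RB EQ RQ
  assumes rA: "realisation A EA RA" and rB: "realisation B EB RB" and rQ: "realisation Q EQ RQ"
    and sA: "is_space A" and sB: "is_space B" and sQ: "is_space Q" and lc: "linear_map Q (A \<otimes> B) c"
begin

lemma c_mem: "x \<in> acar Q \<Longrightarrow> c x \<in> acar (A \<otimes> B)"
  using lc by (simp add: linear_map_def)

lemmas reps = rep_list[of A c _ B, OF sA c_mem]

lemma rep_fun_apply:
  assumes F: "\<And>y. linf (\<lambda>x. F x y)" "\<And>x. linf (F x)"
  shows "rep_fun A B c EA EB RQ v F = c (RQ v) (\<lambda>x y. F (EA x) (EB y))"
  using realisation_bilinear[OF rA rB sA sB F]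
  by (subst reps(2)) (auto simp: rep_fun_def tlist_apply realisationD(5)[OF rQ])

lemma rep_fun_fsum: "fsum (\<lambda>v. EA (RA v)) (\<lambda>v. EB (RB v)) (rep_fun A B c EA EB RQ v)"
proof -
  have "\<forall>(x, y)\<in>set (rep_list A B c (RQ v)). x \<in> acar A \<and> y \<in> acar B"
    using reps(1)[OF realisationD(5)[OF rQ], of v] by (auto simp: legs_in_def)
  then show ?thesis
    unfolding fsum_def rep_fun_def
    by (intro exI[of _ "map (\<lambda>(x, y). (EA x, EB y)) (rep_list A B c (RQ v))"])
       (auto simp: tsum_map realisationD(6)[OF rA] realisationD(6)[OF rB])
qed

lemma rep_fun_lin:
  assumes F: "\<And>y. linf (\<lambda>x. F x y)" "\<And>x. linf (F x)"
  shows "linf (\<lambda>v. rep_fun A B c EA EB RQ v F)"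
  using lc realisationD(3-5)[OF rQ] unfolding rep_fun_apply[OF F] linf_def linear_map_def
  by (auto simp: tscale_def)

lemma rep_fun_pr: "rep_fun A B c EA EB RQ (EQ (RQ v)) = rep_fun A B c EA EB RQ v"
  unfolding rep_fun_def by (simp add: realisationD(5,6)[OF rQ])

end

locale realised_comodule = realised_tensor H P P \<alpha> EH RH EP RP EP RP
  for H :: "('k::field, 'h::ab_group_add, 'm) kalg_scheme" and P :: "('k, 'p::ab_group_add, 'n) kalg_scheme"
    and \<alpha> and EH :: "'h \<Rightarrow> 'i \<Rightarrow> 'k" and RH EP RP +
  assumes aH: "is_algebra H" and aP: "is_algebra P" and hom: "alg_hom P (H \<otimes> P) \<alpha>"
begin

abbreviation "coact' \<equiv> rep_fun H P \<alpha> EH EP RP"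

lemma coact'_M:
  assumes F: "\<And>y. linf (\<lambda>x. F x y)" "\<And>x. linf (F x)"
  shows "coact' (EP (amult P (RP v) (RP w))) F = 
    coact' v (\<lambda>g x. coact' w (\<lambda>k y. F (EH (amult H (RH g) (RH k))) (EP (amult P (RP x) (RP y)))))"
proof -
  let ?\<beta> = "\<lambda>x y. F (EH x) (EP y)"
  have vw: "RP v \<in> acar P" "RP w \<in> acar P" using rB by (auto simp: realisationD)
  have m: "amult P (RP v) (RP w) \<in> acar P"
    using aP vw by (auto simp: is_algebra_def bilinear_map_def linear_map_def)
  have "coact' (EP (amult P (RP v) (RP w))) F = \<alpha> (amult P (RP v) (RP w)) ?\<beta>"
    by (simp add: rep_fun_apply F realisationD(6)[OF rB] m)
  also have "\<dots> = amult (H \<otimes> P) (\<alpha> (RP v)) (\<alpha> (RP w)) ?\<beta>"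
    using hom vw by (simp add: alg_hom_def)
  also have "\<dots> = tsum (rep_list H P \<alpha> (RP v)) (\<lambda>a b. tsum (rep_list H P \<alpha> (RP w)) (\<lambda>c d. ?\<beta> (amult H a c) (amult P b d)))"
    by (simp only: reps(2)[OF vw(1)] reps(2)[OF vw(2)] amult_tlist[OF aH aP reps(1)[OF vw(1)] reps(1)[OF vw(2)]])
      (simp add: tsum_apply tpure_def realisation_bilinear[OF rA rB sA sB F])
  also have "\<dots> = coact' v (\<lambda>g x. coact' w (\<lambda>k y. F (EH (amult H (RH g) (RH k))) (EP (amult P (RP x) (RP y)))))"
    unfolding rep_fun_def using legs_inD[OF reps(1)[OF vw(1)]] legs_inD[OF reps(1)[OF vw(2)]]
    by (intro tsum_cong) (simp add: realisationD(6)[OF rA] realisationD(6)[OF rB])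
  finally show ?thesis .
qed

lemma coact'_e:
  assumes F: "\<And>y. linf (\<lambda>x. F x y)" "\<And>x. linf (F x)"
  shows "coact' (EP (aone P)) F = F (EH (aone H)) (EP (aone P))"
proof -
  have "aone P \<in> acar P" using aP by (simp add: is_algebra_def)
  then show ?thesis
    using hom realisation_bilinear[OF rA rB sA sB F] 
    by (simp add: rep_fun_apply F realisationD(6)[OF rB] alg_hom_def tpure_def)
qed

text \<open>
  The coassociativity axiom is an equation in \<open>H \<otimes> (H \<otimes> P)\<close>.  A trilinear \<open>T\<close> induces a linear functional
  \<open>?G\<close> on that space, and applying \<open>?G\<close> to the two sides gives the two Sweedler sums.
\<close>

lemma coact'_coassoc:
  assumes \<Delta>: "linear_map H (H \<otimes> H) \<Delta>"
    and co: "\<And>a. a \<in> acar P \<Longrightarrow> tassoc H H P (tmap H P (H \<otimes> H) P \<Delta> id (\<alpha> a)) = tmap H P H (H \<otimes> P) id \<alpha> (\<alpha> a)"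
    and T: "\<And>y z. linf (\<lambda>x. T x y z)" "\<And>x z. linf (\<lambda>y. T x y z)" "\<And>x y. linf (T x y)"
  shows "coact' v (\<lambda>g b. rep_fun H H \<Delta> EH EH RH g (\<lambda>x y. T x y b)) = coact' v (\<lambda>g b. coact' b (\<lambda>k c. T g k c))"
proof -
  have v: "RP v \<in> acar P" by (rule realisationD(5)[OF rB])
  have m: "\<Delta> x \<in> acar (H \<otimes> H)" if "x \<in> acar H" for x using \<Delta> that by (simp add: linear_map_def)
  note d = rep_list[of H \<Delta> _ H, OF sA m]
  let ?L = "rep_list H P \<alpha> (RP v)" and ?D = "rep_list H H \<Delta>"
  note L = reps[OF v] and LD = legs_inD[OF reps(1)[OF v]]
  let ?t = "\<lambda>x y z. T (EH x) (EH y) (EP z)"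
  let ?G = "tlift H (H \<otimes> P) (\<lambda>u s. tlift H P (?t u) s)"
  have E: "EH (x + y) = EH x + EH y" "EH (ascale H r x) = fscale r (EH x)"
    "EP (x' + y') = EP x' + EP y'" "EP (ascale P r x') = fscale r (EP x')" for x y r x' y'
    by (simp_all add: realisationD(1,2)[OF rA] realisationD(1,2)[OF rB])
  note Tl = linf_add[OF T(1)] linf_add[OF T(2)] linf_add[OF T(3)] linf_scale[OF T(1)] linf_scale[OF T(2)] linf_scale[OF T(3)]
  have t: "bilinear_map H P ground (?t u)" for u
    by (auto simp: bilinear_map_def linear_map_def E Tl)
  have G: "bilinear_map H (H \<otimes> P) ground (\<lambda>u s. tlift H P (?t u) s)"
    unfolding bilinear_map_def
    by (intro conjI ballI tlift_linear[OF sA sB is_space_ground t] bilinear_map_bind[OF sA sB sA is_space_ground] t)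
       (auto simp: linear_map_def E Tl)
  have Glin: "linear_map (H \<otimes> (H \<otimes> P)) ground ?G"
    by (rule tlift_linear[OF sA is_space_tensor is_space_ground G])
  have Gp: "?G (tpure H (H \<otimes> P) u (tpure H P x y)) = ?t u x y" if "u \<in> acar H" "x \<in> acar H" "y \<in> acar P" for u x y
    using that by (simp add: tlift_tpure[OF sA is_space_tensor is_space_ground G] tpure_mem tlift_tpure[OF sA sB is_space_ground t])
  have eq: "tsum ?L (\<lambda>x y. tsum (?D x) (\<lambda>u v. tpure H (H \<otimes> P) u (tpure H P v y)))
    = tlist H (H \<otimes> P) (map (\<lambda>(x, y). (id x, \<alpha> y)) ?L)"
  proof -
    have "tassoc H H P (tmap H P (H \<otimes> H) P \<Delta> id (tlist H P ?L)) =
      tsum ?L (\<lambda>x y. tsum (?D x) (\<lambda>u v. tpure H (H \<otimes> P) u (tpure H P v y)))"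
    proof (rule tassoc_tmap[OF sA sA sB sA \<Delta> L(1)])
      fix x y assume "(x, y) \<in> set ?L"
      with LD have "x \<in> acar H" by blast
      then show "legs_in H H (?D x) \<and> \<Delta> x = tlist H H (?D x)" using d by blast
    qed
    moreover have "tmap H P H (H \<otimes> P) id \<alpha> (tlist H P ?L) = tlist H (H \<otimes> P) (map (\<lambda>(x, y). (id x, \<alpha> y)) ?L)"
      by (rule tmap_tlist[OF sA sB sA is_space_tensor linear_map_id(1) lc L(1)])
    moreover have "tassoc H H P (tmap H P (H \<otimes> H) P \<Delta> id (tlist H P ?L)) = tmap H P H (H \<otimes> P) id \<alpha> (tlist H P ?L)"
      using co[OF v] by (simp only: L(2)[symmetric])
    ultimately show ?thesis by (simp only:)
  qed
  have Dmem: "u \<in> acar H \<and> w \<in> acar H" if "x \<in> acar H" "(u, w) \<in> set (?D x)" for x u w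
    using legs_inD[OF d(1)] that by blast
  have inner: "tpure H (H \<otimes> P) u (tpure H P w y) \<in> acar (H \<otimes> (H \<otimes> P))"
    if "(x, y) \<in> set ?L" "(u, w) \<in> set (?D x)" for x y u w
    by (intro tpure_mem) (simp_all only: LD[OF that(1)] Dmem[OF conjunct1[OF LD[OF that(1)]] that(2)])
  have "coact' v (\<lambda>g b. rep_fun H H \<Delta> EH EH RH g (\<lambda>x y. T x y b)) = 
    tsum ?L (\<lambda>x y. tsum (?D x) (\<lambda>u v. ?t u v y))"
    unfolding rep_fun_def by (rule tsum_cong) (simp only: LD realisationD(6)[OF rA])
  also have "\<dots> = tsum ?L (\<lambda>x y. ?G (tsum (?D x) (\<lambda>u v. tpure H (H \<otimes> P) u (tpure H P v y))))"
  proof (rule tsum_cong)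
    fix x y assume xy: "(x, y) \<in> set ?L"
    have "?G (tsum (?D x) (\<lambda>u v. tpure H (H \<otimes> P) u (tpure H P v y)))
      = tsum (?D x) (\<lambda>u v. ?G (tpure H (H \<otimes> P) u (tpure H P v y)))"
      by (rule linear_map_sum[OF Glin is_space_tensor]) (rule inner[OF xy])
    also have "\<dots> = tsum (?D x) (\<lambda>u v. ?t u v y)"
      by (rule tsum_cong, rule Gp) (simp_all only: LD[OF xy] Dmem[OF conjunct1[OF LD[OF xy]]])
    finally show "tsum (?D x) (\<lambda>u v. ?t u v y) = ?G (tsum (?D x) (\<lambda>u v. tpure H (H \<otimes> P) u (tpure H P v y)))" ..
  qed
  also have "\<dots> = ?G (tsum ?L (\<lambda>x y. tsum (?D x) (\<lambda>u v. tpure H (H \<otimes> P) u (tpure H P v y))))"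
    by (rule linear_map_sum[OF Glin is_space_tensor, symmetric]) (rule space_sum[OF is_space_tensor], rule inner)
  also have "\<dots> = tsum ?L (\<lambda>x y. tlift H P (?t x) (\<alpha> y))"
    unfolding eq using legs_in_map[OF linear_map_id(1) lc L(1)]
    by (subst tlift_tlist[OF sA is_space_tensor is_space_ground G]) (auto simp: tsum_map)
  also have "\<dots> = tsum ?L (\<lambda>x y. tsum (rep_list H P \<alpha> y) (?t x))"
  proof (rule tsum_cong)
    fix x y assume "(x, y) \<in> set ?L"
    with LD have y: "y \<in> acar P" by blast
    show "tlift H P (?t x) (\<alpha> y) = tsum (rep_list H P \<alpha> y) (?t x)"
      by (subst reps(2)[OF y]) (rule tlift_tlist[OF sA sB is_space_ground t reps(1)[OF y]])
  qed
  also have "\<dots> = coact' v (\<lambda>g b. coact' b (\<lambda>k c. T g k c))"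
    unfolding rep_fun_def by (rule tsum_cong) (simp only: LD realisationD(6)[OF rB])
  finally show ?thesis .
qed

lemma coact'_counit:
  assumes e: "linear_map H ground \<epsilon>"
    and co: "\<And>a. a \<in> acar P \<Longrightarrow> tlunit P (tmap H P ground P \<epsilon> id (\<alpha> a)) = a"
    and f: "linf f"
  shows "coact' v (\<lambda>g b. \<epsilon> (RH g) * f b) = f (EP (RP v))"
proof -
  have v: "RP v \<in> acar P" by (rule realisationD(5)[OF rB])
  note L = reps[OF v] and LD = legs_inD[OF reps(1)[OF v]]
  have "tlunit P (tmap H P ground P \<epsilon> id (\<alpha> (RP v))) = tsum (rep_list H P \<alpha> (RP v)) (\<lambda>g b. ascale P (\<epsilon> g) b)"
    by (subst L(2), subst tmap_tlist[OF sA sB is_space_ground sB e linear_map_id(1) L(1)],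
      subst tlunit_tlist[OF sB legs_in_map[OF e linear_map_id(1) L(1)]]) (simp add: tsum_map)
  then have *: "tsum (rep_list H P \<alpha> (RP v)) (\<lambda>g b. ascale P (\<epsilon> g) b) = RP v" using co[OF v] by simp
  have "f (EP (RP v)) = tsum (rep_list H P \<alpha> (RP v)) (\<lambda>g b. \<epsilon> g * f (EP b))"
    by (subst *[symmetric]) (simp add: E_tsum[OF rB] linf_tsum[OF f] realisationD(2)[OF rB] linf_scale[OF f])
  also have "\<dots> = coact' v (\<lambda>g b. \<epsilon> (RH g) * f b)"
    unfolding rep_fun_def using LD by (intro tsum_cong) (simp add: realisationD(6)[OF rA])
  finally show ?thesis ..
qed

end

section \<open>A Hopf algebra and a Galois object in Sweedler form\<close>

lemma algebra_closed:
  assumes "is_algebra A"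
  shows "is_space A" "aone A \<in> acar A" "x \<in> acar A \<Longrightarrow> y \<in> acar A \<Longrightarrow> amult A x y \<in> acar A"
    "x \<in> acar A \<Longrightarrow> y \<in> acar A \<Longrightarrow> z \<in> acar A \<Longrightarrow> amult A (amult A x y) z = amult A x (amult A y z)"
    "x \<in> acar A \<Longrightarrow> amult A (aone A) x = x" "x \<in> acar A \<Longrightarrow> amult A x (aone A) = x"
  using assms by (auto simp: is_algebra_def bilinear_map_def linear_map_def)

lemma algebra_linear:
  assumes "is_algebra A"
  shows "x \<in> acar A \<Longrightarrow> linear_map A A (amult A x)" "y \<in> acar A \<Longrightarrow> linear_map A A (\<lambda>x. amult A x y)"
  using assms by (auto simp: is_algebra_def bilinear_map_def)

locale galois_input =
  fixes H :: "('k::field, 'h::ab_group_add) hopf" and A :: "('k, 'a::ab_group_add) kalg"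
    and \<alpha> :: "'a \<Rightarrow> ('h, 'a, 'k) tens"
    and EH :: "'h \<Rightarrow> 'i \<Rightarrow> 'k" and RH :: "('i \<Rightarrow> 'k) \<Rightarrow> 'h" and EA :: "'a \<Rightarrow> 'i \<Rightarrow> 'k" and RA :: "('i \<Rightarrow> 'k) \<Rightarrow> 'a"
  assumes H: "is_hopf H" and G: "left_galois_object H A \<alpha>"
    and rH: "realisation H EH RH" and rA: "realisation A EA RA"
begin

lemma aH: "is_algebra H" and homH: "alg_hom H (H \<otimes> H) (hcomult H)"
  and homE: "alg_hom H ground (hcounit H)" and linS: "linear_map H H (hantipode H)"
  using H by (auto simp: is_hopf_def)

lemma aA: "is_algebra A" and homA: "alg_hom A (H \<otimes> A) \<alpha>"
  using G by (auto simp: left_galois_object_def left_comodule_algebra_def)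

lemmas sH = algebra_closed(1)[OF aH] and sA = algebra_closed(1)[OF aA]

lemma linE: "linear_map H ground (hcounit H)" and linD: "linear_map H (H \<otimes> H) (hcomult H)"
  and linA: "linear_map A (H \<otimes> A) \<alpha>"
  using homE homH homA by (auto simp: alg_hom_def)

sublocale D: realised_comodule H H "hcomult H" EH RH EH RH
  by unfold_locales (rule rH sH linD aH homH)+

sublocale C: realised_comodule H A \<alpha> EH RH EA RA
  by unfold_locales (rule rH rA sH sA linA aH aA homA)+

lemma RH_mem: "RH v \<in> acar H" and RA_mem: "RA v \<in> acar A"
  using rH rA by (auto simp: realisationD)

lemma REH: "x \<in> acar H \<Longrightarrow> RH (EH x) = x" and REA: "y \<in> acar A \<Longrightarrow> RA (EA y) = y"
  using rH rA by (auto simp: realisationD)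

lemma D_coassoc:
  assumes T: "\<And>y z. linf (\<lambda>x. T x y z)" "\<And>x z. linf (\<lambda>y. T x y z)" "\<And>x y. linf (T x y)"
  shows "D.coact' v (\<lambda>g b. D.coact' g (\<lambda>x y. T x y b)) = D.coact' v (\<lambda>g b. D.coact' b (\<lambda>k c. T g k c))"
  by (rule D.coact'_coassoc[OF linD _ T]) (use H in \<open>auto simp: is_hopf_def\<close>)

lemma C_coassoc:
  assumes T: "\<And>y z. linf (\<lambda>x. T x y z)" "\<And>x z. linf (\<lambda>y. T x y z)" "\<And>x y. linf (T x y)"
  shows "C.coact' v (\<lambda>g b. D.coact' g (\<lambda>x y. T x y b)) = C.coact' v (\<lambda>g b. C.coact' b (\<lambda>k c. T g k c))"
  by (rule C.coact'_coassoc[OF linD _ T]) (use G in \<open>auto simp: left_galois_object_def left_comodule_algebra_def\<close>)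

lemma D_counit: "linf f \<Longrightarrow> D.coact' v (\<lambda>g b. hcounit H (RH g) * f b) = f (EH (RH v))"
  by (rule D.coact'_counit[OF linE]) (use H in \<open>auto simp: is_hopf_def\<close>)

lemma C_counit: "linf f \<Longrightarrow> C.coact' v (\<lambda>g b. hcounit H (RH g) * f b) = f (EA (RA v))"
  by (rule C.coact'_counit[OF linE]) (use G in \<open>auto simp: left_galois_object_def left_comodule_algebra_def\<close>)

text \<open>
  Turns a vector identity for the comultiplication into one for Sweedler sums.
\<close>

lemma D_push:
  assumes f: "linf f" and eq: "tsum (rep_list H H (hcomult H) (RH v)) b = z"
    and F: "\<And>x y. x \<in> acar H \<Longrightarrow> y \<in> acar H \<Longrightarrow> F (EH x) (EH y) = f (EH (b x y))"
  shows "D.coact' v F = f (EH z)"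
  unfolding rep_fun_def eq[symmetric] E_tsum[OF rH] linf_tsum[OF f]
  using legs_inD[OF D.reps(1)[OF RH_mem]] by (intro tsum_cong F) auto

lemma D_counit':
  assumes f: "linf f"
  shows "D.coact' v (\<lambda>x y. f x * hcounit H (RH y)) = f (EH (RH v))"
proof (rule D_push[OF f])
  have "trunit H (tmap H H H ground id (hcounit H) (hcomult H (RH v))) = RH v"
    using H RH_mem by (auto simp: is_hopf_def)
  then show "tsum (rep_list H H (hcomult H) (RH v)) (\<lambda>x y. ascale H (hcounit H y) x) = RH v"
    by (simp only: D.reps(2)[OF RH_mem] tmap_tlist[OF sH sH sH is_space_ground linear_map_id(1) linE D.reps(1)[OF RH_mem]]
        trunit_tlist[OF sH legs_in_map[OF linear_map_id(1) linE D.reps(1)[OF RH_mem]]] tsum_map) (simp only: id_apply)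
qed (simp add: realisationD(2)[OF rH] REH linf_scale[OF f])

lemma D_S_right:
  assumes f: "linf f"
  shows "D.coact' v (\<lambda>x y. f (EH (amult H (RH x) (RH (EH (hantipode H (RH y))))))) = hcounit H (RH v) * f (EH (aone H))"
proof -
  have "tmult H (tmap H H H H id (hantipode H) (hcomult H (RH v))) = ascale H (hcounit H (RH v)) (aone H)"
    using H RH_mem by (auto simp: is_hopf_def)
  then have "tsum (rep_list H H (hcomult H) (RH v)) (\<lambda>x y. amult H x (hantipode H y)) = ascale H (hcounit H (RH v)) (aone H)"
    by (simp only: D.reps(2)[OF RH_mem] tmap_tlist[OF sH sH sH sH linear_map_id(1) linS D.reps(1)[OF RH_mem]]
        tmult_tlist[OF aH legs_in_map[OF linear_map_id(1) linS D.reps(1)[OF RH_mem]]] tsum_map) (simp only: id_apply)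
  from D_push[OF f this] show ?thesis
    using linS by (simp add: realisationD(2)[OF rH] REH linf_scale[OF f] linear_map_def)
qed

lemma D_S_left:
  assumes f: "linf f"
  shows "D.coact' v (\<lambda>x y. f (EH (amult H (RH (EH (hantipode H (RH x)))) (RH y)))) = hcounit H (RH v) * f (EH (aone H))"
proof -
  have "tmult H (tmap H H H H (hantipode H) id (hcomult H (RH v))) = ascale H (hcounit H (RH v)) (aone H)"
    using H RH_mem by (auto simp: is_hopf_def)
  then have "tsum (rep_list H H (hcomult H) (RH v)) (\<lambda>x y. amult H (hantipode H x) y) = ascale H (hcounit H (RH v)) (aone H)"
    by (simp only: D.reps(2)[OF RH_mem] tmap_tlist[OF sH sH sH sH linS linear_map_id(1) D.reps(1)[OF RH_mem]]
        tmult_tlist[OF aH legs_in_map[OF linS linear_map_id(1) D.reps(1)[OF RH_mem]]] tsum_map) (simp only: id_apply)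
  from D_push[OF f this] show ?thesis
    using linS by (simp add: realisationD(2)[OF rH] REH linf_scale[OF f] linear_map_def)
qed

abbreviation "can \<equiv> galois_map H A \<alpha>"

lemma can_linear: "linear_map (A \<otimes> A) (H \<otimes> A) can"
  unfolding galois_map_def
  by (rule linear_map_compose[OF linear_map_compose[OF 
    tmap_linear[OF sA sA linA linear_map_id(1)] tassoc_linear[OF sH sA sA]]
    tmap_linear[OF sH is_space_tensor linear_map_id(1) tmult_linear[OF aA]]])

lemma can_tlist:
  assumes xs: "legs_in A A xs"
  shows "can (tlist A A xs) = tsum xs (\<lambda>a b. tsum (rep_list H A \<alpha> a) (\<lambda>g y. tpure H A g (amult A y b)))"
proof -
  let ?T = "tmap H (A \<otimes> A) H A id (tmult A)"
  have T: "linear_map (H \<otimes> A \<otimes> A) (H \<otimes> A) ?T"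
    by (rule tmap_linear[OF sH is_space_tensor linear_map_id(1) tmult_linear[OF aA]])
  have Tp: "?T (tpure H (A \<otimes> A) g (tpure A A y b)) = tpure H A g (amult A y b)"
    if "g \<in> acar H" "y \<in> acar A" "b \<in> acar A" for g y b
    using that aA sA unfolding tmap_def
    by (subst tlift_tpure[OF sH is_space_tensor is_space_tensor bilinear_tpure[OF linear_map_id(1) tmult_linear[OF aA]]])
      (auto simp: tpure_mem tmult_def tlift_tpure is_algebra_def)
  have L: "legs_in H A (rep_list H A \<alpha> x) \<and> \<alpha> x = tlist H A (rep_list H A \<alpha> x)" if "x \<in> acar A" for x
    using C.reps that by blast
  have mem: "g \<in> acar H \<and> y \<in> acar A \<and> b \<in> acar A" if "(a, b) \<in> set xs" "(g, y) \<in> set (rep_list H A \<alpha> a)" for a b g y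
  proof -
    have "a \<in> acar A" "b \<in> acar A" using legs_inD[OF xs that(1)] by auto
    then show ?thesis using legs_inD[OF _ that(2)] L by blast
  qed
  have "can (tlist A A xs) = ?T (tsum xs (\<lambda>x y. tsum (rep_list H A \<alpha> x) (\<lambda>u v. tpure H (A \<otimes> A) u (tpure A A v y))))"
    unfolding galois_map_def using L legs_inD[OF xs]
    by (subst tassoc_tmap[OF sH sA sA sA linA xs, of "rep_list H A \<alpha>"]) auto
  also have "\<dots> = tsum xs (\<lambda>x y. ?T (tsum (rep_list H A \<alpha> x) (\<lambda>u v. tpure H (A \<otimes> A) u (tpure A A v y))))"
    by (rule linear_map_sum[OF T is_space_tensor], rule space_sum[OF is_space_tensor]) (auto intro!: tpure_mem dest: mem)
  also have "\<dots> = tsum xs (\<lambda>a b. tsum (rep_list H A \<alpha> a) (\<lambda>g y. tpure H A g (amult A y b)))"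
  proof (rule tsum_cong)
    fix a b assume ab: "(a, b) \<in> set xs"
    have "?T (tsum (rep_list H A \<alpha> a) (\<lambda>u v. tpure H (A \<otimes> A) u (tpure A A v b)))
      = tsum (rep_list H A \<alpha> a) (\<lambda>u v. ?T (tpure H (A \<otimes> A) u (tpure A A v b)))"
      by (rule linear_map_sum[OF T is_space_tensor]) (auto intro!: tpure_mem dest: mem[OF ab])
    also have "\<dots> = tsum (rep_list H A \<alpha> a) (\<lambda>g y. tpure H A g (amult A y b))"
      by (intro tsum_cong Tp) (auto dest: mem[OF ab])
    finally show "?T (tsum (rep_list H A \<alpha> a) (\<lambda>u v. tpure H (A \<otimes> A) u (tpure A A v b)))
      = tsum (rep_list H A \<alpha> a) (\<lambda>g y. tpure H A g (amult A y b))" .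
  qed
  finally show ?thesis .
qed

text \<open>
  The translation map \<open>\<kappa>\<close> of \<open>A\<close>.
\<close>

definition transl where "transl g = inv_into (acar (A \<otimes> A)) can (tpure H A g (aone A))"

lemma can_bij: "bij_betw can (acar (A \<otimes> A)) (acar (H \<otimes> A))"
  using G by (simp add: left_galois_object_def)

lemma transl_mem: "g \<in> acar H \<Longrightarrow> transl g \<in> acar (A \<otimes> A)"
  and can_transl: "g \<in> acar H \<Longrightarrow> can (transl g) = tpure H A g (aone A)"
  using can_bij tpure_mem[of g H "aone A" A] algebra_closed(2)[OF aA]
  by (auto simp: transl_def bij_betw_def inv_into_into f_inv_into_f)

lemma can_inject: "s \<in> acar (A \<otimes> A) \<Longrightarrow> t \<in> acar (A \<otimes> A) \<Longrightarrow> can s = can t \<Longrightarrow> s = t"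
  using can_bij by (auto simp: bij_betw_def inj_on_def)

lemma transl_linear: "linear_map H (A \<otimes> A) transl"
  unfolding linear_map_def
proof (intro conjI ballI allI)
  have c: "can (s + t) = can s + can t" "can (tscale c s) = tscale c (can s)"
    if "s \<in> acar (A \<otimes> A)" "t \<in> acar (A \<otimes> A)" for s t c
    using can_linear that by (auto simp: linear_map_def)
  fix x assume x: "x \<in> acar H"
  then show "transl x \<in> acar (A \<otimes> A)" by (rule transl_mem)
  show "transl (ascale H c x) = ascale (A \<otimes> A) c (transl x)" for c
    using x space_scale[OF is_space_tensor transl_mem[OF x], of c] space_scale[OF sH x]
    by (intro can_inject) (auto simp: transl_mem can_transl c[OF transl_mem[OF x] transl_mem[OF x]] tpure_bilinear)
  fix y assume y: "y \<in> acar H"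
  show "transl (x + y) = transl x + transl y"
    using x y space_add[OF is_space_tensor transl_mem[OF x] transl_mem[OF y]] space_add[OF sH x y]
    by (intro can_inject) (auto simp: transl_mem can_transl c[OF transl_mem[OF x] transl_mem[OF y]] tpure_bilinear)
qed

sublocale K: realised_tensor A A H transl EA RA EA RA EH RH
  by unfold_locales (rule rH rA sH sA transl_linear)+

abbreviation "kappaA \<equiv> rep_fun A A transl EA EA RH"

lemma can_transl_list:
  assumes g: "g \<in> acar H" and \<beta>: "bilinear_form H A \<beta>"
  shows "tsum (rep_list A A transl g) (\<lambda>u v. tsum (rep_list H A \<alpha> u) (\<lambda>k w. \<beta> k (amult A w v))) = \<beta> g (aone A)"
proof -
  have "can (tlist A A (rep_list A A transl g)) \<beta> = tpure H A g (aone A) \<beta>"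
    using can_transl[OF g] K.reps(2)[OF g] by simp
  then show ?thesis using \<beta>
    by (simp add: can_tlist[OF K.reps(1)[OF g]] tsum_apply tpure_def)
qed

lemma can_kappaA:
  assumes F: "\<And>y. linf (\<lambda>x. F x y)" "\<And>x. linf (F x)"
  shows "kappaA g (\<lambda>u v. C.coact' u (\<lambda>k w. F k (EA (amult A (RA w) (RA v))))) = F (EH (RH g)) (EA (aone A))"
proof -
  have "kappaA g (\<lambda>u v. C.coact' u (\<lambda>k w. F k (EA (amult A (RA w) (RA v))))) =
    tsum (rep_list A A transl (RH g)) (\<lambda>u v. tsum (rep_list H A \<alpha> u) (\<lambda>k w. F (EH k) (EA (amult A w v))))"
    unfolding rep_fun_def
  proof (rule tsum_cong)
    fix u v assume "(u, v) \<in> set (rep_list A A transl (RH g))"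
    then have uv: "u \<in> acar A" "v \<in> acar A" using legs_inD[OF K.reps(1)[OF RH_mem]] by blast+
    show "tsum (rep_list H A \<alpha> (RA (EA u))) (\<lambda>x y. F (EH x) (EA (amult A (RA (EA y)) (RA (EA v))))) =
       tsum (rep_list H A \<alpha> u) (\<lambda>k w. F (EH k) (EA (amult A w v)))"
      unfolding REA[OF uv(1)] REA[OF uv(2)]
      by (rule tsum_cong) (use legs_inD[OF C.reps(1)[OF uv(1)]] REA in auto)
  qed
  also have "\<dots> = F (EH (RH g)) (EA (aone A))"
    by (rule can_transl_list[OF RH_mem, where \<beta>="\<lambda>k y. F (EH k) (EA y)"])
      (rule realisation_bilinear[OF rH rA sH sA F])
  finally show ?thesis .
qed

text \<open>
  The tensor \<open>s = \<kappa>(x\<^sub>-\<^sub>1) (1 \<otimes> x\<^sub>0)\<close> and the tensor \<open>x \<otimes> 1\<close> have the same image \<open>x\<^sub>-\<^sub>1 \<otimes> x\<^sub>0\<close> under the Galois map, so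
  they agree.
\<close>

lemma kappaA_can:
  assumes F: "\<And>y. linf (\<lambda>x. F x y)" "\<And>x. linf (F x)"
  shows "C.coact' a (\<lambda>g b. kappaA g (\<lambda>u v. F u (EA (amult A (RA v) (RA b))))) = F (EA (RA a)) (EA (aone A))"
proof -
  let ?x = "RA a" and ?LK = "rep_list A A transl" and ?L = "rep_list H A \<alpha>"
  note x = RA_mem[of a]
  have memL: "g \<in> acar H \<and> b \<in> acar A" if "y \<in> acar A" "(g, b) \<in> set (?L y)" for g b y
    using legs_inD[OF C.reps(1)[OF that(1)] that(2)] .
  have memK: "u \<in> acar A \<and> v \<in> acar A" if "g \<in> acar H" "(u, v) \<in> set (?LK g)" for u v g
    using legs_inD[OF K.reps(1)[OF that(1)] that(2)] .
  define s where "s = tsum (?L ?x) (\<lambda>g b. tlist A A (map (\<lambda>(u, v). (u, amult A v b)) (?LK g)))"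
  have legs_in: "legs_in A A (map (\<lambda>(u, v). (u, amult A v b)) (?LK g))" if "g \<in> acar H" "b \<in> acar A" for g b
    using memK[OF that(1)] that(2) algebra_closed(3)[OF aA] by (fastforce simp: legs_in_def)
  have mem: "tlist A A (map (\<lambda>(u, v). (u, amult A v b)) (?LK g)) \<in> acar (A \<otimes> A)"
    if "(g, b) \<in> set (?L ?x)" for g b
    using memL[OF x that] by (intro tlist_mem[OF sA] legs_in) auto
  have s: "s \<in> acar (A \<otimes> A)"
    unfolding s_def by (rule space_sum[OF is_space_tensor mem])
  have p1: "tpure A A ?x (aone A) \<in> acar (A \<otimes> A)" using x algebra_closed(2)[OF aA] by (rule tpure_mem)
  have "can s = tsum (?L ?x) (\<lambda>g b. can (tlist A A (map (\<lambda>(u, v). (u, amult A v b)) (?LK g))))"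
    unfolding s_def by (rule linear_map_sum[OF can_linear is_space_tensor mem])
  also have "\<dots> = tsum (?L ?x) (\<lambda>g b. tpure H A g b)"
  proof (rule tsum_cong)
    fix g b assume "(g, b) \<in> set (?L ?x)"
    with memL[OF x] have g: "g \<in> acar H" and b: "b \<in> acar A" by blast+
    have "can (tlist A A (map (\<lambda>(u, v). (u, amult A v b)) (?LK g))) =
       tsum (?LK g) (\<lambda>u v. tsum (?L u) (\<lambda>k w. tpure H A k (amult A w (amult A v b))))" (is "?l = ?r")
      using legs_in[OF g b] by (simp only: can_tlist tsum_map)
    also have "\<dots> = tpure H A g b"
    proof
      fix \<beta>
      show "?r \<beta> = tpure H A g b \<beta>"
      proof (cases "bilinear_form H A \<beta>")
        case True
        have bil: "bilinear_form H A (\<lambda>k y. \<beta> k (amult A (RA (EA y)) b))"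
          using True algebra_linear(2)[OF aA b] RA_mem sH sA
          by (auto simp: bilinear_form_def Vector_Spaces.linear_iff linear_map_def
              realisationD(1-4)[OF rA])
        have "?r \<beta> = tsum (?LK g) (\<lambda>u v. tsum (?L u) (\<lambda>k w. \<beta> k (amult A w (amult A v b))))"
          using True by (simp add: tsum_apply tpure_def)
        also have "\<dots> = tsum (?LK g) (\<lambda>u v. tsum (?L u) (\<lambda>k w. \<beta> k (amult A (RA (EA (amult A w v))) b)))"
        proof (intro tsum_cong)
          fix u v k w assume "(u, v) \<in> set (?LK g)" "(k, w) \<in> set (?L u)"
          then have "v \<in> acar A" "w \<in> acar A" using memK[OF g] memL by blast+
          then show "\<beta> k (amult A w (amult A v b)) = \<beta> k (amult A (RA (EA (amult A w v))) b)"
            using b algebra_closed(3,4)[OF aA] by (simp add: REA)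
        qed
        also have "\<dots> = \<beta> g b"
          using b algebra_closed(2,5)[OF aA] by (subst can_transl_list[OF g bil]) (simp add: REA)
        finally show ?thesis using True by (simp add: tpure_def)
      qed (simp add: tsum_apply tpure_def tsum_zero)
    qed
    finally show "can (tlist A A (map (\<lambda>(u, v). (u, amult A v b)) (?LK g))) = tpure H A g b" .
  qed
  also have "\<dots> = \<alpha> ?x" by (simp only: C.reps(2)[OF x, unfolded tlist_def])
  also have "\<dots> = can (tpure A A ?x (aone A))"
  proof -
    have "can (tlist A A [(?x, aone A)]) = tsum (?L ?x) (\<lambda>g y. tpure H A g (amult A y (aone A)))"
      using x algebra_closed(2)[OF aA] by (subst can_tlist) auto
    also have "\<dots> = tsum (?L ?x) (\<lambda>g y. tpure H A g y)"
      using memL[OF x] algebra_closed(6)[OF aA] by (intro tsum_cong) auto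
    finally show ?thesis by (simp add: tlist_def[of A A] C.reps(2)[OF x, unfolded tlist_def])
  qed
  finally have "s = tpure A A ?x (aone A)" by (rule can_inject[OF s p1])
  then have "s (\<lambda>x y. F (EA x) (EA y)) = F (EA ?x) (EA (aone A))"
    by (simp add: tpure_def realisation_bilinear[OF rA rA sA sA F])
  moreover have "s (\<lambda>x y. F (EA x) (EA y)) = C.coact' a (\<lambda>g b. kappaA g (\<lambda>u v. F u (EA (amult A (RA v) (RA b)))))"
    unfolding s_def rep_fun_def tsum_apply tlist_apply
  proof (rule tsum_cong)
    fix g b assume "(g, b) \<in> set (?L ?x)"
    with memL[OF x] have g: "g \<in> acar H" and b: "b \<in> acar A" by blast+
    have "tsum (?LK g) (\<lambda>u v. F (EA u) (EA (amult A v b))) = 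
      tsum (?LK g) (\<lambda>u v. F (EA u) (EA (amult A (RA (EA v)) b)))"
      using memK[OF g] REA by (intro tsum_cong) auto
    then show "(if bilinear_form A A (\<lambda>x y. F (EA x) (EA y))
        then tsum (map (\<lambda>(u, v). (u, amult A v b)) (?LK g)) (\<lambda>x y. F (EA x) (EA y)) else 0) =
       tsum (?LK (RH (EH g))) (\<lambda>u v. F (EA u) (EA (amult A (RA (EA v)) (RA (EA b)))))"
      by (simp add: realisation_bilinear[OF rA rA sA sA F] REH[OF g] REA[OF b] tsum_map)
  qed
  ultimately show ?thesis by simp
qed

end

section \<open>Coordinates on tensor products\<close>

text \<open>
  The type of functions on lists has room for the spaces and for their tensor products: vectors of
  \<open>H\<close> and \<open>A\<close> are supported on lists of length one, and their tensor products on lists of length two.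
\<close>

definition Fin :: "('k::field, 'x list \<Rightarrow> 'k) kalg" where
  "Fin = \<lparr>acar = {v. finite {l. v l \<noteq> 0} \<and> (\<forall>l. v l \<noteq> 0 \<longrightarrow> (\<exists>a. l = [a]))}, ascale = fscale,
     amult = (\<lambda>x y. x), aone = 0\<rparr>"

definition tau :: "('x list \<Rightarrow> 'k::field) \<Rightarrow> ('x list \<Rightarrow> 'k) \<Rightarrow> 'x list \<Rightarrow> 'k" where
  "tau p q l = (case l of [a, b] \<Rightarrow> p [a] * q [b] | _ \<Rightarrow> 0)"

definition coords :: "('x list \<Rightarrow> 'k::field, 'x list \<Rightarrow> 'k, 'k) tens \<Rightarrow> 'x list \<Rightarrow> 'k" where
  "coords t l = (case l of [a, b] \<Rightarrow> t (\<lambda>p q. p [a] * q [b]) | _ \<Rightarrow> 0)"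

lemma ascale_Fin [simp]: "ascale Fin = fscale"
  by (simp add: Fin_def)

lemma linf_coord': "linf (\<lambda>x. x i)"
  by (simp add: linf_def fscale_def)

lemma bil_coord: "bilinear_form Fin Fin (\<lambda>p q. p [a] * q [b])"
  by (auto simp: bilinear_form_linf intro!: lin linf_coord')

lemma coords_tpure: "coords (tpure Fin Fin p q) = tau p q"
  by (auto simp: coords_def tau_def tpure_def bil_coord fun_eq_iff split: list.splits)

lemma coords_linear: "Vector_Spaces.linear tscale fscale coords"
  unfolding Vector_Spaces.linear_iff
  by (auto simp: vector_space_fscale vector_space_tscale coords_def tscale_def fscale_def fun_eq_iff split: list.splits)

lemma Fin_space: "is_space Fin"
proof -
  interpret V: vector_space "fscale :: 'a::field \<Rightarrow> ('b list \<Rightarrow> 'a) \<Rightarrow> _" by (rule vector_space_fscale)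
  have "finite {l. x l + y l \<noteq> 0}" if "finite {l. x l \<noteq> 0}" "finite {l. y l \<noteq> 0}" for x y :: "'b list \<Rightarrow> 'a"
    by (rule finite_subset[of _ "{l. x l \<noteq> 0} \<union> {l. y l \<noteq> 0}"]) (use that in auto)
  moreover have "finite {l. c * x l \<noteq> 0}" if "finite {l. x l \<noteq> 0}" for x :: "'b list \<Rightarrow> 'a" and c
    by (rule finite_subset[of _ "{l. x l \<noteq> 0}"]) (use that in auto)
  moreover have "x l \<noteq> 0 \<or> y l \<noteq> 0" if "x l + y l \<noteq> 0" for x y :: "'b list \<Rightarrow> 'a" and l
    using that by auto
  ultimately show ?thesis
    unfolding is_space_def Fin_def
    by (auto simp: vector_space_fscale V.subspace_def fscale_def) blast+
qed

text \<open>
  A tensor \<open>t\<close> of finitely supported functions is determined by its coordinates: on a bilinear form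
  \<open>\<beta>\<close> it takes the value \<open>\<Sum>l m. t(l,m) \<beta>(d l, d m)\<close> with unit vectors \<open>d l\<close>, a sum over a finite set that
  contains the supports of all legs.
\<close>

lemma coords_inj: "inj_on coords (acar (Fin \<otimes> Fin))"
proof (rule inj_onI)
  fix s t :: "('x list \<Rightarrow> 'k::field, 'x list \<Rightarrow> 'k, 'k) tens"
  assume st: "s \<in> acar (Fin \<otimes> Fin)" "t \<in> acar (Fin \<otimes> Fin)" and eq: "coords s = coords t"
  obtain xs where xs: "legs_in Fin Fin xs" "s = tlist Fin Fin xs" using acar_tensorE[OF Fin_space st(1)] .
  obtain ys where ys: "legs_in Fin Fin ys" "t = tlist Fin Fin ys" using acar_tensorE[OF Fin_space st(2)] .
  \<comment> \<open>All tensors in question live on the finite set \<open>B\<close> of indices.\<close>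
  define B where "B = (\<Union>(x, y)\<in>set xs \<union> set ys. {l. x l \<noteq> 0} \<union> {l. y l \<noteq> 0})"
  have "finite {l. x l \<noteq> 0} \<and> finite {l. y l \<noteq> 0}" if "(x, y) \<in> set xs \<union> set ys" for x y
    using that legs_inD[OF xs(1)] legs_inD[OF ys(1)] by (auto simp: Fin_def)
  then have B: "finite B" unfolding B_def by auto
  define d where "d l = (\<lambda>l'. if l' = l then 1 else 0 :: 'k)" for l :: "'x list"
  have expand: "x = (\<Sum>l\<in>B. fscale (x l) (d l))" if "{l. x l \<noteq> 0} \<subseteq> B" for x
  proof
    fix i
    have "(\<Sum>l\<in>B. fscale (x l) (d l)) i = (\<Sum>l\<in>B. if l = i then x l else 0)"
      by (auto simp: sum_fun_apply fscale_def d_def intro!: sum.cong)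
    then show "x i = (\<Sum>l\<in>B. fscale (x l) (d l)) i" using that B by auto
  qed
  have apply_eq: "tsum zs \<beta> = (\<Sum>l\<in>B. \<Sum>m\<in>B. tsum zs (\<lambda>x y. x l * y m) * \<beta> (d l) (d m))"
    if \<beta>: "bilinear_form Fin Fin \<beta>" and zs: "set zs \<subseteq> set xs \<union> set ys" for zs \<beta>
  proof -
    have b: "linf (\<lambda>x. \<beta> x y)" "linf (\<beta> x)" for x y using \<beta> by (auto simp: bilinear_form_linf)
    have "tsum zs \<beta> = tsum zs (\<lambda>x y. \<Sum>l\<in>B. \<Sum>m\<in>B. x l * y m * \<beta> (d l) (d m))"
    proof (rule tsum_cong)
      fix x y assume "(x, y) \<in> set zs"
      then have "{l. x l \<noteq> 0} \<subseteq> B" "{l. y l \<noteq> 0} \<subseteq> B" using zs unfolding B_def by fast+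
      note xy = this[THEN expand]
      have "\<beta> x y = (\<Sum>l\<in>B. x l * \<beta> (d l) y)"
        by (subst xy(1)) (simp add: linf_sum[OF b(1)] linf_scale[OF b(1)])
      moreover have "\<beta> z y = (\<Sum>m\<in>B. y m * \<beta> z (d m))" for z
        by (subst xy(2)) (simp add: linf_sum[OF b(2)] linf_scale[OF b(2)])
      ultimately show "\<beta> x y = (\<Sum>l\<in>B. \<Sum>m\<in>B. x l * y m * \<beta> (d l) (d m))"
        by (simp add: sum_distrib_left mult.assoc)
    qed
    also have "\<dots> = (\<Sum>l\<in>B. \<Sum>m\<in>B. tsum zs (\<lambda>x y. x l * y m) * \<beta> (d l) (d m))"
      unfolding tsum_sum
      by (intro sum.cong refl, induction zs) (auto simp: algebra_simps)
    finally show ?thesis .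
  qed
  have co: "tsum xs (\<lambda>x y. x l * y m) = tsum ys (\<lambda>x y. x l * y m)" if lm: "l \<in> B" "m \<in> B" for l m
  proof -
    have "\<exists>a. l = [a]" if l: "l \<in> B" for l
    proof -
      obtain x y where xy: "(x, y) \<in> set xs \<union> set ys" "x l \<noteq> 0 \<or> y l \<noteq> 0"
        using l by (auto simp: B_def)
      then have "x \<in> acar Fin" "y \<in> acar Fin" using legs_inD[OF xs(1)] legs_inD[OF ys(1)] by blast+
      then show ?thesis using xy(2) by (auto simp: Fin_def)
    qed
    then obtain a b where "l = [a]" "m = [b]" using lm by metis
    moreover have "coords s [a, b] = coords t [a, b]" using eq by simp
    ultimately show ?thesis by (simp add: coords_def xs(2) ys(2) tlist_apply bil_coord)
  qed
  show "s = t"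
  proof (rule tensor_eqI[OF st Fin_space])
    fix \<beta> :: "('x list \<Rightarrow> 'k) \<Rightarrow> ('x list \<Rightarrow> 'k) \<Rightarrow> 'k"
    assume \<beta>: "bilinear_form Fin Fin \<beta>"
    have "tsum xs \<beta> = tsum ys \<beta>"
      using apply_eq[OF \<beta>, of xs] apply_eq[OF \<beta>, of ys] co by (simp cong: sum.cong)
    then show "s \<beta> = t \<beta>" using \<beta> by (simp add: xs(2) ys(2) tlist_apply)
  qed
qed

definition of_coords :: "('x list \<Rightarrow> 'k::field) \<Rightarrow> ('x list \<Rightarrow> 'k, 'x list \<Rightarrow> 'k, 'k) tens" where
  "of_coords = (SOME g. range g \<subseteq> acar (Fin \<otimes> Fin) \<and> Vector_Spaces.linear fscale tscale g \<and>
    (\<forall>t\<in>acar (Fin \<otimes> Fin). g (coords t) = t))"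

lemma of_coords:
  fixes v :: "'x list \<Rightarrow> 'k::field" and t :: "('x list \<Rightarrow> 'k, 'x list \<Rightarrow> 'k, 'k) tens"
  shows "of_coords v \<in> acar (Fin \<otimes> Fin)"
    "Vector_Spaces.linear fscale tscale (of_coords :: _ \<Rightarrow> ('x list \<Rightarrow> 'k, 'x list \<Rightarrow> 'k, 'k) tens)"
    "t \<in> acar (Fin \<otimes> Fin) \<Longrightarrow> of_coords (coords t) = t"
proof -
  interpret VT: vector_space_pair "tscale :: 'k \<Rightarrow> ('x list \<Rightarrow> 'k, 'x list \<Rightarrow> 'k, 'k) tens \<Rightarrow> _"
      "fscale :: 'k \<Rightarrow> ('x list \<Rightarrow> 'k) \<Rightarrow> _"
    by (simp add: vector_space_pair_def vector_space_fscale vector_space_tscale)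
  have sub: "VT.vs1.subspace (acar (Fin \<otimes> Fin))"
    using is_space_tensor[of "Fin :: ('k, 'x list \<Rightarrow> 'k) kalg" "Fin :: ('k, 'x list \<Rightarrow> 'k) kalg"]
    by (simp add: is_space_def)
  let ?g = "of_coords :: _ \<Rightarrow> ('x list \<Rightarrow> 'k, 'x list \<Rightarrow> 'k, 'k) tens"
  from VT.linear_exists_left_inverse_on[OF coords_linear sub coords_inj]
  have *: "range ?g \<subseteq> acar (Fin \<otimes> Fin) \<and> Vector_Spaces.linear fscale tscale ?g \<and>
      (\<forall>t\<in>acar (Fin \<otimes> Fin). ?g (coords t) = t)"
    unfolding of_coords_def by (rule someI_ex)
  show "of_coords v \<in> acar (Fin \<otimes> Fin)"
    by (rule subsetD[OF conjunct1[OF *] rangeI])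
  show "Vector_Spaces.linear fscale tscale ?g"
    by (rule conjunct1[OF conjunct2[OF *]])
  show "t \<in> acar (Fin \<otimes> Fin) \<Longrightarrow> of_coords (coords t) = t"
    by (rule bspec[OF conjunct2[OF conjunct2[OF *]]])
qed

lemma tau_linv: "linv (\<lambda>x. tau x y)" "linv (tau x)"
  by (auto simp: linv_def linf_def tau_def fscale_def algebra_simps split: list.splits)

lemma linf_exists:
  assumes "v \<noteq> (0 :: 'i \<Rightarrow> 'k::field)"
  shows "\<exists>f. linf f \<and> f v = 1"
proof -
  obtain i where "v i \<noteq> 0" using assms by (auto simp: fun_eq_iff)
  then show ?thesis
    by (intro exI[of _ "\<lambda>x. inverse (v i) * x i"]) (auto intro!: lin linf_coord')
qed

section \<open>The cogroupoid of a Galois object\<close>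

text \<open>
  The family of Galois objects is indexed by the Booleans, with \<open>True\<close> for the Hopf algebra \<open>H\<close> and
  \<open>False\<close> for \<open>A\<close>.  The operations with prefix \<open>f\<close> are those of the family.
\<close>

locale galois_input_finite = galois_input H A \<alpha> EH RH EA RA
  for H :: "('k::field, 'h::ab_group_add) hopf" and A :: "('k, 'a::ab_group_add) kalg" and \<alpha>
    and EH :: "'h \<Rightarrow> 'x list \<Rightarrow> 'k" and RH EA RA +
  assumes EH_Fin: "EH x \<in> acar Fin" and EA_Fin: "EA y \<in> acar Fin"
begin

definition fpr where "fpr Z v = (if Z then EH (RH v) else EA (RA v))"
definition fM where "fM Z v w = (if Z then EH (amult H (RH v) (RH w)) else EA (amult A (RA v) (RA w)))"
definition fe where "fe Z = (if Z then EH (aone H) else EA (aone A))"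
definition fcoact where "fcoact Z = (if Z then D.coact' else C.coact')"
definition feps where "feps v = hcounit H (RH v)"
definition fS where "fS v = EH (hantipode H (RH v))"
definition fkappa where "fkappa Z = (if Z then (\<lambda>v F. D.coact' v (\<lambda>x y. F x (fS y))) else kappaA)"
definition fw where "fw Z = (SOME f. linf f \<and> f (fe Z) = 1)"
definition flift where
  "flift Z W v F = tsum (rep_list Fin Fin of_coords v) (\<lambda>x y. F (fpr Z x) (fpr W y))"

lemma EH_lin: "EH (x + y) = EH x + EH y" "EH (ascale H c x) = fscale c (EH x)"
  and EA_lin: "EA (x' + y') = EA x' + EA y'" "EA (ascale A c x') = fscale c (EA x')"
  and RH_lin: "RH (v + w) = RH v + RH w" "RH (fscale c v) = ascale H c (RH v)"
  and RA_lin: "RA (v + w) = RA v + RA w" "RA (fscale c v) = ascale A c (RA v)"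
  using rH rA by (auto simp: realisationD)

lemma fpr_linv: "linv (fpr Z)"
  unfolding fpr_def using realisation_linv[OF rH] realisation_linv[OF rA] by (cases Z) simp_all

lemma fe_nz: "fe Z \<noteq> 0"
proof
  assume "fe Z = 0"
  moreover have "RH 0 = 0" "RA 0 = 0"
    using RH_lin(1)[of 0 0] RA_lin(1)[of 0 0] by simp_all
  moreover have "aone H \<noteq> 0"
  proof
    assume "aone H = 0"
    moreover have "hcounit H (0 + 0) = hcounit H 0 + hcounit H 0"
      using linE is_space_closed(1)[OF sH] unfolding linear_map_def by blast
    moreover have "hcounit H (aone H) = 1" using homE by (simp add: alg_hom_def)
    ultimately show False by (metis add_0 add_cancel_right_right zero_neq_one)
  qed
  moreover have "aone A \<noteq> 0"
  proof
    assume 0: "aone A = 0"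
    have "x = 0" if x: "x \<in> acar A" for x
    proof -
      have "amult A (0 + 0) x = amult A 0 x + amult A 0 x"
        using algebra_linear(2)[OF aA x] is_space_closed(1)[OF sA] unfolding linear_map_def by blast
      moreover have "amult A 0 x = x" using algebra_closed(5)[OF aA x] 0 by simp
      ultimately show ?thesis by (metis add_0 add_cancel_right_right)
    qed
    then show False using G is_space_closed(1)[OF sA] by (auto simp: left_galois_object_def)
  qed
  ultimately show False
    using REH[OF algebra_closed(2)[OF aH]] REA[OF algebra_closed(2)[OF aA]]
    by (auto simp: fe_def split: if_splits)
qed

lemma fpr_Fin: "fpr Z v = v \<Longrightarrow> v \<in> acar Fin"
  using EH_Fin[of "RH v"] EA_Fin[of "RA v"] by (auto simp: fpr_def split: if_splits)

lemma flift_apply: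
  assumes F: "\<And>y. linf (\<lambda>x. F x y)" "\<And>x. linf (F x)"
  shows "flift Z W v F = of_coords v (\<lambda>x y. F (fpr Z x) (fpr W y))"
proof -
  have "bilinear_form Fin Fin (\<lambda>x y. F (fpr Z x) (fpr W y))"
    by (simp add: bilinear_form_linf linf_comp[OF F(1) fpr_linv] linf_comp[OF F(2) fpr_linv])
  then show ?thesis unfolding flift_def
    by (subst rep_list(2)[of Fin of_coords v Fin, OF Fin_space of_coords(1)]) (simp add: tlist_apply)
qed

lemma family: "comodule_algebras True fpr fM fe fcoact feps fS"
proof
  note defs = fpr_def fM_def fe_def fcoact_def feps_def fS_def
  note cl = algebra_closed(2-)[OF aH] algebra_closed(2-)[OF aA] 
  have SH: "hantipode H x \<in> acar H" if "x \<in> acar H" for x using linS that by (simp add: linear_map_def)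
  note r = RH_mem RA_mem REH REA cl SH
  fix Z :: bool and x y z :: "'x list \<Rightarrow> 'k"
  show "linv (fpr Z)" by (rule fpr_linv)
  show "fpr Z (fpr Z x) = fpr Z x" by (simp add: defs r)
  show "linv (\<lambda>x. fM Z x y)"
    using algebra_linear(2)[OF aH RH_mem, of y] algebra_linear(2)[OF aA RA_mem, of y]
    by (cases Z) (auto simp: defs linv_def linf_def RH_lin RA_lin EH_lin EA_lin linear_map_def r, auto simp: fscale_def)
  show "linv (fM Z x)"
    using algebra_linear(1)[OF aH RH_mem, of x] algebra_linear(1)[OF aA RA_mem, of x]
    by (cases Z) (auto simp: defs linv_def linf_def RH_lin RA_lin EH_lin EA_lin linear_map_def r, auto simp: fscale_def)
  show "fpr Z (fM Z x y) = fM Z x y" "fM Z (fpr Z x) y = fM Z x y" "fM Z x (fpr Z y) = fM Z x y"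
    "fM Z (fM Z x y) z = fM Z x (fM Z y z)" "fM Z (fe Z) x = fpr Z x" "fM Z x (fe Z) = fpr Z x" "fpr Z (fe Z) = fe Z"
    by (simp_all add: defs r)
  show "fe Z \<noteq> 0" by (rule fe_nz)
  show "fsum (fpr True) (fpr Z) (fcoact Z x)"
    using D.rep_fun_fsum C.rep_fun_fsum by (cases Z) (simp_all add: fpr_def[abs_def] fcoact_def)
  show "fcoact Z (fpr Z x) = fcoact Z x"
    using D.rep_fun_pr C.rep_fun_pr by (cases Z) (simp_all add: defs)
  show "linf feps" using linE RH_mem by (auto simp: linf_def feps_def linear_map_def RH_lin)
  show "feps (fM True x y) = feps x * feps y" "feps (fe True) = 1" "feps (fpr True x) = feps x"
    using homE by (simp_all add: defs r alg_hom_def)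
  show "linv fS" using linear_map_linv[OF rH rH linS] by (simp add: fS_def[abs_def])
  show "fpr True (fS x) = fS x" "fS (fpr True x) = fS x" by (simp_all add: defs r)
  show "linf (\<lambda>a. fcoact Z a F)" if "\<And>y. linf (\<lambda>x. F x y)" "\<And>x. linf (F x)" for F
    using D.rep_fun_lin[OF that] C.rep_fun_lin[OF that] by (cases Z) (simp_all add: defs)
  show "fcoact Z (fM Z x y) F = fcoact Z x (\<lambda>g x. fcoact Z y (\<lambda>k y. F (fM True g k) (fM Z x y)))"
    if "\<And>y. linf (\<lambda>x. F x y)" "\<And>x. linf (F x)" for F
    using D.coact'_M[OF that] C.coact'_M[OF that] by (cases Z) (simp_all add: defs)
  show "fcoact Z (fe Z) F = F (fe True) (fe Z)" if "\<And>y. linf (\<lambda>x. F x y)" "\<And>x. linf (F x)" for F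
    using D.coact'_e[OF that] C.coact'_e[OF that] by (cases Z) (simp_all add: defs)
  show "fcoact Z x (\<lambda>g b. fcoact True g (\<lambda>x y. T x y b)) = fcoact Z x (\<lambda>g b. fcoact Z b (\<lambda>k c. T g k c))"
    if "\<And>y z. linf (\<lambda>x. T x y z)" "\<And>x z. linf (\<lambda>y. T x y z)" "\<And>x y. linf (T x y)" for T
    using D_coassoc[OF that] C_coassoc[OF that] by (cases Z) (simp_all add: defs)
  fix f :: "('x list \<Rightarrow> 'k) \<Rightarrow> 'k" assume f: "linf f"
  show "fcoact Z x (\<lambda>g b. feps g * f b) = f (fpr Z x)"
    using D_counit[OF f] C_counit[OF f] by (cases Z) (simp_all add: defs)
  show "fcoact True x (\<lambda>x y. f x * feps y) = f (fpr True x)"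
    using D_counit'[OF f] by (simp add: defs)
  show "fcoact True x (\<lambda>x y. f (fM True x (fS y))) = feps x * f (fe True)"
    using D_S_right[OF f] by (simp add: defs)
  show "fcoact True x (\<lambda>x y. f (fM True (fS x) y)) = feps x * f (fe True)"
    using D_S_left[OF f] by (simp add: defs)
qed

sublocale fam: comodule_algebras True fpr fM fe fcoact feps fS by (rule family)

lemma cogroupoid: "galois_cogroupoid True fpr fM fe fcoact feps fS fkappa tau flift fw"
proof
  fix Z W :: bool and x y :: "'x list \<Rightarrow> 'k"
  have w: "linf (fw Z) \<and> fw Z (fe Z) = 1"
    unfolding fw_def by (rule someI_ex[OF linf_exists[OF fe_nz]])
  then show "linf (fw Z)" "fw Z (fe Z) = 1" by auto
  show "linv (\<lambda>x. tau x y)" "linv (tau x)" by (rule tau_linv)+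
  show "fsum (fpr Z) (fpr W) (flift Z W x)"
    unfolding fsum_def flift_def[abs_def]
    by (intro exI[of _ "map (\<lambda>(x, y). (fpr Z x, fpr W y)) (rep_list Fin Fin of_coords x)"])
      (auto simp: tsum_map fun_eq_iff)
  have kappa_True: "fkappa True v F = fcoact True v (\<lambda>x y. F x (fS y))" for v F
    by (simp add: fkappa_def fcoact_def)
  have "RH (EH (hantipode H (RH v))) = hantipode H (RH v)" for v
    using linS RH_mem by (intro REH) (simp add: linear_map_def)
  then show "fsum (fpr Z) (fpr Z) (fkappa Z x)"
    using K.rep_fun_fsum fsum_map[OF D.rep_fun_fsum, of "fpr True" "\<lambda>x. x" "fpr True" fS x]
    by (cases Z) (auto simp: fkappa_def fpr_def[abs_def] fS_def)
  show "fkappa Z (fpr True x) = fkappa Z x"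
    by (cases Z) (simp_all only: fkappa_def fpr_def if_True if_False D.rep_fun_pr K.rep_fun_pr)
  fix F :: "('x list \<Rightarrow> 'k) \<Rightarrow> ('x list \<Rightarrow> 'k) \<Rightarrow> 'k"
  assume F: "\<And>y. linf (\<lambda>x. F x y)" "\<And>x. linf (F x)"
  show "linf (\<lambda>c. flift Z W c F)"
  proof -
    have "Vector_Spaces.linear fscale tscale (of_coords :: ('x list \<Rightarrow> 'k) \<Rightarrow> _)" by (rule of_coords(2))
    then show ?thesis
      unfolding flift_apply[OF F] by (auto simp: linf_def Vector_Spaces.linear_iff tscale_def)
  qed
  show "flift Z W (tau x y) F = F x y" if "fpr Z x = x" "fpr W y = y"
  proof -
    have "tpure Fin Fin x y \<in> acar (Fin \<otimes> Fin)" using that by (intro tpure_mem fpr_Fin)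
    from of_coords(3)[OF this] have "of_coords (tau x y) = tpure Fin Fin x y" by (simp add: coords_tpure)
    moreover have "bilinear_form Fin Fin (\<lambda>x y. F (fpr Z x) (fpr W y))"
      by (simp add: bilinear_form_linf linf_comp[OF F(1) fpr_linv] linf_comp[OF F(2) fpr_linv])
    ultimately show ?thesis by (simp add: flift_apply[OF F] tpure_def that)
  qed
  show "linf (\<lambda>a. fkappa Z a F)"
    using K.rep_fun_lin[OF F] fam.coact_lin[of "\<lambda>x y. F x (fS y)" True] F linf_comp[OF F(2) fam.S_lin]
    by (cases Z) (simp_all add: fkappa_def fcoact_def)
  show "fkappa Z x (\<lambda>u v. fcoact Z u (\<lambda>k w. F k (fM Z w v))) = F (fpr True x) (fe Z)"
    using can_kappaA[OF F, of x] fam.can_kappa_regular[OF F, of x]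
    by (cases Z) (simp_all only: kappa_True, simp_all add: fkappa_def fcoact_def fM_def fpr_def fe_def)
  show "fcoact Z x (\<lambda>g b. fkappa Z g (\<lambda>u v. F u (fM Z v b))) = F (fpr Z x) (fe Z)"
    using kappaA_can[OF F, of x] fam.kappa_can_regular[OF F, of x]
    by (cases Z) (simp_all only: kappa_True, simp_all add: fkappa_def fcoact_def fM_def fpr_def fe_def)
  show "fkappa True x F = fcoact True x (\<lambda>x y. F x (fS y))"
    by (rule kappa_True)
qed

sublocale cog: galois_cogroupoid True fpr fM fe fcoact feps fS fkappa tau flift fw
  by (rule cogroupoid)

abbreviation "CC \<equiv> cog.galois_cogpd UNIV"

lemma CC_sel: "acar (hopf_at CC X) = cog.hom_car X X" "ascale (hopf_at CC X) = fscale"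
  "amult (hopf_at CC X) = cog.hom_mult X X" "aone (hopf_at CC X) = cog.hom_one X X"
  "hcomult (hopf_at CC X) = cog.comult X X X" "hcounit (hopf_at CC X) = cog.counit X"
  "hantipode (hopf_at CC X) = cog.antipode X X" "homalg CC = cog.hom_alg" "comul CC = cog.comult"
  by (simp_all add: hopf_at_def cog.galois_cogpd_def kalg.defs hopf.defs cog.hom_alg_def)

lemma to_hom_mem: "cog.to_hom Z v \<in> cog.hom_car True Z"
  by (rule cog.to_hom_hom_car)

text \<open>
  Stated for a generic target \<open>B\<close> with the operations of \<open>C(h,Z)\<close>, because the Hopf algebra at an object and
  the Hom algebra of the cogroupoid are records of different types.
\<close>

lemma to_hom_alg_hom:
  fixes P :: "('k, 'p::ab_group_add, 'm) kalg_scheme" and E :: "'p \<Rightarrow> 'x list \<Rightarrow> 'k"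
  assumes r: "realisation P E R" and P: "is_algebra P" and pr: "fpr Z = (\<lambda>v. E (R v))" and e: "fe Z = E (aone P)"
    and M: "\<And>v w. fM Z v w = E (amult P (R v) (R w))"
    and B: "acar B = cog.hom_car True Z" "ascale B = fscale" "amult B = cog.hom_mult True Z" "aone B = cog.hom_one True Z"
  shows "alg_hom P B (\<lambda>x. cog.to_hom Z (E x))" "bij_betw (\<lambda>x. cog.to_hom Z (E x)) (acar P) (acar B)"
proof -
  have lin: "cog.to_hom Z (x + y) = cog.to_hom Z x + cog.to_hom Z y" "cog.to_hom Z (fscale c x) = fscale c (cog.to_hom Z x)" for x y c
    using cog.to_hom_lin[OF linv_id] by (simp_all only: linv_add linv_scale)
  have "cog.to_hom Z (E (amult P x y)) = cog.hom_mult True Z (cog.to_hom Z (E x)) (cog.to_hom Z (E y))"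
    if "x \<in> acar P" "y \<in> acar P" for x y
    using cog.to_hom_M[of Z "E x" "E y"] that realisationD(6)[OF r] by (simp add: M)
  moreover have "cog.to_hom Z (E (aone P)) = cog.hom_one True Z" using cog.to_hom_e[of Z] by (simp add: e)
  ultimately show "alg_hom P B (\<lambda>x. cog.to_hom Z (E x))"
    by (simp add: alg_hom_def linear_map_def B to_hom_mem realisationD(1,2)[OF r] lin)
  show "bij_betw (\<lambda>x. cog.to_hom Z (E x)) (acar P) (acar B)"
  proof (rule bij_betw_byWitness[where f'="\<lambda>c. R (cog.to_hom_inv Z c)"])
    show "\<forall>x\<in>acar P. R (cog.to_hom_inv Z (cog.to_hom Z (E x))) = x"
      by (simp add: cog.to_hom_inv_to_hom pr realisationD(5,6)[OF r])
    show "\<forall>c\<in>acar B. cog.to_hom Z (E (R (cog.to_hom_inv Z c))) = c"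
      using cog.pr_to_hom_inv[of Z] by (simp add: pr B cog.to_hom_to_hom_inv)
  qed (auto simp: B to_hom_mem realisationD(5)[OF r])
qed

abbreviation "\<phi> \<equiv> \<lambda>x. cog.to_hom True (EH x)"
abbreviation "\<psi> \<equiv> \<lambda>x. cog.to_hom False (EA x)"

lemma \<phi>: "alg_hom H (hopf_at CC True) \<phi>" "bij_betw \<phi> (acar H) (acar (hopf_at CC True))"
  by (rule to_hom_alg_hom[OF rH aH]; simp add: CC_sel fpr_def[abs_def] fe_def fM_def)+

lemma \<psi>: "alg_hom A (homalg CC True False) \<psi>" "bij_betw \<psi> (acar A) (acar (homalg CC True False))"
  by (rule to_hom_alg_hom[OF rA aA]; simp add: CC_sel fpr_def[abs_def] fe_def fM_def)+

lemma hopf_space: "is_space (hopf_at CC True)"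
  using cog.hom_alg_space[of True True] by (simp add: is_space_def CC_sel)

text \<open>
  Both sides are \<open>\<Sum> \<phi> x \<otimes> \<psi> y\<close>, summed over the coaction.  This is the comultiplication of \<open>\<phi>\<close> and the coaction of
  \<open>\<psi>\<close> at once.
\<close>

lemma comult_to_hom:
  fixes P :: "('k, 'p::ab_group_add, 'm) kalg_scheme" and E :: "'p \<Rightarrow> 'x list \<Rightarrow> 'k"
  assumes P: "is_space P" and B: "is_space B" "ascale B = fscale"
    and f: "linear_map P B (\<lambda>x. cog.to_hom Z (E x))" and xs: "legs_in H P xs"
    and v: "\<And>F :: _ \<Rightarrow> _ \<Rightarrow> 'k. fcoact Z v F = tsum xs (\<lambda>x y. F (EH x) (E y))"
  shows "cog.comult True Z True (cog.to_hom Z v)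
    = tmap H P (hopf_at CC True) B \<phi> (\<lambda>x. cog.to_hom Z (E x)) (tlist H P xs)"
proof
  fix \<beta>
  have l: "linear_map H (hopf_at CC True) \<phi>" using \<phi>(1) by (simp add: alg_hom_def)
  have bil: "bilinear_form (hopf_at CC True) B \<beta> \<longleftrightarrow> (\<forall>y. linf (\<lambda>x. \<beta> x y)) \<and> (\<forall>x. linf (\<beta> x))"
    by (rule bilinear_form_linf) (simp_all add: CC_sel B)
  have "cog.cosum True Z True (cog.to_hom Z v) \<beta> = tsum xs (\<lambda>x y. \<beta> (\<phi> x) (cog.to_hom Z (E y)))"
    if \<beta>: "\<And>y. linf (\<lambda>x. \<beta> x y)" "\<And>x. linf (\<beta> x)"
    unfolding cog.cosum_to_hom[OF \<beta>] by (rule v[of "\<lambda>x y. \<beta> (cog.to_hom True x) (cog.to_hom Z y)"])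
  then show "cog.comult True Z True (cog.to_hom Z v) \<beta>
    = tmap H P (hopf_at CC True) B \<phi> (\<lambda>x. cog.to_hom Z (E x)) (tlist H P xs) \<beta>"
    unfolding tmap_tlist[OF sH P hopf_space B(1) l f xs]
    by (simp add: tlist_apply bil cog.comult_def cog.bil_hom_alg tsum_map)
qed

lemma \<phi>_comult:
  assumes x: "x \<in> acar H"
  shows "cog.comult True True True (\<phi> x) = tmap H H (hopf_at CC True) (hopf_at CC True) \<phi> \<phi> (hcomult H x)"
  unfolding D.reps(2)[OF x]
  by (rule comult_to_hom[OF sH hopf_space _ _ D.reps(1)[OF x]])
    (use \<phi>(1) in \<open>auto simp: CC_sel alg_hom_def fcoact_def rep_fun_def REH[OF x]\<close>)

lemma \<psi>_coaction:
  assumes x: "x \<in> acar A"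
  shows "cog.comult True False True (\<psi> x) = tmap H A (hopf_at CC True) (homalg CC True False) \<phi> \<psi> (\<alpha> x)"
  unfolding C.reps(2)[OF x]
  by (rule comult_to_hom[OF sA _ _ _ C.reps(1)[OF x]])
    (use \<psi>(1) in \<open>auto simp: CC_sel cog.hom_alg_space alg_hom_def fcoact_def rep_fun_def REA[OF x]\<close>)

lemma cogroupoid_with_isos:
  "connected_cogroupoid CC" "ob CC = {True, False}" "hopf_iso H (hopf_at CC True) \<phi>"
  "comodule_algebra_iso H A \<alpha> (hopf_at CC True) (homalg CC True False) (comul CC True False True) \<phi> \<psi>"
proof -
  show "connected_cogroupoid CC" by (rule cog.galois_cogpd_connected)
  show "ob CC = {True, False}" by (auto simp: cog.galois_cogpd_def)
  show "hopf_iso H (hopf_at CC True) \<phi>"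
    using \<phi> by (simp add: hopf_iso_def CC_sel(5-7) \<phi>_comult cog.counit_to_hom cog.antipode_to_hom feps_def fS_def REH)
  show "comodule_algebra_iso H A \<alpha> (hopf_at CC True) (homalg CC True False) (comul CC True False True) \<phi> \<psi>"
    using \<psi> by (simp add: comodule_algebra_iso_def \<psi>_coaction) (simp add: CC_sel \<psi>_coaction)
qed

end

theorem theorem2p11:
  fixes H :: "('k::field, 'h::ab_group_add) hopf"
    and A :: "('k, 'a::ab_group_add) kalg"
    and \<alpha> :: "'a \<Rightarrow> ('h, 'a, 'k) tens"
  assumes "is_hopf H"
    and "left_galois_object H A \<alpha>"
  shows "\<exists>(C :: (bool, 'k, ('h + 'a) list \<Rightarrow> 'k) cogpd) X Y \<phi> \<psi>.
           connected_cogroupoid C \<and> ob C = {X, Y} \<and> X \<noteq> Y \<and>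
           hopf_iso H (hopf_at C X) \<phi> \<and>
           comodule_algebra_iso H A \<alpha> (hopf_at C X) (homalg C X Y) (comul C X Y X) \<phi> \<psi>"
proof -
  have sp: "is_space H" "is_space A"
    using assms by (auto simp: is_hopf_def left_galois_object_def left_comodule_algebra_def is_algebra_def)
  have inj: "inj (\<lambda>x. [Inl x :: 'h + 'a])" "inj (\<lambda>x. [Inr x :: 'h + 'a])"
    by (auto simp: inj_def)
  obtain EH :: "'h \<Rightarrow> ('h + 'a) list \<Rightarrow> 'k" and RH where rH: "realisation H EH RH"
      "\<And>x. finite {i. EH x i \<noteq> 0} \<and> {i. EH x i \<noteq> 0} \<subseteq> range (\<lambda>x. [Inl x])"
    using realisation_exists[OF sp(1) inj(1)] by metis
  obtain EA :: "'a \<Rightarrow> ('h + 'a) list \<Rightarrow> 'k" and RA where rA: "realisation A EA RA"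
      "\<And>x. finite {i. EA x i \<noteq> 0} \<and> {i. EA x i \<noteq> 0} \<subseteq> range (\<lambda>x. [Inr x])"
    using realisation_exists[OF sp(2) inj(2)] by metis
  have fin: "v \<in> acar Fin" if "finite {i. v i \<noteq> 0} \<and> {i. v i \<noteq> 0} \<subseteq> range (\<lambda>x. [c x])"
    for v :: "('h + 'a) list \<Rightarrow> 'k" and c :: "'z \<Rightarrow> 'h + 'a"
    using that by (auto simp: Fin_def)
  interpret galois_input_finite H A \<alpha> EH RH EA RA
    by unfold_locales (rule assms rH(1) rA(1) fin[OF rH(2)] fin[OF rA(2)])+
  show ?thesis
    using cogroupoid_with_isos by (intro exI[of _ CC] exI[of _ True] exI[of _ False] exI[of _ \<phi>] exI[of _ \<psi>]) simp
qed

end
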